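(* For every $p\in(0,1/2)$ there exist constants $c,\gamma_0,d_0$ such that the following holds. Choose any $\gamma, d\in\mathbb{Z}^+$ such that $\gamma\ge\gamma_0$, $\gamma \mid d$ and $\frac{d}{\gamma}\ge d_0$. For any $n$ divisible by $\gamma$, let $B\sim \mathrm{ABC}_{\gamma\text{-stacked}}(n,d)$. Then with constant probability over the choice of $B$ (i.e. with probability bounded below by a positive constant not depending on $n$), both $$\frac1n\,\mathbb{E}_{S\sim\binom{[n]}{pn}}\,\mathrm{err}(B,S)\ \le\ p^{\,d-c\log(d)} + o(1)$$ and $$\frac1n\max_{S\in\binom{[n]}{pn}}\mathrm{err}(B,S)\ \le\ \frac{8\gamma^3p}{d}+o(1),$$ where $o(1)$ is as $n\to\infty$.
   Context: Decoding error: for an assignment matrix $A_0\in\mathbb{R}^{N\times M}$ and a set $S\subset[M]$ of stragglers, $\mathrm{err}(A_0,S) := \min_{w\in\mathbb{R}^M:\ w_j=0\ \forall j\in S}\ |A_0w-\mathbbm{1}|_2^2$, where $\mathbbm{1}$ is the all-ones vector. $\binom{[n]}{pn}$ is the set of subsets of $[n]$ of size $pn$ (assumed an integer), and $S\sim\binom{[n]}{pn}$ means a uniformly random such subset. $\mathrm{ABC}(n,\gamma,d)$ is the distribution on matrices $A_0\in\{0,1\}^{\gamma n\times n}$ obtained as follows: create $\gamma n$ row-nodes with $d$ half-edges each and $n$ column-nodes with $\gamma d$ half-edges each; pair the $\gamma dn$ row half-edges with the $\gamma dn$ column half-edges by a uniformly random permutation; set $(A_0)_{ij}=1$ if and only if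 there is at least one edge from row-node $i$ to column-node $j$, and $0$ otherwise. For $\gamma,d,n\in\mathbb{Z}^+$ with $\gamma\mid d$ and $\gamma\mid n$, $\mathrm{ABC}_{\gamma\text{-stacked}}(n,d)$ is the distribution of the $n\times n$ matrix $B$ formed by sampling $A_0\sim\mathrm{ABC}(n/\gamma,\gamma,d/\gamma)$ (so that $A_0^\top$ is $(n/\gamma)\times n$) and vertically stacking $\gamma$ identical copies of $A_0^\top$. *)

theory Defs
  imports
    "HOL-Probability.Probability"
    "HOL-Combinatorics.Permutations"
    "Jordan_Normal_Form.Matrix"
begin

text \<open>
  Matrices are those of Jordan\_Normal\_Form, with rows and columns indexed from 0, so the index
  set [n] is \<open>{..<n}\<close>.

  In \<open>err\<close> the infimum is a minimum, being the squared Euclidean distance from the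
  all-ones vector to a subspace of a finite-dimensional space.
\<close>

definition err :: "real mat \<Rightarrow> nat set \<Rightarrow> real" where
  "err A S =
     (INF w \<in> {w \<in> carrier_vec (dim_col A). \<forall>j<dim_col A. j \<in> S \<longrightarrow> vec_index w j = 0}.
        \<Sum>i<dim_row A. (vec_index (mult_mat_vec A w) i - 1)\<^sup>2)"

definition subsets_of_card :: "nat \<Rightarrow> nat \<Rightarrow> nat set set" where
  "subsets_of_card n k = {S. S \<subseteq> {..<n} \<and> card S = k}"

text \<open>
  Configuration model. On each side the \<open>\<gamma> * d * n\<close> half-edges are numbered from 0;
  row half-edge \<open>h\<close> belongs to row-node \<open>h div d\<close>, column half-edge \<open>h\<close> belongs
  to column-node \<open>h div (\<gamma> * d)\<close>, and row half-edge \<open>h\<close> is paired with column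
  half-edge \<open>\<pi> h\<close>. Parallel edges are merged.
\<close>

definition biadjacency :: "nat \<Rightarrow> nat \<Rightarrow> nat \<Rightarrow> (nat \<Rightarrow> nat) \<Rightarrow> real mat" where
  "biadjacency n \<gamma> d \<pi> =
     mat (\<gamma> * n) n
       (\<lambda>(i, j). if \<exists>h<\<gamma> * d * n. h div d = i \<and> \<pi> h div (\<gamma> * d) = j then 1 else 0)"

definition ABC :: "nat \<Rightarrow> nat \<Rightarrow> nat \<Rightarrow> real mat pmf" where
  "ABC n \<gamma> d = map_pmf (biadjacency n \<gamma> d) (pmf_of_set {\<pi>. \<pi> permutes {..<\<gamma> * d * n}})"

definition vstack :: "nat \<Rightarrow> 'a mat \<Rightarrow> 'a mat" where
  "vstack m A = mat (m * dim_row A) (dim_col A) (\<lambda>(i, j). A $$ (i mod dim_row A, j))"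

definition ABC_stacked :: "nat \<Rightarrow> nat \<Rightarrow> nat \<Rightarrow> real mat pmf" where
  "ABC_stacked \<gamma> n d =
     map_pmf (\<lambda>A. vstack \<gamma> (transpose_mat A)) (ABC (n div \<gamma>) \<gamma> (d div \<gamma>))"

end

theory Submission
  imports Defs "HOL-Library.Function_Algebras"
begin

text \<open>
  Write \<open>e = d / \<gamma>\<close> and \<open>m = n / \<gamma>\<close>, so that each of the \<open>m\<close> distinct rows has \<open>d\<close> half-edges and each
  of the \<open>n\<close> columns has \<open>e\<close>. Only upper bounds on the decoding error are needed.

  Average error. The residual \<open>r\<close> of the least squares problem lies in the left kernel of the
  surviving columns, and \<open>|r|\<^sup>2 = \<Sum> r\<close>; hence the error is at most \<open>\<gamma>\<close> times the size of the support
  of a kernel vector. For a fixed \<open>S\<close>, with high probability every kernel vector \<open>x\<close> has support of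
  size at most \<open>exp 3 * p ^ d * m\<close>. If \<open>x\<close> vanishes outside a set of fewer than \<open>p\<^sup>2 * m / (4 * e)\<close>
  rows, no surviving column meets its support in exactly one half-edge; if \<open>x\<close> is a nonzero
  constant outside such a set, every surviving column meets that set. Both are excluded by a union
  bound. Otherwise no value dominates, a fresh random column is orthogonal to \<open>x\<close> with
  probability bounded away from 1, and each column that is not orthogonal raises the rank; as the
  rank is at most \<open>m\<close> and about \<open>\<gamma> * m / 16\<close> columns are exposed, such an \<open>x\<close> survives only with
  exponentially small probability. Markov's inequality over \<open>S\<close> finishes this half.

  Worst-case error. Constant weights on the survivors leave the squared deviations of the number
  of straggling half-edges per row. These have a bounded exponential moment, which beats the
  union bound over the \<open>2 ^ n\<close> sets \<open>S\<close> because the target exceeds the typical value by a factor of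
  order \<open>\<gamma>\<^sup>2\<close>. Rows with parallel edges are few and cost at most 1 each.
\<close>

section \<open>Random permutations and hit patterns\<close>

text \<open>Kernel vectors form a continuum, so a union bound over \<open>x\<close> is impossible;
  union bounds run over row sets only, at most \<open>2 ^ m\<close> of them. Exposure avoids
  choosing \<open>x\<close> in advance: a witness is taken from the columns already seen, and each
  new column that is not orthogonal to it is charged to the rank, at a total cost of
  \<open>2 ^ m\<close>. This works only if a fresh column fails with probability bounded below in
  terms of \<open>p\<close> alone, which is false for vectors with a dominant value; hence the
  separate first-moment treatment of those. The border \<open>p\<^sup>2 * m / (4 * e)\<close>
  between the two regimes is a compromise: below it the second-order error of the tilted
  first-moment bound stays under control, above it the \<open>e\<close> slots of a column meet an
  exceptional row with probability of order \<open>p\<^sup>2\<close>. The lower bound on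
  \<open>\<gamma>\<close> makes about \<open>\<gamma> * m / 16\<close> exposed columns outweigh the
  rank loss. The factors linear in \<open>m\<close> that come from conditioning on a cardinality are
  harmless, since \<open>\<gamma>\<close> and \<open>d\<close> are fixed and the decay in
  \<open>m\<close> is exponential.\<close>

lemma sum_Pow_binomial:
  fixes a b :: real
  assumes "finite B"
  shows "(\<Sum>Y\<in>Pow B. a ^ card Y * b ^ (card B - card Y)) = (a + b) ^ card B"
proof -
  have "(a + b) ^ card B = (\<Prod>i\<in>B. a + b)" by simp
  also have "\<dots> = (\<Sum>Y\<in>Pow B. (\<Prod>i\<in>Y. a) * (\<Prod>i\<in>B - Y. b))"
    using assms by (rule prod_add)
  also have "\<dots> = (\<Sum>Y\<in>Pow B. a ^ card Y * b ^ (card B - card Y))"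
    using assms by (intro sum.cong) (auto simp: card_Diff_subset finite_subset)
  finally show ?thesis by simp
qed

lemma sum_Pow_disjoint_UN:
  fixes g :: "'j \<Rightarrow> 'a set \<Rightarrow> real"
  assumes "finite J" "\<And>j. j \<in> J \<Longrightarrow> finite (B j)" "disjoint_family_on B J"
  shows "(\<Sum>X\<in>Pow (\<Union>j\<in>J. B j). \<Prod>j\<in>J. g j (X \<inter> B j)) = (\<Prod>j\<in>J. \<Sum>Y\<in>Pow (B j). g j Y)"
  using assms
proof (induction J rule: finite_induct)
  case empty
  then show ?case by simp
next
  case (insert i J)
  have disj: "B i \<inter> (\<Union>j\<in>J. B j) = {}"
    using insert.prems(2) insert.hyps(2) by (fastforce simp: disjoint_family_on_def)
  have IH: "(\<Sum>X\<in>Pow (\<Union>j\<in>J. B j). \<Prod>j\<in>J. g j (X \<inter> B j)) = (\<Prod>j\<in>J. \<Sum>Y\<in>Pow (B j). g j Y)"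
    using insert.prems by (intro insert.IH) (auto simp: disjoint_family_on_def)
  have "(\<Sum>X\<in>Pow (\<Union>j\<in>insert i J. B j). \<Prod>j\<in>insert i J. g j (X \<inter> B j))
      = (\<Sum>(Y, Z)\<in>Pow (B i) \<times> Pow (\<Union>j\<in>J. B j). g i Y * (\<Prod>j\<in>J. g j (Z \<inter> B j)))"
  proof (rule sum.reindex_bij_witness[where i = "\<lambda>(Y, Z). Y \<union> Z"
        and j = "\<lambda>X. (X \<inter> B i, X \<inter> (\<Union>j\<in>J. B j))"], goal_cases)
    case (5 X)
    have "X \<inter> (\<Union>j\<in>J. B j) \<inter> B j = X \<inter> B j" if "j \<in> J" for j
      using that by auto
    then show ?case using insert.hyps by simp
  qed (use disj in auto)
  also have "\<dots> = (\<Sum>Y\<in>Pow (B i). g i Y) * (\<Sum>Z\<in>Pow (\<Union>j\<in>J. B j). \<Prod>j\<in>J. g j (Z \<inter> B j))"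
    by (simp add: sum_product sum.cartesian_product)
  finally show ?case using IH insert.hyps by simp
qed

text \<open>Consecutive terms satisfy
  \<open>(j + 1) * (1 - q) * f (j + 1) = (N - j) * q * f j\<close>. By \<open>q * N = K\<close> the
  coefficient on the right is at least the one on the left for \<open>j < K\<close> and at most that
  from \<open>K\<close> on. In this cross-multiplied form the relation also covers
  \<open>q = 0\<close> and \<open>q = 1\<close>.\<close>

lemma binomial_pmf_le_mode:
  fixes q :: real
  assumes "K \<le> N" "0 < N" "q = real K / real N" "j \<le> N"
  shows "real (N choose j) * q ^ j * (1 - q) ^ (N - j) \<le> real (N choose K) * q ^ K * (1 - q) ^ (N - K)"
proof -
  define f where "f j = real (N choose j) * q ^ j * (1 - q) ^ (N - j)" for j
  have q: "0 \<le> q" "q \<le> 1" "q * N = K" using assms by auto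
  have ch: "real (Suc j) * real (N choose Suc j) = real (N - j) * real (N choose j)" for j
    using binomial_absorb_comp[of N j] binomial_absorption[of j N] by (metis of_nat_mult)
  have step: "real (Suc j) * (1 - q) * f (Suc j) = real (N - j) * q * f j" if "j < N" for j
  proof -
    have "N - j = Suc (N - Suc j)" using that by simp
    then have "real (Suc j) * (1 - q) * f (Suc j) = (real (Suc j) * real (N choose Suc j)) * q ^ Suc j * (1-q) ^ (N - j)"
      unfolding f_def by simp
    also have "\<dots> = real (N - j) * q * f j"
      unfolding ch f_def by simp
    finally show ?thesis .
  qed
  have f0: "f j \<ge> 0" for j using q by (simp add: f_def)
  have up: "f j \<le> f (Suc j)" if "j < K" for j
  proof -
    have "j < N" using that assms by simp
    have l: "real (Suc j) * (1 - q) \<le> real (N - j) * q"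
    proof -
      have "real (N - j) * q = K - j * q" using \<open>j < N\<close> q(3) by (simp add: of_nat_diff algebra_simps)
      moreover have "real (Suc j) * (1-q) \<le> real K - real j * q"
        using that q by (simp add: algebra_simps)
      ultimately show ?thesis by simp
    qed
    have qp: "q > 0" using that assms by simp
    have pos: "real (N - j) * q > 0" using \<open>j < N\<close> qp by simp
    have "real (N - j) * q * f j \<le> real (N - j) * q * f (Suc j)"
      using step[OF \<open>j < N\<close>] mult_right_mono[OF l f0[of "Suc j"]] by simp
    then show ?thesis using mult_le_cancel_left_pos[OF pos] by blast
  qed
  have down: "f (Suc j) \<le> f j" if "K \<le> j" "j < N" for j
  proof -
    have l: "real (N - j) * q \<le> real (Suc j) * (1 - q)"
    proof -
      have "real (N - j) * q = K - j * q" using that q(3) by (simp add: of_nat_diff algebra_simps)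
      moreover have "real K - real j * q \<le> real (Suc j) * (1-q)"
        using that q by (simp add: algebra_simps)
      ultimately show ?thesis by simp
    qed
    have "q < 1" using that assms by simp
    then have pos: "real (Suc j) * (1 - q) > 0" by simp
    have "real (Suc j) * (1 - q) * f (Suc j) \<le> real (Suc j) * (1 - q) * f j"
      using step[OF that(2)] mult_right_mono[OF l f0[of j]] by simp
    then show ?thesis using mult_le_cancel_left_pos[OF pos] by blast
  qed
  have "f j \<le> f K"
  proof (cases "j \<le> K")
    case True
    then show ?thesis
    proof (induction rule: inc_induct)
      case base then show ?case by simp
    next
      case (step n) then show ?case using up[of n] by linarith
    qed
  next
    case False
    then have "K \<le> j" by simp
    then show ?thesis using \<open>j \<le> N\<close>
    proof (induction rule: dec_induct)
      case base then show ?case by simp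
    next
      case (step n) then show ?case using down[of n] by simp
    qed
  qed
  then show ?thesis unfolding f_def .
qed

text \<open>The largest of the \<open>N + 1\<close> binomial probabilities is at least their
  average. The factor \<open>N + 1\<close> in the later bounds for random subsets originates
  here.\<close>

lemma binomial_mode_ge:
  fixes q :: real
  assumes "K \<le> N" "0 < N" "q = real K / real N"
  shows "1 \<le> real (N + 1) * (real (N choose K) * q ^ K * (1 - q) ^ (N - K))"
proof -
  have "1 = (q + (1 - q)) ^ N" by simp
  also have "\<dots> = (\<Sum>j\<le>N. real (N choose j) * q ^ j * (1 - q) ^ (N - j))"
    by (subst binomial_ring) simp
  also have "\<dots> \<le> (\<Sum>j\<le>N. real (N choose K) * q ^ K * (1 - q) ^ (N - K))"
    using binomial_pmf_le_mode[OF assms] by (intro sum_mono) auto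
  also have "\<dots> = real (N + 1) * (real (N choose K) * q ^ K * (1 - q) ^ (N - K))" by simp
  finally show ?thesis .
qed

text \<open>Left composition with \<open>\<sigma>\<close> injects the fibre of \<open>F\<close> over
  \<open>X\<close> into the fibre over \<open>Y\<close>, so transitivity on \<open>T\<close> forces
  all fibres to have the same size.\<close>

lemma map_pmf_permutation_uniform:
  assumes "finite V" and T: "finite T" "T \<noteq> {}" "\<And>\<pi>. \<pi> permutes V \<Longrightarrow> F \<pi> \<in> T"
    and trans: "\<And>X Y. X \<in> T \<Longrightarrow> Y \<in> T \<Longrightarrow>
      \<exists>\<sigma>. \<sigma> permutes V \<and> (\<forall>\<pi>. \<pi> permutes V \<longrightarrow> F \<pi> = X \<longrightarrow> F (\<sigma> \<circ> \<pi>) = Y)"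
  shows "map_pmf F (pmf_of_set {\<pi>. \<pi> permutes V}) = pmf_of_set T"
    (is "?L = _")
proof -
  let ?P = "{\<pi>. \<pi> permutes V}"
  have finP: "finite ?P" "?P \<noteq> {}" using assms finite_permutations permutes_id by blast+
  have pm: "pmf ?L Z = card {\<pi>. \<pi> permutes V \<and> F \<pi> = Z} / card ?P" for Z
    using finP by (simp add: pmf_map measure_pmf_of_set vimage_def Int_def)
  have le: "pmf ?L X \<le> pmf ?L Y" if XY: "X \<in> T" "Y \<in> T" for X Y
  proof -
    obtain \<sigma> where \<sigma>: "\<sigma> permutes V" "\<And>\<pi>. \<pi> permutes V \<Longrightarrow> F \<pi> = X \<Longrightarrow> F (\<sigma> \<circ> \<pi>) = Y"
      using trans[OF XY] by blast
    have "inj_on ((\<circ>) \<sigma>) {\<pi>. \<pi> permutes V \<and> F \<pi> = X}"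
    proof (rule inj_on_inverseI[where g = "(\<circ>) (inv_into UNIV \<sigma>)"])
      show "inv_into UNIV \<sigma> \<circ> (\<sigma> \<circ> \<pi>) = \<pi>" for \<pi> :: "'a \<Rightarrow> 'a"
        using permutes_inv_o(2)[OF \<sigma>(1)] by (simp add: comp_assoc[symmetric])
    qed
    moreover have "(\<circ>) \<sigma> ` {\<pi>. \<pi> permutes V \<and> F \<pi> = X} \<subseteq> {\<pi>. \<pi> permutes V \<and> F \<pi> = Y}"
      using \<sigma> permutes_compose[OF _ \<sigma>(1)] by auto
    moreover have "finite {\<pi>. \<pi> permutes V \<and> F \<pi> = Y}" using finP(1) by (rule rev_finite_subset) auto
    ultimately have "card {\<pi>. \<pi> permutes V \<and> F \<pi> = X} \<le> card {\<pi>. \<pi> permutes V \<and> F \<pi> = Y}"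
      by (rule card_inj_on_le)
    then show ?thesis unfolding pm by (simp add: divide_right_mono)
  qed
  have setL: "set_pmf ?L \<subseteq> T" using T finP by (auto simp: set_pmf_of_set)
  from T(2) obtain X0 where X0: "X0 \<in> T" by (meson ex_in_conv)
  have eq: "pmf ?L X = pmf ?L X0" if "X \<in> T" for X
    using le[OF that X0] le[OF X0 that] by (rule antisym)
  have "1 = (\<Sum>X\<in>T. pmf ?L X)" using sum_pmf_eq_1[OF T(1) setL] by simp
  also have "\<dots> = card T * pmf ?L X0" using eq by simp
  finally have v: "pmf ?L X0 = 1 / card T" using T by (simp add: field_simps)
  show ?thesis
  proof (rule pmf_eqI)
    fix X
    show "pmf ?L X = pmf (pmf_of_set T) X"
    proof (cases "X \<in> T")
      case True
      then show ?thesis using eq[OF True] v T by simp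
    next
      case False
      then have "X \<notin> set_pmf ?L" using setL by blast
      then have "pmf ?L X = 0" by (simp only: set_pmf_iff not_not)
      then show ?thesis using False T by simp
    qed
  qed
qed

lemma permutes_extend_bij:
  assumes "finite V" "X \<subseteq> V" "Y \<subseteq> V" "bij_betw f X Y"
  shows "\<exists>\<sigma>. \<sigma> permutes V \<and> (\<forall>x\<in>X. \<sigma> x = f x)"
proof -
  obtain g where g: "bij_betw g (V - X) (V - Y)"
  proof -
    have "card (V - X) = card (V - Y)"
      using assms bij_betw_same_card[OF assms(4)] card_Diff_subset[of X V] card_Diff_subset[of Y V]
        finite_subset[OF _ assms(1)] by auto
    then show ?thesis using finite_same_card_bij[of "V - X" "V - Y"] assms that by auto
  qed
  define \<sigma> where "\<sigma> v = (if v \<in> X then f v else if v \<in> V then g v else v)" for v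
  have "bij_betw \<sigma> (X \<union> (V - X)) (Y \<union> (V - Y))"
  proof (rule bij_betw_combine)
    show "bij_betw \<sigma> X Y" using assms(4) bij_betw_cong[of X \<sigma> f Y] by (simp add: \<sigma>_def)
    show "bij_betw \<sigma> (V - X) (V - Y)" using g bij_betw_cong[of "V - X" \<sigma> g "V - Y"] by (simp add: \<sigma>_def)
  qed auto
  then have "bij_betw \<sigma> V V" using assms by (simp add: Un_absorb1)
  then have "\<sigma> permutes V" using assms by (intro bij_imp_permutes) (auto simp: \<sigma>_def)
  then show ?thesis by (intro exI[of _ \<sigma>]) (simp add: \<sigma>_def)
qed

lemma map_pmf_permutation_image:
  assumes "finite V" "A \<subseteq> V"
  shows "map_pmf (\<lambda>\<pi>. \<pi> ` A) (pmf_of_set {\<pi>. \<pi> permutes V}) = pmf_of_set {X. X \<subseteq> V \<and> card X = card A}"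
proof (rule map_pmf_permutation_uniform)
  show "{X. X \<subseteq> V \<and> card X = card A} \<noteq> {}" using assms by auto
  show "\<pi> ` A \<in> {X. X \<subseteq> V \<and> card X = card A}" if "\<pi> permutes V" for \<pi>
    using that assms by (auto simp: card_image permutes_inj_on permutes_in_image)
  fix X Y assume X: "X \<in> {X. X \<subseteq> V \<and> card X = card A}" and Y: "Y \<in> {X. X \<subseteq> V \<and> card X = card A}"
  obtain f where f: "bij_betw f X Y"
    using X Y finite_same_card_bij[of X Y] finite_subset[OF _ assms(1)] by auto
  obtain \<sigma> where \<sigma>: "\<sigma> permutes V" "\<forall>x\<in>X. \<sigma> x = f x"
    using permutes_extend_bij[OF assms(1) _ _ f] X Y by auto
  have "\<sigma> ` X = Y" using \<sigma>(2) f by (auto simp: bij_betw_def)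
  then show "\<exists>\<sigma>. \<sigma> permutes V \<and> (\<forall>\<pi>. \<pi> permutes V \<longrightarrow> \<pi> ` A = X \<longrightarrow> (\<sigma> \<circ> \<pi>) ` A = Y)"
    using \<sigma>(1) by (intro exI[of _ \<sigma>] conjI allI impI) (simp_all only: image_comp[symmetric])
qed (use assms in auto)

lemma set_pmf_permutations:
  "finite V \<Longrightarrow> set_pmf (pmf_of_set {\<pi>. \<pi> permutes V}) = {\<pi>. \<pi> permutes V}"
proof (rule set_pmf_of_set)
  show "{\<pi>. \<pi> permutes V} \<noteq> {}" using permutes_id by blast
qed (simp add: finite_permutations)

lemma map_pmf_permutation_inv:
  assumes "finite V"
  shows "map_pmf (inv_into UNIV) (pmf_of_set {\<pi>. \<pi> permutes V}) = pmf_of_set {\<pi>. \<pi> permutes V}"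
proof -
  have "inj_on (inv_into UNIV) {\<pi>. \<pi> permutes V}"
    by (rule inj_on_inverseI[where g = "inv_into UNIV"]) (simp add: permutes_inv_inv)
  moreover have "(inv_into UNIV) ` {\<pi>. \<pi> permutes V} = {\<pi>. \<pi> permutes V}"
  proof (rule equalityI; rule subsetI)
    fix \<pi> assume "\<pi> \<in> {\<pi>. \<pi> permutes V}"
    then have "inv_into UNIV \<pi> \<in> {\<pi>. \<pi> permutes V}" "\<pi> = inv_into UNIV (inv_into UNIV \<pi>)"
      by (auto simp: permutes_inv_inv intro: permutes_inv)
    then show "\<pi> \<in> inv_into UNIV ` {\<pi>. \<pi> permutes V}" by (intro image_eqI)
  qed (auto intro: permutes_inv)
  ultimately show ?thesis
    using assms finite_permutations[of V] permutes_id[of V]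
      map_pmf_of_set_inj[of "inv_into UNIV" "{\<pi>. \<pi> permutes V}"] by (metis (lifting) empty_iff mem_Collect_eq)
qed

text \<open>A preimage is an image under the inverse, and inversion preserves the uniform law.
  Preimages occur because \<open>row_edges\<close> collects the half-edges that are sent to given
  rows.\<close>

lemma map_pmf_permutation_vimage:
  assumes "finite V" "A \<subseteq> V"
  shows "map_pmf (\<lambda>\<pi>. {h \<in> V. \<pi> h \<in> A}) (pmf_of_set {\<pi>. \<pi> permutes V})
    = pmf_of_set {X. X \<subseteq> V \<and> card X = card A}"
proof -
  have "map_pmf (\<lambda>\<pi>. {h \<in> V. \<pi> h \<in> A}) (pmf_of_set {\<pi>. \<pi> permutes V})
      = map_pmf (\<lambda>\<pi>. inv_into UNIV \<pi> ` A) (pmf_of_set {\<pi>. \<pi> permutes V})"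
  proof (rule map_pmf_cong)
    fix \<pi> assume "\<pi> \<in> set_pmf (pmf_of_set {\<pi>. \<pi> permutes V})"
    then have \<pi>: "\<pi> permutes V"
      using assms finite_permutations[of V] permutes_id[of V] set_pmf_of_set[of "{\<pi>. \<pi> permutes V}"] by blast
    show "{h \<in> V. \<pi> h \<in> A} = inv_into UNIV \<pi> ` A"
    proof (intro Set.set_eqI iffI)
      fix h assume "h \<in> {h \<in> V. \<pi> h \<in> A}"
      then show "h \<in> inv_into UNIV \<pi> ` A" using permutes_inverses(2)[OF \<pi>, of h] by (intro image_eqI[of _ _ "\<pi> h"]) auto
    next
      fix h assume "h \<in> inv_into UNIV \<pi> ` A"
      then show "h \<in> {h \<in> V. \<pi> h \<in> A}"
        using assms permutes_inverses(1)[OF \<pi>] permutes_in_image[OF permutes_inv[OF \<pi>]] by auto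
    qed
  qed simp
  also have "\<dots> = map_pmf (\<lambda>\<pi>. \<pi> ` A) (map_pmf (inv_into UNIV) (pmf_of_set {\<pi>. \<pi> permutes V}))"
    by (simp add: pmf.map_comp o_def)
  also have "\<dots> = pmf_of_set {X. X \<subseteq> V \<and> card X = card A}"
    using map_pmf_permutation_inv[OF assms(1)] map_pmf_permutation_image[OF assms] by simp
  finally show ?thesis .
qed

text \<open>
  The blocks of a uniformly random \<open>K\<close>-subset behave like independent blocks of Bernoulli
  variables with parameter \<open>K / N\<close>, up to the factor \<open>N + 1\<close> that is the price for
  conditioning on the cardinality; \<open>s\<close> is a free tilting parameter.
\<close>
lemma prob_uniform_subset_le:
  fixes g :: "'j \<Rightarrow> 'a set \<Rightarrow> real" and q s :: real
  assumes J: "finite J" "\<And>j. j \<in> J \<Longrightarrow> finite (B j)" "disjoint_family_on B J" "(\<Union>j\<in>J. B j) = V"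
    and N: "card V = N" "0 < N" "K \<le> N" "q = real K / real N" and "0 < s"
    and g0: "\<And>j Y. j \<in> J \<Longrightarrow> 0 \<le> g j Y"
    and Q: "\<And>X. X \<subseteq> V \<Longrightarrow> card X = K \<Longrightarrow> Q X \<Longrightarrow> 1 \<le> (\<Prod>j\<in>J. g j (X \<inter> B j))"
  shows "measure_pmf.prob (pmf_of_set {X. X \<subseteq> V \<and> card X = K}) {X. Q X}
    \<le> real (N + 1) * inverse s ^ K
        * (\<Prod>j\<in>J. \<Sum>Y\<in>Pow (B j). g j Y * ((q * s) ^ card Y * (1 - q) ^ (card (B j) - card Y)))"
proof -
  let ?F = "{X. X \<subseteq> V \<and> card X = K}"
  have finV: "finite V" using J by auto
  have cF: "card ?F = N choose K" using n_subsets[OF finV] N by simp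
  have F: "finite ?F" "?F \<noteq> {}"
    using cF N zero_less_binomial[of K N] card_gt_0_iff[of ?F] by simp_all
  have q: "0 \<le> q" "q \<le> 1" using N by auto
  let ?G = "{X\<in>?F. Q X}"
  let ?h = "\<lambda>j Y. g j Y * ((q * s) ^ card Y * (1 - q) ^ (card (B j) - card Y))"
  let ?w = "q ^ K * (1 - q) ^ (N - K)"
  have w: "(\<Prod>j\<in>J. ?h j (X \<inter> B j)) = (\<Prod>j\<in>J. g j (X \<inter> B j)) * (s ^ K * ?w)" if X: "X \<in> ?F" for X
  proof -
    have finX: "finite X" using X finV finite_subset by auto
    have dis: "\<forall>i\<in>J. \<forall>j\<in>J. i \<noteq> j \<longrightarrow> (X \<inter> B i) \<inter> (X \<inter> B j) = {}"
      using J(3) by (auto simp: disjoint_family_on_def)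
    have dis': "\<forall>i\<in>J. \<forall>j\<in>J. i \<noteq> j \<longrightarrow> B i \<inter> B j = {}"
      using J(3) by (auto simp: disjoint_family_on_def)
    have c1: "(\<Sum>j\<in>J. card (X \<inter> B j)) = K"
    proof -
      have "X = (\<Union>j\<in>J. X \<inter> B j)" using X J by auto
      then have "card X = (\<Sum>j\<in>J. card (X \<inter> B j))"
        using card_UN_disjoint[OF J(1) _ dis] finX by auto
      then show ?thesis using X by simp
    qed
    have c2: "(\<Sum>j\<in>J. card (B j)) = N"
      using card_UN_disjoint[OF J(1) _ dis'] J N by auto
    have c3: "(\<Sum>j\<in>J. card (B j) - card (X \<inter> B j)) = N - K"
      using J c1 c2 by (subst sum_subtractf_nat) (auto intro: card_mono)
    have "(\<Prod>j\<in>J. ?h j (X \<inter> B j))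
       = (\<Prod>j\<in>J. g j (X \<inter> B j)) * ((\<Prod>j\<in>J. (q * s) ^ card (X \<inter> B j)) * (\<Prod>j\<in>J. (1 - q) ^ (card (B j) - card (X \<inter> B j))))"
      by (simp add: prod.distrib)
    also have "\<dots> = (\<Prod>j\<in>J. g j (X \<inter> B j)) * ((q * s) ^ K * (1 - q) ^ (N - K))"
      unfolding power_sum[symmetric] c1 c3 ..
    finally show ?thesis by (simp only: power_mult_distrib mult_ac)
  qed
  have "measure_pmf.prob (pmf_of_set ?F) {X. Q X} = card ?G / (N choose K)"
    using F cF by (simp add: measure_pmf_of_set Int_def)
  \<comment> \<open>A single \<open>K\<close>-set has probability \<open>1 / (N choose K)\<close>,
    which is at most \<open>N + 1\<close> times its weight under independent Bernoulli choices with
    parameter \<open>q\<close>.\<close>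
  also have "\<dots> \<le> card ?G * (real (N + 1) * ?w)"
  proof -
    have "1 \<le> real (N + 1) * (real (N choose K) * q ^ K * (1 - q) ^ (N - K))"
      using binomial_mode_ge N by blast
    moreover have "real (N choose K) > 0" using N by simp
    ultimately have "1 / real (N choose K) \<le> real (N + 1) * ?w"
      by (subst pos_divide_le_eq) (simp_all only: mult_ac)
    from mult_left_mono[OF this, of "real (card ?G)"] show ?thesis by simp
  qed
  \<comment> \<open>On sets of size \<open>K\<close> the tilt is the constant \<open>s ^ K\<close>
    and can be inserted for free; it takes effect only when the sum is enlarged to all
    subsets.\<close>
  also have "\<dots> = real (N + 1) * inverse s ^ K * (\<Sum>X\<in>?G. s ^ K * ?w)"
  proof -
    have e: "inverse s ^ K * (s ^ K * ?w) = ?w"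
      using \<open>0 < s\<close> by (simp add: power_inverse)
    have "real (N + 1) * inverse s ^ K * (\<Sum>X\<in>?G. s ^ K * ?w)
        = real (N + 1) * card ?G * (inverse s ^ K * (s ^ K * ?w))"
      by (simp only: sum_constant mult_ac)
    then show ?thesis unfolding e by (simp only: mult_ac)
  qed
  also have "\<dots> \<le> real (N + 1) * inverse s ^ K * (\<Sum>X\<in>Pow V. \<Prod>j\<in>J. ?h j (X \<inter> B j))"
  proof (intro mult_left_mono)
    have "(\<Sum>X\<in>?G. s ^ K * ?w) \<le> (\<Sum>X\<in>?G. \<Prod>j\<in>J. ?h j (X \<inter> B j))"
    proof (rule sum_mono)
      fix X assume X: "X \<in> ?G"
      then have "1 \<le> (\<Prod>j\<in>J. g j (X \<inter> B j))" using Q by auto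
      from mult_right_mono[OF this, of "s ^ K * ?w"]
      show "s ^ K * ?w \<le> (\<Prod>j\<in>J. ?h j (X \<inter> B j))"
        using w[of X] X q \<open>0 < s\<close> by simp
    qed
    also have "\<dots> \<le> (\<Sum>X\<in>Pow V. \<Prod>j\<in>J. ?h j (X \<inter> B j))"
      using finV g0 q \<open>0 < s\<close>
      by (intro sum_mono2) (auto intro!: prod_nonneg mult_nonneg_nonneg)
    finally show "(\<Sum>X\<in>?G. s ^ K * ?w) \<le> (\<Sum>X\<in>Pow V. \<Prod>j\<in>J. ?h j (X \<inter> B j))" .
  qed (use \<open>0 < s\<close> in auto)
  also have "(\<Sum>X\<in>Pow V. \<Prod>j\<in>J. ?h j (X \<inter> B j)) = (\<Prod>j\<in>J. \<Sum>Y\<in>Pow (B j). ?h j Y)"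
    using sum_Pow_disjoint_UN[OF J(1-3), of ?h] J(4) by simp
  finally show ?thesis .
qed

section \<open>Rank and sequential exposure\<close>

interpretation fun_space: vector_space "\<lambda>(c::real) (f::nat \<Rightarrow> real) i. c * f i"
  by unfold_locales (auto simp: fun_eq_iff algebra_simps)

text \<open>The rank of the 0-1 matrix with the members of \<open>C\<close> as columns. Repeated
  columns merge in the set, which does not change the rank.\<close>

definition set_rank :: "nat set set \<Rightarrow> nat" where
  "set_rank C = fun_space.dim ((indicator :: nat set \<Rightarrow> nat \<Rightarrow> real) ` C)"

lemma set_rank_le:
  assumes "\<And>s. s \<in> C \<Longrightarrow> s \<subseteq> {..<m}"
  shows "set_rank C \<le> m"
proof -
  let ?W = "(\<lambda>i. indicator {i} :: nat \<Rightarrow> real) ` {..<m}"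
  have "(indicator s :: nat \<Rightarrow> real) \<in> fun_space.span ?W" if "s \<in> C" for s
  proof -
    have fin: "finite s" using assms[OF that] finite_subset by blast
    have "(indicator s :: nat \<Rightarrow> real) = (\<Sum>i\<in>s. indicator {i})"
    proof
      fix j
      have "(\<Sum>i\<in>s. indicator {i} :: nat \<Rightarrow> real) j = (\<Sum>i\<in>s. indicator {i} j)"
        using fin by (induction s rule: finite_induct) auto
      also have "\<dots> = indicator s j"
        using fin by (simp add: indicator_def of_bool_def sum.If_cases)
      finally show "indicator s j = (\<Sum>i\<in>s. indicator {i} :: nat \<Rightarrow> real) j" by simp
    qed
    also have "\<dots> \<in> fun_space.span ?W"
      using assms[OF that] by (intro fun_space.span_sum fun_space.span_base) auto
    finally show ?thesis .
  qed
  then have "set_rank C \<le> card ?W"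
    unfolding set_rank_def by (intro fun_space.dim_le_card) auto
  also have "\<dots> \<le> m" using card_image_le[of "{..<m}"] by simp
  finally show ?thesis .
qed

lemma fun_space_dim_insert:
  assumes "finite S" "v \<notin> fun_space.span S"
  shows "fun_space.dim (insert v S) = Suc (fun_space.dim S)"
proof -
  obtain B where B: "B \<subseteq> S" "fun_space.independent B" "S \<subseteq> fun_space.span B" "card B = fun_space.dim S"
    using fun_space.basis_exists[of S] by blast
  have finB: "finite B" using B assms finite_subset by blast
  have "v \<notin> fun_space.span B"
    using assms B fun_space.span_mono by blast
  then have "fun_space.independent (insert v B)" "v \<notin> B"
    using B fun_space.independent_insertI fun_space.span_base by blast+
  moreover have "insert v S \<subseteq> fun_space.span (insert v B)"
    using B fun_space.span_mono[of B "insert v B"] fun_space.span_base[of v "insert v B"] by blast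
  ultimately have "card (insert v B) = fun_space.dim (insert v S)"
    using B by (intro fun_space.basis_card_eq_dim) auto
  then show ?thesis using finB \<open>v \<notin> B\<close> B by simp
qed

lemma set_rank_mono_insert:
  assumes "finite C" shows "set_rank C \<le> set_rank (insert t C)"
proof (cases "(indicator t :: nat \<Rightarrow> real) \<in> fun_space.span (indicator ` C)")
  case True
  then have "fun_space.span (insert (indicator t) (indicator ` C)) = fun_space.span ((indicator :: nat set \<Rightarrow> nat \<Rightarrow> real) ` C)"
    by (rule fun_space.span_redundant)
  then show ?thesis unfolding set_rank_def image_insert by (metis fun_space.dim_span order_refl)
next
  case False
  then show ?thesis using fun_space_dim_insert[of "indicator ` C" "indicator t"] assms
    by (simp add: set_rank_def)
qed

text \<open>Summation against \<open>x\<close> is a linear functional that vanishes on the span of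
  the old columns but not on the new one.\<close>

lemma set_rank_insert:
  fixes x :: "nat \<Rightarrow> real"
  assumes "finite C" and C: "\<And>s. s \<in> C \<Longrightarrow> s \<subseteq> {..<m}" "t \<subseteq> {..<m}"
    and "\<And>s. s \<in> C \<Longrightarrow> (\<Sum>i\<in>s. x i) = 0" "(\<Sum>i\<in>t. x i) \<noteq> 0"
  shows "set_rank (insert t C) = Suc (set_rank C)"
proof -
  have ind: "(\<Sum>i<m. x i * indicator s i) = (\<Sum>i\<in>s. x i)" if "s \<subseteq> {..<m}" for s
    using that by (simp add: indicator_def of_bool_def if_distrib sum.If_cases Int_absorb1 cong: if_cong)
  have orth: "(\<Sum>i<m. x i * f i) = 0" if "f \<in> fun_space.span (indicator ` C)" for f
    using that
  proof (induction rule: fun_space.span_induct_alt)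
    case base
    then show ?case by simp
  next
    case (step c f g)
    then obtain s where "s \<in> C" "f = indicator s" by auto
    then have "(\<Sum>i<m. x i * f i) = 0" using ind[of s] assms by auto
    then have "(\<Sum>i<m. c * (x i * f i)) = 0" by (simp flip: sum_distrib_left)
    then show ?case using step by (simp add: algebra_simps sum.distrib)
  qed
  have "(indicator t :: nat \<Rightarrow> real) \<notin> fun_space.span (indicator ` C)"
    using orth[of "indicator t"] ind[of t] C(2) assms(5) by metis
  then show ?thesis
    using fun_space_dim_insert[of "indicator ` C" "indicator t"] assms by (simp add: set_rank_def)
qed

section \<open>Lists of distinct half-edges: the values of a random permutation on given
  slots\<close>

definition dlists :: "'a set \<Rightarrow> nat \<Rightarrow> 'a list set" where
  "dlists V k = {xs. length xs = k \<and> distinct xs \<and> set xs \<subseteq> V}"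

lemma dlists_0 [simp]: "dlists V 0 = {[]}"
  by (auto simp: dlists_def)

lemma finite_dlists [simp]: "finite V \<Longrightarrow> finite (dlists V k)"
  unfolding dlists_def using finite_lists_length_eq[of V k] by (rule finite_subset[rotated]) auto

lemma card_dlists_cong: "finite V \<Longrightarrow> finite W \<Longrightarrow> card V = card W \<Longrightarrow> card (dlists V k) = card (dlists W k)"
proof -
  assume *: "finite V" "finite W" "card V = card W"
  then obtain f where f: "bij_betw f V W" using finite_same_card_bij by blast
  have "bij_betw (map f) (dlists V k) (dlists W k)"
  proof (rule bij_betw_byWitness[where f' = "map (inv_into V f)"])
    show "\<forall>xs\<in>dlists V k. map (inv_into V f) (map f xs) = xs"
      using f by (auto simp: dlists_def bij_betw_def intro!: map_idI)
    show "\<forall>xs\<in>dlists W k. map f (map (inv_into V f) xs) = xs"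
      using f by (auto simp: dlists_def bij_betw_def f_inv_into_f intro!: map_idI)
    show "map f ` dlists V k \<subseteq> dlists W k"
      using f by (auto simp: dlists_def bij_betw_def distinct_map intro: inj_on_subset) blast
    show "map (inv_into V f) ` dlists W k \<subseteq> dlists V k"
      using f by (auto simp: dlists_def bij_betw_def distinct_map
          intro: inj_on_subset[OF inj_on_inv_into]) (metis inv_into_into subsetD)
  qed
  then show ?thesis by (rule bij_betw_same_card)
qed

lemma sum_dlists_append:
  fixes f :: "'a list \<Rightarrow> real"
  assumes "finite V"
  shows "sum f (dlists V (k + l)) = (\<Sum>xs\<in>dlists V k. \<Sum>ys\<in>dlists (V - set xs) l. f (xs @ ys))"
proof -
  have "sum f (dlists V (k + l)) = (\<Sum>(xs, ys)\<in>(SIGMA xs:dlists V k. dlists (V - set xs) l). f (xs @ ys))"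
  proof (rule sum.reindex_bij_witness[where i = "\<lambda>(xs, ys). xs @ ys" and j = "\<lambda>zs. (take k zs, drop k zs)"],
      goal_cases)
    case (2 zs)
    then have "set (take k zs) \<inter> set (drop k zs) = {}"
      by (intro set_take_disj_set_drop_if_distinct) (auto simp: dlists_def)
    then show ?case using 2 set_take_subset[of k zs] set_drop_subset[of k zs]
      by (auto simp: dlists_def)
  qed (auto simp: dlists_def)
  also have "\<dots> = (\<Sum>xs\<in>dlists V k. \<Sum>ys\<in>dlists (V - set xs) l. f (xs @ ys))"
    using assms by (subst sum.Sigma) auto
  finally show ?thesis .
qed

lemma card_dlists_append:
  assumes "finite V"
  shows "real (card (dlists V (k + l))) = (\<Sum>xs\<in>dlists V k. real (card (dlists (V - set xs) l)))"
  using sum_dlists_append[OF assms, of "\<lambda>_. 1"] by simp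

lemma card_dlists_le: "finite V \<Longrightarrow> card (dlists V k) \<le> card V ^ k"
proof -
  assume "finite V"
  then have "card (dlists V k) \<le> card {xs. set xs \<subseteq> V \<and> length xs = k}"
    by (intro card_mono finite_lists_length_eq) (auto simp: dlists_def)
  then show ?thesis using card_lists_length_eq[OF \<open>finite V\<close>] by simp
qed

text \<open>
  Row-nodes are neither repeated nor taken from \<open>F\<close>, so merging parallel edges has no effect and
  a column sum becomes a sum over the list.
\<close>
definition clean_lists :: "nat set \<Rightarrow> nat \<Rightarrow> (nat \<Rightarrow> real) \<Rightarrow> real \<Rightarrow> nat \<Rightarrow> nat \<Rightarrow> nat set \<Rightarrow> nat list set" where
  "clean_lists P D x a k L F = {ys. length ys = L \<and> set ys \<subseteq> P \<and> distinct (map (\<lambda>h. h div D) ys) \<and>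
     (\<forall>h\<in>set ys. h div D \<notin> F) \<and> length (filter (\<lambda>h. x (h div D) \<noteq> a) ys) = k}"

lemma clean_lists_sum:
  assumes "finite F" "ys \<in> clean_lists P D x a k L F"
  shows "(\<Sum>i\<in>F \<union> (\<lambda>h. h div D) ` set ys. x i) = (\<Sum>i\<in>F. x i) + (\<Sum>h\<leftarrow>ys. x (h div D))"
proof -
  have "(\<Sum>i\<in>F \<union> (\<lambda>h. h div D) ` set ys. x i) = (\<Sum>i\<in>F. x i) + (\<Sum>i\<in>(\<lambda>h. h div D) ` set ys. x i)"
    using assms by (intro sum.union_disjoint) (auto simp: clean_lists_def)
  also have "(\<Sum>i\<in>(\<lambda>h. h div D) ` set ys. x i) = (\<Sum>i\<leftarrow>map (\<lambda>h. h div D) ys. x i)"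
    using assms by (subst sum_list_distinct_conv_sum_set) (auto simp: clean_lists_def)
  finally show ?thesis by (simp add: comp_def)
qed

lemma clean_lists_0_sum:
  assumes "ys \<in> clean_lists P D x a 0 L F"
  shows "(\<Sum>h\<leftarrow>ys. x (h div D)) = real L * a"
proof -
  have "\<forall>h\<in>set ys. x (h div D) = a" using assms by (auto simp: clean_lists_def filter_empty_conv)
  then have "(\<Sum>h\<leftarrow>ys. x (h div D)) = real (length ys) * a"
    by (induction ys) (auto simp: algebra_simps)
  then show ?thesis using assms by (simp add: clean_lists_def)
qed

lemma clean_lists_1_sum:
  assumes "ys \<in> clean_lists P D x a 1 L F"
  shows "\<exists>b. b \<noteq> a \<and> (\<Sum>h\<leftarrow>ys. x (h div D)) = (real L - 1) * a + b"
proof -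
  have key: "\<exists>b. b \<noteq> a \<and> (\<Sum>h\<leftarrow>ys. x (h div D)) = (real (length ys) - 1) * a + b"
    if "length (filter (\<lambda>h. x (h div D) \<noteq> a) ys) = 1" for ys
    using that
  proof (induction ys)
    case (Cons h ys)
    show ?case
    proof (cases "x (h div D) = a")
      case True
      then show ?thesis using Cons by (auto simp: algebra_simps)
    next
      case False
      then have "filter (\<lambda>h. x (h div D) \<noteq> a) ys = []" using Cons.prems by simp
      then have "\<forall>h\<in>set ys. x (h div D) = a" by (simp add: filter_empty_conv)
      then have "(\<Sum>h\<leftarrow>ys. x (h div D)) = real (length ys) * a"
        by (induction ys) (auto simp: algebra_simps)
      then show ?thesis using False by (intro exI[of _ "x (h div D)"]) (auto simp: algebra_simps)
    qed
  qed simp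
  show ?thesis using key[of ys] assms by (auto simp: clean_lists_def)
qed

lemma finite_clean_lists: "finite P \<Longrightarrow> finite (clean_lists P D x a k L F)"
  unfolding clean_lists_def using finite_lists_length_eq[of P L] by (rule finite_subset[rotated]) auto

lemma clean_lists_subset_dlists:
  "clean_lists P D x a k L ((\<lambda>h. h div D) ` set zs) \<subseteq> dlists (P - set zs) L"
  by (auto simp: clean_lists_def dlists_def distinct_map)

lemma div_eq_iff_interval: "0 < (e::nat) \<Longrightarrow> h div e = c \<longleftrightarrow> h \<in> {c * e..<c * e + e}"
  using div_nat_eqI[of e c h] div_times_less_eq_dividend[of h e] dividend_less_div_times[of e h]
  by (auto simp: algebra_simps)

lemma card_div_vimage:
  fixes U :: "nat set"
  assumes "finite U" "0 < D"
  shows "card {h. h div D \<in> U} = D * card U" "finite {h. h div D \<in> U}"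
proof -
  have bij: "bij_betw (\<lambda>h. (h div D, h mod D)) {h. h div D \<in> U} (U \<times> {..<D})"
    by (rule bij_betw_byWitness[where f' = "\<lambda>(i, r). i * D + r"]) (use assms in auto)
  show "card {h. h div D \<in> U} = D * card U"
    using bij_betw_same_card[OF bij] by (simp add: card_cartesian_product)
  show "finite {h. h div D \<in> U}" using bij_betw_finite[OF bij] assms by simp
qed

text \<open>Recursion on the first entry: a half-edge from \<open>H\<close> leaves the number of
  exceptions unchanged, one from \<open>G\<close> adds one. Its row joins the forbidden set, which
  keeps the later rows different from it. An injection suffices for the lower bounds in
  view.\<close>

lemma card_clean_lists_Cons:
  assumes "finite P" "0 < D" "finite F" and H: "H \<subseteq> P" "H \<inter> {h. h div D \<in> F} = {}"
    and G: "G \<subseteq> P" "G \<inter> {h. h div D \<in> F} = {}"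
    and Ha: "\<And>h. h \<in> H \<Longrightarrow> x (h div D) = a" and Ga: "\<And>h. h \<in> G \<Longrightarrow> x (h div D) \<noteq> a"
  shows "(\<Sum>h\<in>H. card (clean_lists P D x a (Suc k) L (insert (h div D) F)))
       + (\<Sum>h\<in>G. card (clean_lists P D x a k L (insert (h div D) F)))
       \<le> card (clean_lists P D x a (Suc k) (Suc L) F)"
    and "(\<Sum>h\<in>H. card (clean_lists P D x a 0 L (insert (h div D) F)))
       \<le> card (clean_lists P D x a 0 (Suc L) F)"
proof -
  let ?C = "\<lambda>k h. (#) h ` clean_lists P D x a k L (insert (h div D) F)"
  have fin: "finite H" "finite G" using assms finite_subset by blast+
  have c: "card (\<Union>h\<in>A. ?C k h) = (\<Sum>h\<in>A. card (clean_lists P D x a k L (insert (h div D) F)))"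
    if "finite A" for A k
  proof -
    have "card (\<Union>h\<in>A. ?C k h) = (\<Sum>h\<in>A. card (?C k h))"
      using that by (intro card_UN_disjoint) (auto intro: finite_clean_lists assms)
    then show ?thesis by (simp add: card_image)
  qed
  have mem: "h # ys \<in> clean_lists P D x a k' (Suc L) F"
    if "ys \<in> clean_lists P D x a k L (insert (h div D) F)" "h \<in> P" "h div D \<notin> F"
      "k' = (if x (h div D) = a then k else Suc k)" for h ys k k'
  proof -
    have "h div D \<notin> (\<lambda>h. h div D) ` set ys"
      using that(1) unfolding clean_lists_def by fastforce
    then show ?thesis using that by (auto simp: clean_lists_def)
  qed
  have sub1: "(\<Union>h\<in>H. ?C (Suc k) h) \<subseteq> clean_lists P D x a (Suc k) (Suc L) F"
    and sub2: "(\<Union>h\<in>G. ?C k h) \<subseteq> clean_lists P D x a (Suc k) (Suc L) F"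
    and sub3: "(\<Union>h\<in>H. ?C 0 h) \<subseteq> clean_lists P D x a 0 (Suc L) F"
    using H G by (force intro!: mem simp: Ha Ga)+
  have "(\<Union>h\<in>H. ?C (Suc k) h) \<inter> (\<Union>h\<in>G. ?C k h) = {}"
    using Ha Ga by auto
  then have "card (\<Union>h\<in>H. ?C (Suc k) h) + card (\<Union>h\<in>G. ?C k h)
      = card ((\<Union>h\<in>H. ?C (Suc k) h) \<union> (\<Union>h\<in>G. ?C k h))"
    using fin assms by (intro card_Un_disjoint[symmetric]) (auto intro: finite_clean_lists)
  also have "\<dots> \<le> card (clean_lists P D x a (Suc k) (Suc L) F)"
    using sub1 sub2 assms by (intro card_mono finite_clean_lists) auto
  finally show "(\<Sum>h\<in>H. card (clean_lists P D x a (Suc k) L (insert (h div D) F)))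
       + (\<Sum>h\<in>G. card (clean_lists P D x a k L (insert (h div D) F)))
       \<le> card (clean_lists P D x a (Suc k) (Suc L) F)"
    using c fin by simp
  have "card (\<Union>h\<in>H. ?C 0 h) \<le> card (clean_lists P D x a 0 (Suc L) F)"
    using sub3 assms by (intro card_mono finite_clean_lists) auto
  then show "(\<Sum>h\<in>H. card (clean_lists P D x a 0 L (insert (h div D) F)))
       \<le> card (clean_lists P D x a 0 (Suc L) F)"
    using c fin by simp
qed

lemma real_card_Diff: "finite B \<Longrightarrow> real (card A) - real (card B) \<le> real (card (A - B))"
  using diff_card_le_card_Diff[of B A] by linarith

text \<open>At most \<open>e\<close> rows, hence at most \<open>D * e\<close> half-edges, are ever
  forbidden, so \<open>\<alpha>\<close> and \<open>\<beta>\<close> bound the ordinary and the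
  exceptional choices from below at every slot. The factor \<open>L\<close> counts the positions of
  the single exception.\<close>

lemma card_clean_lists_ge:
  fixes \<alpha> \<beta> :: real
  assumes P: "finite P" "0 < D" and \<alpha>: "0 \<le> \<alpha>" "\<alpha> + D * e \<le> card {h\<in>P. x (h div D) = a}"
    and \<beta>: "0 \<le> \<beta>" "\<beta> + D * e \<le> card {h\<in>P. x (h div D) \<noteq> a}"
    and "finite F" "card F + L \<le> e"
  shows "\<alpha> ^ L \<le> card (clean_lists P D x a 0 L F) \<and>
    real L * \<beta> * \<alpha> ^ (L - 1) \<le> card (clean_lists P D x a 1 L F)"
  using assms(7-)
proof (induction L arbitrary: F)
  case 0
  have "clean_lists P D x a 0 0 F = {[]}" by (auto simp: clean_lists_def)
  then show ?case by simp
next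
  case (Suc L)
  define H where "H = {h\<in>P. x (h div D) = a} - {h. h div D \<in> F}"
  define G where "G = {h\<in>P. x (h div D) \<noteq> a} - {h. h div D \<in> F}"
  have le: "real (card {h. h div D \<in> F}) \<le> D * e"
  proof -
    have "card {h. h div D \<in> F} = D * card F" using card_div_vimage Suc.prems P by blast
    also have "\<dots> \<le> D * e" using Suc.prems by (intro mult_le_mono2) simp
    finally show ?thesis by (metis of_nat_le_iff of_nat_mult)
  qed
  have H: "\<alpha> \<le> card H"
    using real_card_Diff[OF card_div_vimage(2)[OF Suc.prems(1) P(2)], of "{h\<in>P. x (h div D) = a}"] \<alpha>(2) le
    unfolding H_def of_nat_mult by linarith
  have G: "\<beta> \<le> card G"
    using real_card_Diff[OF card_div_vimage(2)[OF Suc.prems(1) P(2)], of "{h\<in>P. x (h div D) \<noteq> a}"] \<beta>(2) le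
    unfolding G_def of_nat_mult by linarith
  have IH: "\<alpha> ^ L \<le> card (clean_lists P D x a 0 L (insert (h div D) F))"
    "real L * \<beta> * \<alpha> ^ (L - 1) \<le> card (clean_lists P D x a 1 L (insert (h div D) F))" for h
  proof -
    have "card (insert (h div D) F) + L \<le> e" "finite (insert (h div D) F)"
      using Suc.prems card_insert_le_m1[of "Suc (card F)" F] by (auto simp: card_insert_if)
    then show "\<alpha> ^ L \<le> card (clean_lists P D x a 0 L (insert (h div D) F))"
      "real L * \<beta> * \<alpha> ^ (L - 1) \<le> card (clean_lists P D x a 1 L (insert (h div D) F))"
      using Suc.IH by blast+
  qed
  have sub: "H \<subseteq> P" "H \<inter> {h. h div D \<in> F} = {}" "G \<subseteq> P" "G \<inter> {h. h div D \<in> F} = {}"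
     "\<And>h. h \<in> H \<Longrightarrow> x (h div D) = a" "\<And>h. h \<in> G \<Longrightarrow> x (h div D) \<noteq> a"
    unfolding H_def G_def by auto
  note C = card_clean_lists_Cons[where H = H and G = G and x = x and a = a, OF P Suc.prems(1) sub]
  have "\<alpha> ^ Suc L \<le> card H * \<alpha> ^ L" using H \<alpha>(1) by (simp add: mult_right_mono)
  also have "\<dots> = (\<Sum>h\<in>H. \<alpha> ^ L)" by simp
  also have "\<dots> \<le> (\<Sum>h\<in>H. real (card (clean_lists P D x a 0 L (insert (h div D) F))))"
    by (intro sum_mono IH)
  also have "\<dots> \<le> card (clean_lists P D x a 0 (Suc L) F)"
    using C(2)[of L] by (metis of_nat_le_iff of_nat_sum)
  finally have 1: "\<alpha> ^ Suc L \<le> card (clean_lists P D x a 0 (Suc L) F)" .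
  \<comment> \<open>The exception sits either in a later slot (first summand) or in the first one
    (second summand).\<close>
  have "real (Suc L) * \<beta> * \<alpha> ^ (Suc L - 1) = \<alpha> * (real L * \<beta> * \<alpha> ^ (L - 1)) + \<beta> * \<alpha> ^ L"
    by (cases L) (simp_all add: algebra_simps)
  also have "\<dots> \<le> card H * (real L * \<beta> * \<alpha> ^ (L - 1)) + card G * \<alpha> ^ L"
    using H G \<alpha>(1) \<beta>(1) by (intro add_mono mult_right_mono) auto
  also have "\<dots> = (\<Sum>h\<in>H. real L * \<beta> * \<alpha> ^ (L - 1)) + (\<Sum>h\<in>G. \<alpha> ^ L)" by simp
  also have "\<dots> \<le> (\<Sum>h\<in>H. real (card (clean_lists P D x a 1 L (insert (h div D) F))))
      + (\<Sum>h\<in>G. real (card (clean_lists P D x a 0 L (insert (h div D) F))))"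
    by (intro add_mono sum_mono IH)
  also have "\<dots> \<le> card (clean_lists P D x a 1 (Suc L) F)"
    using C(1)[of 0 L] by (metis (mono_tags) One_nat_def of_nat_add of_nat_le_iff of_nat_sum)
  finally show ?case using 1 by blast
qed

text \<open>The case \<open>L = 1\<close> on its own, because \<open>card_clean_lists_ge\<close>
  asks in addition for at least \<open>D * e\<close> half-edges on which \<open>x\<close> equals
  \<open>a\<close>; here \<open>a\<close> may be a value that \<open>x\<close> never takes.\<close>

lemma card_clean_lists_1_ge:
  assumes P: "finite P" "0 < D" and "finite F" "card F \<le> e"
  shows "real (card {h\<in>P. x (h div D) \<noteq> a}) - real (D * e) \<le> card (clean_lists P D x a 1 1 F)"
proof -
  define G where "G = {h\<in>P. x (h div D) \<noteq> a} - {h. h div D \<in> F}"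
  have "card {h. h div D \<in> F} \<le> D * e"
    using card_div_vimage(1)[OF assms(3,2)] mult_le_mono2[OF assms(4)] by simp
  then have "real (card {h\<in>P. x (h div D) \<noteq> a}) - real (D * e) \<le> card G"
    using real_card_Diff[OF card_div_vimage(2)[OF assms(3,2)], of "{h\<in>P. x (h div D) \<noteq> a}"]
    unfolding G_def by linarith
  moreover have "card G \<le> card (clean_lists P D x a 1 1 F)"
  proof -
    have "clean_lists P D x a 0 0 F' = {[]}" for F' by (auto simp: clean_lists_def)
    then have "card (clean_lists P D x a 0 0 F') = 1" for F' by simp
    then have "(\<Sum>h\<in>G. card (clean_lists P D x a 0 0 (insert (h div D) F))) = card G"
      by (simp only: card_eq_sum[symmetric])
    moreover have "(\<Sum>h\<in>{}. card (clean_lists P D x a (Suc 0) 0 (insert (h div D) F)))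
        + (\<Sum>h\<in>G. card (clean_lists P D x a 0 0 (insert (h div D) F))) \<le> card (clean_lists P D x a (Suc 0) (Suc 0) F)"
      by (rule card_clean_lists_Cons(1)[OF P assms(3)]) (auto simp: G_def)
    ultimately show ?thesis by simp
  qed
  ultimately show ?thesis by linarith
qed

text \<open>
  All but the last \<open>L\<close> slots of a column are exposed first. If a value \<open>a\<close> is attained on more than
  three quarters of the pool, \<open>L\<close> is chosen such that "no slot differs from \<open>a\<close>" and "exactly one slot
  differs from \<open>a\<close>" both have probability bounded below. The two cases give different column sums,
  so at least one of them makes the sum nonzero. If there is no such value, \<open>L = 1\<close> suffices.
\<close>
lemma dlists_tail_nonzero:
  fixes x :: "nat \<Rightarrow> real" and \<kappa> :: real
  assumes P: "finite P" "0 < D" "0 < e" and M: "M = real (card P)" and \<kappa>: "0 < \<kappa>" "\<kappa> \<le> 1 / 4"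
    and spread: "\<And>a. \<kappa> * M \<le> real e * card {h\<in>P. x (h div D) \<noteq> a}"
    and big: "4 * real D * real e ^ 2 \<le> \<kappa> * M"
  obtains L where "L \<le> e"
    "\<And>zs. zs \<in> dlists P (e - L) \<Longrightarrow>
      \<kappa> / 8 * card (dlists (P - set zs) L) \<le>
      card {ys\<in>dlists (P - set zs) L. (\<Sum>i\<in>(\<lambda>h. h div D) ` set (zs @ ys). x i) \<noteq> 0}"
proof -
  let ?d = "\<lambda>zs. (\<lambda>h. h div D) ` set zs"
  let ?Z = "\<lambda>zs L. {ys\<in>dlists (P - set zs) L. (\<Sum>i\<in>?d (zs @ ys). x i) \<noteq> 0}"
  define B where "B a = real (card {h\<in>P. x (h div D) \<noteq> a})" for a
  have De: "4 * (real D * real e) * real e \<le> \<kappa> * M" using big by (simp add: power2_eq_square mult_ac)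
  have De1: "4 * (real D * real e) \<le> \<kappa> * M"
  proof -
    have "4 * (real D * real e) * 1 \<le> 4 * (real D * real e) * real e" using P by (intro mult_left_mono) auto
    then show ?thesis using De by linarith
  qed
  have M0: "0 < M" 
  proof -
    have "0 < 4 * (real D * real e)" using P by simp
    then have "0 < \<kappa> * M" using De1 by linarith
    then show ?thesis using \<kappa>(1) by (rule zero_less_mult_pos)
  qed
  have De0: "0 \<le> real D * real e" by simp
  have \<kappa>M: "\<kappa> * M \<le> M / 4" using \<kappa> M0 by simp
  have dl: "card (dlists (P - set zs) L) \<le> M ^ L" for zs L
  proof -
    have "card (dlists (P - set zs) L) \<le> card (P - set zs) ^ L" using P by (intro card_dlists_le) simp
    also have "\<dots> \<le> card P ^ L" using P by (intro power_mono card_mono) auto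
    finally show ?thesis unfolding M by (metis of_nat_le_iff of_nat_power)
  qed
  have clean: "card (clean_lists P D x a k L (?d zs)) \<le>
      card (?Z zs L)"
    if "\<And>ys. ys \<in> clean_lists P D x a k L (?d zs) \<Longrightarrow>
        (\<Sum>i\<in>?d zs. x i) + (\<Sum>h\<leftarrow>ys. x (h div D)) \<noteq> 0" for a k L zs
  proof (rule card_mono)
    show "finite (?Z zs L)"
      using P by simp
    show "clean_lists P D x a k L (?d zs) \<subseteq>
      ?Z zs L"
    proof
      fix ys assume ys: "ys \<in> clean_lists P D x a k L (?d zs)"
      then show "ys \<in> ?Z zs L"
        using that[OF ys] clean_lists_sum[OF _ ys] clean_lists_subset_dlists[of P D x a k L zs]
        by (auto simp: image_Un)
    qed
  qed
  have cF: "card (?d zs) + L \<le> e" if "zs \<in> dlists P (e - L)" "L \<le> e" for zs L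
  proof -
    have "card (?d zs) \<le> length zs"
      using order_trans[OF card_image_le[OF finite_set] card_length] .
    then show ?thesis using that by (simp add: dlists_def)
  qed
  show thesis
  proof (cases "\<forall>a. M / 4 \<le> B a")
    case True
    show thesis
    proof (rule that[of 1])
      show "1 \<le> e" using P by simp
      fix zs assume zs: "zs \<in> dlists P (e - 1)"
      \<comment> \<open>Any last half-edge in a new row with \<open>x\<close> different from this
        \<open>a\<close> makes the column sum nonzero.\<close>
      define a where "a = - (\<Sum>i\<in>?d zs. x i)"
      have "\<kappa> / 8 * card (dlists (P - set zs) 1) \<le> \<kappa> / 8 * M"
        using dl[of zs 1] \<kappa> by (intro mult_left_mono) auto
      also have "\<dots> \<le> M / 4 - real (D * e)" unfolding of_nat_mult using De1 \<kappa>M M0 by linarith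
      also have "\<dots> \<le> card (clean_lists P D x a 1 1 (?d zs))"
      proof -
        have "card (?d zs) \<le> e"
          using cF[OF zs] P by simp
        from card_clean_lists_1_ge[OF P(1,2) _ this, of x a] True[rule_format, of a]
        show ?thesis unfolding B_def by simp
      qed
      also have "\<dots> \<le> card (?Z zs 1)"
      proof -
        have "card (clean_lists P D x a 1 1 (?d zs)) \<le>
          card (?Z zs 1)"
        proof (rule clean)
          fix ys assume "ys \<in> clean_lists P D x a 1 1 (?d zs)"
          from clean_lists_1_sum[OF this]
          show "(\<Sum>i\<in>?d zs. x i) + (\<Sum>h\<leftarrow>ys. x (h div D)) \<noteq> 0"
            unfolding a_def by auto
        qed
        then show ?thesis by simp
      qed
      finally show "\<kappa> / 8 * card (dlists (P - set zs) 1) \<le>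
        card (?Z zs 1)" .
    qed
  next
    case False
    then obtain a where a: "B a < M / 4" by (meson not_le)
    define b where "b = B a"
    have eb: "\<kappa> * M \<le> real e * b" using spread[of a] by (simp add: b_def B_def)
    have b4: "4 * (real D * real e) \<le> b"
    proof -
      have "4 * (real D * real e) * real e \<le> b * real e" using De eb by (simp add: mult.commute)
      then show ?thesis using P by simp
    qed
    have b0: "0 < b"
    proof -
      have "0 < 4 * (real D * real e)" using P by simp
      then show ?thesis using b4 by linarith
    qed
    have A: "real (card {h\<in>P. x (h div D) = a}) = M - b"
    proof -
      have "P = {h\<in>P. x (h div D) = a} \<union> {h\<in>P. x (h div D) \<noteq> a}" by auto
      then have "card P = card {h\<in>P. x (h div D) = a} + card {h\<in>P. x (h div D) \<noteq> a}"
        using P card_Un_disjoint[of "{h\<in>P. x (h div D) = a}" "{h\<in>P. x (h div D) \<noteq> a}"] by auto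
      then show ?thesis unfolding M b_def B_def by simp
    qed
    \<comment> \<open>\<open>b / M\<close> is the chance that a slot is exceptional. This
      \<open>L\<close> keeps \<open>L * b\<close> between \<open>\<kappa> * M\<close> and
      \<open>M / 2\<close>: small enough for "no exception" to be likely, large enough for "one
      exception" not to be rare.\<close>
    define L where "L = min e (nat \<lfloor>M / (2 * b)\<rfloor>)"
    have fl: "2 \<le> M / (2 * b)" using a b0 unfolding b_def[symmetric] by (simp add: field_simps)
    have L1: "1 \<le> L" using fl P unfolding L_def by (auto simp: le_nat_iff le_floor_iff)
    have Le: "L \<le> e" unfolding L_def by simp
    have Lb: "real L * b \<le> M / 2"
    proof -
      have "real L \<le> M / (2 * b)" using fl unfolding L_def by linarith
      then show ?thesis using b0 by (simp add: field_simps)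
    qed
    have Lb': "\<kappa> * M \<le> real L * b"
    proof (cases "L = e")
      case True
      then show ?thesis using eb by simp
    next
      case False
      then have "real L = real (nat \<lfloor>M / (2 * b)\<rfloor>)" unfolding L_def by linarith
      then have "real L \<ge> M / (2 * b) - 1" using fl by linarith
      then have "real L * b \<ge> M / 2 - b" using b0 by (simp add: field_simps)
      then show ?thesis using a \<kappa>M unfolding b_def by linarith
    qed
    have LDe: "real L * (real D * real e) \<le> \<kappa> * M / 4"
    proof -
      have "real L * (real D * real e) \<le> real e * (real D * real e)" using Le by (intro mult_right_mono) auto
      then show ?thesis using De by (simp add: mult_ac)
    qed
    define \<alpha> where "\<alpha> = M - b - real D * real e"
    define \<beta> where "\<beta> = b - real D * real e"
    have \<alpha>0: "0 \<le> \<alpha>" using a De1 \<kappa>M M0 unfolding \<alpha>_def b_def by linarith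
    have \<beta>0: "0 \<le> \<beta>" using b4 De0 unfolding \<beta>_def by linarith
    have \<alpha>M: "\<alpha> \<le> M" using b0 De0 unfolding \<alpha>_def by linarith
    \<comment> \<open>Bernoulli's inequality: exceptions cost at most 1/2 and rows already used at
      most 1/16, which leaves 7/16.\<close>
    have \<alpha>L: "7 / 16 * M ^ L \<le> \<alpha> ^ L"
    proof -
      define y where "y = (b + real D * real e) / M"
      have "y \<le> 1" using \<alpha>0 M0 unfolding \<alpha>_def y_def by simp
      then have "- 1 \<le> - y" by simp
      from Bernoulli_inequality[OF this, of L] have "1 - real L * y \<le> (1 - y) ^ L" by simp
      moreover have "1 - y = \<alpha> / M"
        using M0 unfolding \<alpha>_def y_def by (simp add: field_simps)
      ultimately have "1 - real L * (b + real D * real e) / M \<le> (\<alpha> / M) ^ L" by (simp add: y_def)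
      moreover have "real L * (b + real D * real e) \<le> 9 / 16 * M"
        using Lb LDe \<kappa>M M0 unfolding distrib_left by linarith
      ultimately have "7 / 16 \<le> (\<alpha> / M) ^ L" using M0 pos_divide_le_eq[of M "real L * (b + real D * real e)" "9 / 16"] by linarith
      then show ?thesis using M0 pos_le_divide_eq[of "M ^ L" "7 / 16" "\<alpha> ^ L"] by (simp only: power_divide zero_less_power)
    qed
    have \<alpha>L': "7 / 16 * M ^ (L - 1) \<le> \<alpha> ^ (L - 1)"
    proof -
      have e: "M ^ L = M * M ^ (L - 1)" "\<alpha> ^ L = \<alpha> * \<alpha> ^ (L - 1)"
        using L1 by (cases L; simp)+
      have "7 / 16 * M ^ (L - 1) * M \<le> \<alpha> ^ (L - 1) * \<alpha>" using \<alpha>L unfolding e by (simp add: mult_ac)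
      also have "\<dots> \<le> \<alpha> ^ (L - 1) * M" using \<alpha>0 \<alpha>M by (intro mult_left_mono) auto
      finally show ?thesis using M0 by simp
    qed
    have L\<beta>: "3 / 4 * (\<kappa> * M) \<le> real L * \<beta>" using Lb' LDe unfolding \<beta>_def by (simp add: algebra_simps)
    have Z1: "\<kappa> / 8 * M ^ L \<le> real L * \<beta> * \<alpha> ^ (L - 1)"
    proof -
      have "M ^ L = M * M ^ (L - 1)" using L1 by (cases L; simp)
      then have e: "\<kappa> / 8 * M ^ L = 1 / 8 * (\<kappa> * M * M ^ (L - 1))" by simp
      have "0 \<le> \<kappa> * M * M ^ (L - 1)" using \<kappa> M0 by simp
      then have "\<kappa> / 8 * M ^ L \<le> 3 / 4 * (\<kappa> * M) * (7 / 16 * M ^ (L - 1))"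
        unfolding e by (simp add: mult_ac)
      also have "\<dots> \<le> real L * \<beta> * \<alpha> ^ (L - 1)"
        using \<beta>0 \<kappa> M0 by (intro mult_mono[OF L\<beta> \<alpha>L']) auto
      finally show ?thesis .
    qed
    have Z0: "\<kappa> / 8 * M ^ L \<le> \<alpha> ^ L"
    proof -
      have "\<kappa> / 8 * M ^ L \<le> 7 / 16 * M ^ L" using \<kappa> M0 by (intro mult_right_mono) auto
      then show ?thesis using \<alpha>L by linarith
    qed
    show thesis
    proof (rule that[of L])
      show "L \<le> e" by fact
      fix zs assume zs: "zs \<in> dlists P (e - L)"
      define F where "F = ?d zs"
      have Fe: "card F + L \<le> e" "finite F" using cF[OF zs Le] by (auto simp: F_def)
      have ge: "\<alpha> ^ L \<le> card (clean_lists P D x a 0 L F) \<and>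
          real L * \<beta> * \<alpha> ^ (L - 1) \<le> card (clean_lists P D x a 1 L F)"
        using A by (intro card_clean_lists_ge[where e = e] P Fe \<alpha>0 \<beta>0) (auto simp: \<alpha>_def \<beta>_def b_def B_def)
      have "\<kappa> / 8 * card (dlists (P - set zs) L) \<le> \<kappa> / 8 * M ^ L"
        using dl \<kappa> by (intro mult_left_mono) auto
      also have "\<dots> \<le> card (?Z zs L)"
      proof (cases "(\<Sum>i\<in>F. x i) + real L * a = 0")
        case False
        have "card (clean_lists P D x a 0 L F) \<le>
          card (?Z zs L)"
          unfolding F_def
        proof (rule clean)
          fix ys assume "ys \<in> clean_lists P D x a 0 L (?d zs)"
          from clean_lists_0_sum[OF this] False
          show "(\<Sum>i\<in>?d zs. x i) + (\<Sum>h\<leftarrow>ys. x (h div D)) \<noteq> 0"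
            unfolding F_def by simp
        qed
        then show ?thesis using Z0 ge by linarith
      next
        case True
        have "card (clean_lists P D x a 1 L F) \<le>
          card (?Z zs L)"
          unfolding F_def
        proof (rule clean)
          fix ys assume "ys \<in> clean_lists P D x a 1 L (?d zs)"
          from clean_lists_1_sum[OF this] obtain c where "c \<noteq> a" "(\<Sum>h\<leftarrow>ys. x (h div D)) = (real L - 1) * a + c"
            by blast
          then show "(\<Sum>i\<in>?d zs. x i) + (\<Sum>h\<leftarrow>ys. x (h div D)) \<noteq> 0"
            using True unfolding F_def[symmetric] by (simp add: algebra_simps)
        qed
        then show ?thesis using Z1 ge by linarith
      qed
      finally show "\<kappa> / 8 * card (dlists (P - set zs) L) \<le>
        card (?Z zs L)" .
    qed
  qed
qed

lemma dlists_nonzero: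
  fixes x :: "nat \<Rightarrow> real" and \<kappa> :: real
  assumes P: "finite P" "0 < D" "0 < e" and M: "M = real (card P)" and \<kappa>: "0 < \<kappa>" "\<kappa> \<le> 1 / 4"
    and spread: "\<And>a. \<kappa> * M \<le> real e * card {h\<in>P. x (h div D) \<noteq> a}"
    and big: "4 * real D * real e ^ 2 \<le> \<kappa> * M"
  shows "\<kappa> / 8 * card (dlists P e) \<le> card {ys\<in>dlists P e. (\<Sum>i\<in>(\<lambda>h. h div D) ` set ys. x i) \<noteq> 0}"
proof -
  let ?N = "\<lambda>ys. (\<Sum>i\<in>(\<lambda>h. h div D) ` set ys. x i) \<noteq> 0"
  obtain L where L: "L \<le> e" "\<And>zs. zs \<in> dlists P (e - L) \<Longrightarrow>
      \<kappa> / 8 * card (dlists (P - set zs) L) \<le> card {ys\<in>dlists (P - set zs) L. ?N (zs @ ys)}"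
    using dlists_tail_nonzero[OF assms] by blast
  have cnt: "real (card {ys\<in>dlists Q k. R ys}) = (\<Sum>ys\<in>dlists Q k. of_bool (R ys))"
    if "finite Q" for Q k and R :: "nat list \<Rightarrow> bool"
    using that by (simp add: of_bool_def sum.If_cases Int_def)
  have "\<kappa> / 8 * card (dlists P e) = (\<Sum>zs\<in>dlists P (e - L). \<kappa> / 8 * card (dlists (P - set zs) L))"
    using card_dlists_append[OF P(1), of "e - L" L] L(1) by (simp add: sum_distrib_left)
  also have "\<dots> \<le> (\<Sum>zs\<in>dlists P (e - L). real (card {ys\<in>dlists (P - set zs) L. ?N (zs @ ys)}))"
    by (intro sum_mono L)
  also have "\<dots> = (\<Sum>zs\<in>dlists P (e - L). \<Sum>ys\<in>dlists (P - set zs) L. of_bool (?N (zs @ ys)))"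
    using cnt P by simp
  also have "\<dots> = (\<Sum>ys\<in>dlists P e. of_bool (?N ys))"
    using sum_dlists_append[OF P(1), of "\<lambda>ys. of_bool (?N ys)" "e - L" L] L(1) by simp
  also have "\<dots> = card {ys\<in>dlists P e. ?N ys}"
    using cnt P by simp
  finally show ?thesis .
qed

section \<open>Exposure of columns one at a time\<close>

definition block_cols :: "nat \<Rightarrow> nat \<Rightarrow> nat list \<Rightarrow> nat \<Rightarrow> nat set set" where
  "block_cols e D xs r = (\<lambda>j. (\<lambda>h. h div D) ` set (take e (drop (j * e) xs))) ` {..<r}"

text \<open>Far from all constant vectors at once, including the zero vector
  (\<open>a = 0\<close>).\<close>

definition spread_vec :: "real \<Rightarrow> nat \<Rightarrow> (nat \<Rightarrow> real) \<Rightarrow> bool" where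
  "spread_vec u m x \<longleftrightarrow> (\<forall>a. u \<le> real (card {i. i < m \<and> x i \<noteq> a}))"

text \<open>All large \<open>U\<close> are covered simultaneously, because the vector whose
  exceptional rows form \<open>U\<close> is known only after the prefix has been exposed.\<close>

definition pool_good :: "real \<Rightarrow> nat \<Rightarrow> nat \<Rightarrow> nat set \<Rightarrow> bool" where
  "pool_good u D m H \<longleftrightarrow> (\<forall>U\<subseteq>{..<m}. u \<le> real (card U) \<longrightarrow> 2 * card {h\<in>H. h div D \<in> U} \<le> D * card U)"

text \<open>The event passes to shorter prefixes with the same \<open>x\<close>, so a prefix that is
  not bad needs no further attention.\<close>

definition bad_prefix :: "real \<Rightarrow> nat \<Rightarrow> nat \<Rightarrow> nat \<Rightarrow> nat \<Rightarrow> nat list \<Rightarrow> bool" where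
  "bad_prefix u e D m r xs \<longleftrightarrow> pool_good u D m (set xs) \<and>
     (\<exists>x. spread_vec u m x \<and> (\<forall>s\<in>block_cols e D xs r. (\<Sum>i\<in>s. x i) = 0))"

lemma block_cols_append:
  assumes "length xs = r * e" "length ys = e"
  shows "block_cols e D (xs @ ys) (Suc r) = insert ((\<lambda>h. h div D) ` set ys) (block_cols e D xs r)"
proof -
  have "take e (drop (j * e) (xs @ ys)) = take e (drop (j * e) xs)" if "j < r" for j
  proof -
    have "Suc j * e \<le> r * e" using that by (intro mult_le_mono1) simp
    then have "j * e + e \<le> length xs" using assms by simp
    then show ?thesis by simp
  qed
  then have "(\<lambda>j. (\<lambda>h. h div D) ` set (take e (drop (j * e) (xs @ ys)))) ` {..<r}
      = (\<lambda>j. (\<lambda>h. h div D) ` set (take e (drop (j * e) xs))) ` {..<r}"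
    by (intro image_cong) (simp_all only: lessThan_iff)
  moreover have "take e (drop (r * e) (xs @ ys)) = ys" using assms by simp
  ultimately show ?thesis
    unfolding block_cols_def lessThan_Suc image_insert by (simp only:)
qed

lemma div_less_of_less_mult: "h < D * m \<Longrightarrow> h div D < (m::nat)"
  by (metis less_mult_imp_div_less mult.commute)

lemma block_cols_subset:
  assumes "set xs \<subseteq> {..<D * m}" "s \<in> block_cols e D xs r"
  shows "s \<subseteq> {..<m}"
proof -
  obtain j where s: "s = (\<lambda>h. h div D) ` set (take e (drop (j * e) xs))"
    using assms(2) unfolding block_cols_def by blast
  have "set (take e (drop (j * e) xs)) \<subseteq> {..<D * m}"
    using assms(1) set_take_subset[of e "drop (j * e) xs"] set_drop_subset[of "j * e" xs] by blast
  then show ?thesis unfolding s using div_less_of_less_mult by blast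
qed

lemma pool_good_mono: "pool_good u D m H \<Longrightarrow> G \<subseteq> H \<Longrightarrow> finite H \<Longrightarrow> pool_good u D m G"
  unfolding pool_good_def
proof (intro allI impI)
  fix U assume *: "\<forall>U\<subseteq>{..<m}. u \<le> real (card U) \<longrightarrow> 2 * card {h\<in>H. h div D \<in> U} \<le> D * card U"
    "G \<subseteq> H" "finite H" "U \<subseteq> {..<m}" "u \<le> real (card U)"
  have "card {h\<in>G. h div D \<in> U} \<le> card {h\<in>H. h div D \<in> U}"
    using * by (intro card_mono) auto
  moreover have "2 * card {h\<in>H. h div D \<in> U} \<le> D * card U" using * by blast
  ultimately show "2 * card {h\<in>G. h div D \<in> U} \<le> D * card U" by linarith
qed

text \<open>The rows on which \<open>x\<close> differs from \<open>a\<close> number at least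
  \<open>u\<close> and keep at least half of their half-edges, so the remaining pool inherits the
  spread of \<open>x\<close>.\<close>

lemma pool_spread:
  assumes D: "0 < D" and x: "spread_vec u m x" and g: "pool_good u D m (set xs)"
    and V: "set xs \<subseteq> {..<D * m}"
  shows "real D * u \<le> 2 * real (card {h\<in>{..<D * m} - set xs. x (h div D) \<noteq> a})"
proof -
  define U where "U = {i. i < m \<and> x i \<noteq> a}"
  have U: "U \<subseteq> {..<m}" "u \<le> card U" "finite U" using x by (auto simp: U_def spread_vec_def)
  have "{h. h div D \<in> U} = {h\<in>{..<D * m}. x (h div D) \<noteq> a}"
    using D by (auto simp: U_def less_mult_imp_div_less mult.commute)
       (metis div_less_iff_less_mult mult.commute)
  then have "{h\<in>{..<D * m} - set xs. x (h div D) \<noteq> a} = {h. h div D \<in> U} - {h\<in>set xs. h div D \<in> U}"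
    by auto
  moreover have "real (card {h. h div D \<in> U}) - real (card {h\<in>set xs. h div D \<in> U})
      \<le> card ({h. h div D \<in> U} - {h\<in>set xs. h div D \<in> U})"
    by (rule real_card_Diff) simp
  moreover have "card {h. h div D \<in> U} = D * card U" using card_div_vimage(1) U D by blast
  moreover have "2 * card {h\<in>set xs. h div D \<in> U} \<le> D * card U"
    using g U unfolding pool_good_def by blast
  then have "2 * real (card {h\<in>set xs. h div D \<in> U}) \<le> real (D * card U)" by linarith
  moreover have "real D * u \<le> real (D * card U)" using U by (simp add: mult_left_mono)
  ultimately show ?thesis by simp
qed

text \<open>
  Revealing the columns one at a time, each column that is not orthogonal to a fixed kernel
  vector raises the rank of the revealed columns, so the weight \<open>(1/2) ^ rank\<close> on the bad
  event shrinks on average by a constant factor while it never drops below \<open>(1/2) ^ m\<close>.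
\<close>
lemma sum_bad_prefix_le:
  fixes \<kappa> :: real
  assumes \<kappa>: "0 < \<kappa>" "\<kappa> \<le> 1 / 4" and D: "0 < D" "0 < e"
    and u: "u = 2 * \<kappa> * m / e" and big: "8 * real e ^ 2 \<le> \<kappa> * m" and R: "2 * (r * e) \<le> D * m"
  shows "(\<Sum>xs\<in>dlists {..<D * m} (r * e). of_bool (bad_prefix u e D m r xs) * (1 / 2) ^ set_rank (block_cols e D xs r))
    \<le> (1 - \<kappa> / 16) ^ r * real (card (dlists {..<D * m} (r * e)))"
  using R
proof (induction r)
  case 0
  then show ?case by (simp add: power_le_one of_bool_def)
next
  case (Suc r)
  let ?V = "{..<D * m}"
  let ?Y = "\<lambda>r xs. of_bool (bad_prefix u e D m r xs) * (1 / 2 :: real) ^ set_rank (block_cols e D xs r)"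
  have step: "(\<Sum>ys\<in>dlists (?V - set xs) e. ?Y (Suc r) (xs @ ys))
      \<le> (1 - \<kappa> / 16) * ?Y r xs * real (card (dlists (?V - set xs) e))"
    if xs: "xs \<in> dlists ?V (r * e)" for xs
  proof (cases "bad_prefix u e D m r xs")
    case False
    have "\<not> bad_prefix u e D m (Suc r) (xs @ ys)" if "ys \<in> dlists (?V - set xs) e" for ys
    proof
      assume b: "bad_prefix u e D m (Suc r) (xs @ ys)"
      have "block_cols e D (xs @ ys) (Suc r) = insert ((\<lambda>h. h div D) ` set ys) (block_cols e D xs r)"
        using xs that by (intro block_cols_append) (auto simp: dlists_def)
      then have "bad_prefix u e D m r xs"
        using b pool_good_mono[of u D m "set (xs @ ys)" "set xs"] unfolding bad_prefix_def by auto
      then show False using False by simp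
    qed
    then show ?thesis using False by simp
  next
    case True
    \<comment> \<open>The witness depends on the prefix only, so the next column is fresh relative
      to it. The longer prefix may be bad through a different vector; what counts is that the rank
      rises whenever this \<open>x\<close> fails.\<close>
    then obtain x where x: "spread_vec u m x" "\<And>s. s \<in> block_cols e D xs r \<Longrightarrow> (\<Sum>i\<in>s. x i) = 0"
      and g: "pool_good u D m (set xs)" unfolding bad_prefix_def by blast
    define P where "P = ?V - set xs"
    define c where "c = (1 / 2 :: real) ^ set_rank (block_cols e D xs r)"
    have c0: "0 \<le> c" by (simp add: c_def)
    have xs': "length xs = r * e" "distinct xs" "set xs \<subseteq> ?V" using xs by (auto simp: dlists_def)
    have finP: "finite P" by (simp add: P_def)
    have cP: "real (card P) = real (D * m) - real (r * e)"
    proof -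
      have "card P = D * m - r * e"
        unfolding P_def using xs' distinct_card[of xs] by (simp add: card_Diff_subset)
      moreover have "r * e \<le> D * m" using Suc.prems by simp
      ultimately show ?thesis by simp
    qed
    have cP2: "real D * real m \<le> 2 * real (card P)"
    proof -
      have "2 * (r * e) \<le> D * m" using Suc.prems by simp
      then have "2 * real (r * e) \<le> real (D * m)" by linarith
      then show ?thesis unfolding cP by simp
    qed
    let ?N = "\<lambda>ys. (\<Sum>i\<in>(\<lambda>h. h div D) ` set ys. x i) \<noteq> 0"
    have nz: "\<kappa> / 8 * card (dlists P e) \<le> card {ys\<in>dlists P e. ?N ys}"
    proof (rule dlists_nonzero[OF finP D refl \<kappa>])
      fix a
      have "\<kappa> * real (card P) \<le> \<kappa> * (real D * real m)" unfolding cP using \<kappa> by (intro mult_left_mono) auto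
      also have "\<dots> = real e * (real D * u) / 2" unfolding u using D by simp
      also have "\<dots> \<le> real e * (2 * real (card {h\<in>P. x (h div D) \<noteq> a})) / 2"
        using pool_spread[OF D(1) x(1) g xs'(3), of a] unfolding P_def
        by (intro divide_right_mono mult_left_mono) auto
      finally show "\<kappa> * real (card P) \<le> real e * card {h\<in>P. x (h div D) \<noteq> a}" by simp
    next
      have "real D * (8 * real e ^ 2) \<le> real D * (\<kappa> * m)" using big by (intro mult_left_mono) auto
      also have "\<dots> = \<kappa> * (real D * m)" by simp
      also have "\<dots> \<le> \<kappa> * (2 * real (card P))" using \<kappa> cP2 by (intro mult_left_mono) auto
      finally show "4 * real D * real e ^ 2 \<le> \<kappa> * real (card P)" by simp
    qed
    have Y: "?Y (Suc r) (xs @ ys) \<le> c * (1 - of_bool (?N ys) / 2)" if ys: "ys \<in> dlists P e" for ys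
    proof -
      have bc: "block_cols e D (xs @ ys) (Suc r) = insert ((\<lambda>h. h div D) ` set ys) (block_cols e D xs r)"
        using xs' ys by (intro block_cols_append) (auto simp: dlists_def)
      have fin: "finite (block_cols e D xs r)" by (simp add: block_cols_def)
      have sub: "\<And>s. s \<in> block_cols e D xs r \<Longrightarrow> s \<subseteq> {..<m}"
        using block_cols_subset[OF xs'(3)] .
      have sub': "(\<lambda>h. h div D) ` set ys \<subseteq> {..<m}"
        using ys div_less_of_less_mult by (auto simp: dlists_def P_def)
      show ?thesis
      proof (cases "?N ys")
        case True
        have "set_rank (block_cols e D (xs @ ys) (Suc r)) = Suc (set_rank (block_cols e D xs r))"
          unfolding bc using fin sub sub' x(2) True by (rule set_rank_insert)
        then show ?thesis using True c0 by (simp add: c_def)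
      next
        case False
        have "set_rank (block_cols e D xs r) \<le> set_rank (block_cols e D (xs @ ys) (Suc r))"
          unfolding bc using fin by (rule set_rank_mono_insert)
        then have "(1 / 2 :: real) ^ set_rank (block_cols e D (xs @ ys) (Suc r)) \<le> c"
          unfolding c_def by (intro power_decreasing) auto
        then show ?thesis using False c0 by (simp add: of_bool_def)
      qed
    qed
    have "(\<Sum>ys\<in>dlists P e. ?Y (Suc r) (xs @ ys)) \<le> (\<Sum>ys\<in>dlists P e. c * (1 - of_bool (?N ys) / 2))"
      by (rule sum_mono[OF Y])
    also have "\<dots> = c * (card (dlists P e) - card {ys\<in>dlists P e. ?N ys} / 2)"
      using finP by (simp add: sum_distrib_left[symmetric] sum_subtractf sum_divide_distrib[symmetric]
          of_bool_def sum.If_cases Int_def)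
    \<comment> \<open>At least a share \<open>\<kappa> / 8\<close> of the continuations halves the
      weight.\<close>
    also have "\<dots> \<le> c * ((1 - \<kappa> / 16) * card (dlists P e))"
      using nz c0 by (intro mult_left_mono) (auto simp: algebra_simps)
    finally show ?thesis using True by (simp add: P_def c_def mult_ac)
  qed
  have cc: "real (card (dlists (?V - set xs) e)) = real (card (dlists {..<D * m - r * e} e))"
    if "xs \<in> dlists ?V (r * e)" for xs
  proof -
    have "card (?V - set xs) = D * m - r * e"
      using that distinct_card[of xs] by (auto simp: dlists_def card_Diff_subset)
    then show ?thesis using card_dlists_cong[of "?V - set xs" "{..<D * m - r * e}" e] by simp
  qed
  let ?E = "real (card (dlists {..<D * m - r * e} e))"
  have split: "Suc r * e = r * e + e" by simp
  have "(\<Sum>xs\<in>dlists ?V (Suc r * e). ?Y (Suc r) xs)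
      = (\<Sum>xs\<in>dlists ?V (r * e). \<Sum>ys\<in>dlists (?V - set xs) e. ?Y (Suc r) (xs @ ys))"
    unfolding split by (rule sum_dlists_append) simp
  also have "\<dots> \<le> (\<Sum>xs\<in>dlists ?V (r * e). (1 - \<kappa> / 16) * ?Y r xs * ?E)"
    using step cc by (intro sum_mono) fastforce
  also have "\<dots> = (1 - \<kappa> / 16) * ?E * (\<Sum>xs\<in>dlists ?V (r * e). ?Y r xs)"
    by (simp add: sum_distrib_left mult_ac)
  also have "\<dots> \<le> (1 - \<kappa> / 16) * ?E * ((1 - \<kappa> / 16) ^ r * real (card (dlists ?V (r * e))))"
    using Suc \<kappa> by (intro mult_left_mono) auto
  also have "\<dots> = (1 - \<kappa> / 16) ^ Suc r * (\<Sum>xs\<in>dlists ?V (r * e). ?E)"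
    by simp
  also have "(\<Sum>xs\<in>dlists ?V (r * e). ?E) = real (card (dlists ?V (Suc r * e)))"
    unfolding split using cc card_dlists_append[of ?V "r * e" e] by simp
  finally show ?case .
qed

text \<open>The rank is at most \<open>m\<close>, so \<open>2 ^ m\<close> times the weight is at
  least 1 on each bad list and the scaled sum dominates the count. The factor \<open>2 ^ m\<close>
  takes the place of a union bound over \<open>x\<close>.\<close>

lemma card_bad_prefix_le:
  fixes \<kappa> :: real
  assumes \<kappa>: "0 < \<kappa>" "\<kappa> \<le> 1 / 4" and D: "0 < D" "0 < e"
    and u: "u = 2 * \<kappa> * m / e" and big: "8 * real e ^ 2 \<le> \<kappa> * m" and R: "2 * (r * e) \<le> D * m"
  shows "real (card {xs\<in>dlists {..<D * m} (r * e). bad_prefix u e D m r xs})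
    \<le> 2 ^ m * (1 - \<kappa> / 16) ^ r * real (card (dlists {..<D * m} (r * e)))"
proof -
  let ?L = "dlists {..<D * m} (r * e)"
  have rk: "set_rank (block_cols e D xs r) \<le> m" if "xs \<in> ?L" for xs
  proof (rule set_rank_le)
    show "s \<subseteq> {..<m}" if "s \<in> block_cols e D xs r" for s
      using block_cols_subset[OF _ that] \<open>xs \<in> ?L\<close> by (simp add: dlists_def)
  qed
  have "real (card {xs\<in>?L. bad_prefix u e D m r xs}) = (\<Sum>xs\<in>?L. of_bool (bad_prefix u e D m r xs))"
    by (simp add: of_bool_def sum.If_cases Int_def)
  also have "\<dots> \<le> (\<Sum>xs\<in>?L. 2 ^ m * (of_bool (bad_prefix u e D m r xs) * (1 / 2) ^ set_rank (block_cols e D xs r)))"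
  proof (rule sum_mono)
    fix xs assume "xs \<in> ?L"
    have "(2::real) ^ m * (1 / 2) ^ m \<le> 2 ^ m * (1 / 2) ^ set_rank (block_cols e D xs r)"
      using rk[OF \<open>xs \<in> ?L\<close>] by (intro mult_left_mono power_decreasing) auto
    then show "of_bool (bad_prefix u e D m r xs)
        \<le> (2::real) ^ m * (of_bool (bad_prefix u e D m r xs) * (1 / 2) ^ set_rank (block_cols e D xs r))"
      by (simp add: power_mult_distrib[symmetric])
  qed
  also have "\<dots> = 2 ^ m * (\<Sum>xs\<in>?L. of_bool (bad_prefix u e D m r xs) * (1 / 2) ^ set_rank (block_cols e D xs r))"
    by (simp only: sum_distrib_left)
  also have "\<dots> \<le> 2 ^ m * ((1 - \<kappa> / 16) ^ r * real (card ?L))"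
    by (intro mult_left_mono sum_bad_prefix_le assms) auto
  finally show ?thesis by (simp add: mult_ac)
qed

section \<open>Kernel vectors with large support\<close>

lemma map_pmf_permutation_list:
  assumes "finite V" "distinct zs" "set zs \<subseteq> V"
  shows "map_pmf (\<lambda>\<pi>. map \<pi> zs) (pmf_of_set {\<pi>. \<pi> permutes V}) = pmf_of_set (dlists V (length zs))"
proof (rule map_pmf_permutation_uniform)
  have "zs \<in> dlists V (length zs)" using assms by (simp add: dlists_def)
  then show "dlists V (length zs) \<noteq> {}" by blast
  show "map \<pi> zs \<in> dlists V (length zs)" if "\<pi> permutes V" for \<pi>
    using that assms by (auto simp: dlists_def distinct_map permutes_inj_on permutes_in_image)
  fix xs ys assume xs: "xs \<in> dlists V (length zs)" and ys: "ys \<in> dlists V (length zs)"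
  define f where "f v = ys ! (SOME i. i < length xs \<and> xs ! i = v)" for v
  have f: "f (xs ! i) = ys ! i" if "i < length xs" for i
  proof -
    have "(SOME j. j < length xs \<and> xs ! j = xs ! i) = i"
      using that xs by (intro some_equality) (auto simp: dlists_def nth_eq_iff_index_eq)
    then show ?thesis by (simp add: f_def)
  qed
  then have map: "map f xs = ys"
    using xs ys by (intro nth_equalityI) (auto simp: dlists_def)
  have "bij_betw f (set xs) (set ys)"
    using xs ys map distinct_map[of f xs] by (auto simp: dlists_def bij_betw_def simp flip: set_map)
  then obtain \<sigma> where \<sigma>: "\<sigma> permutes V" "\<forall>x\<in>set xs. \<sigma> x = f x"
    using permutes_extend_bij[OF assms(1), of "set xs" "set ys" f] xs ys by (auto simp: dlists_def)
  have "map \<sigma> xs = ys" using \<sigma>(2) map by (metis map_cong)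
  then show "\<exists>\<sigma>. \<sigma> permutes V \<and> (\<forall>\<pi>. \<pi> permutes V \<longrightarrow> map \<pi> zs = xs \<longrightarrow> map (\<sigma> \<circ> \<pi>) zs = ys)"
    using \<sigma>(1) by (intro exI[of _ \<sigma>]) (auto simp flip: map_map)
qed (use assms in auto)

section \<open>Hit patterns of column blocks\<close>

lemma sum_Pow_nonsingleton:
  fixes a b :: real
  assumes "finite B"
  shows "(\<Sum>Y\<in>Pow B. of_bool (card Y \<noteq> 1) * (a ^ card Y * b ^ (card B - card Y)))
    = (a + b) ^ card B - card B * (a * b ^ (card B - 1))"
proof -
  have "(\<Sum>Y\<in>Pow B. of_bool (card Y = 1) * (a ^ card Y * b ^ (card B - card Y)))
      = (\<Sum>Y\<in>{Y. Y \<subseteq> B \<and> card Y = 1}. a ^ card Y * b ^ (card B - card Y))"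
    using assms by (intro sum.mono_neutral_cong_right) auto
  also have "\<dots> = card B * (a * b ^ (card B - 1))"
    using n_subsets[OF assms, of 1] by simp
  finally have 1: "(\<Sum>Y\<in>Pow B. of_bool (card Y = 1) * (a ^ card Y * b ^ (card B - card Y)))
      = card B * (a * b ^ (card B - 1))" .
  have "(\<Sum>Y\<in>Pow B. of_bool (card Y \<noteq> 1) * (a ^ card Y * b ^ (card B - card Y)))
      + (\<Sum>Y\<in>Pow B. of_bool (card Y = 1) * (a ^ card Y * b ^ (card B - card Y)))
      = (\<Sum>Y\<in>Pow B. a ^ card Y * b ^ (card B - card Y))"
    unfolding sum.distrib[symmetric] by (intro sum.cong) auto
  then show ?thesis using 1 sum_Pow_binomial[OF assms, of a b] by simp
qed

lemma sum_Pow_nonempty: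
  fixes a b :: real
  assumes "finite B"
  shows "(\<Sum>Y\<in>Pow B. of_bool (Y \<noteq> {}) * (a ^ card Y * b ^ (card B - card Y))) = (a + b) ^ card B - b ^ card B"
proof -
  have "(\<Sum>Y\<in>Pow B. of_bool (Y \<noteq> {}) * (a ^ card Y * b ^ (card B - card Y)))
      = (\<Sum>Y\<in>Pow B - {{}}. a ^ card Y * b ^ (card B - card Y))"
    using assms by (intro sum.mono_neutral_cong_right) auto
  also have "\<dots> = (\<Sum>Y\<in>Pow B. a ^ card Y * b ^ (card B - card Y)) - b ^ card B"
    using assms by (subst sum_diff1) auto
  finally show ?thesis using sum_Pow_binomial[OF assms, of a b] by simp
qed

text \<open>With \<open>u = e * q\<close> and \<open>s = 1 / p\<close> the sum over all patterns is
  about \<open>1 + u * (s - 1)\<close>, and the excluded singletons weigh about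
  \<open>u * s\<close>. The difference is \<open>1 - u\<close> up to \<open>(u * s)^2\<close>:
  forbidding single hits turns the gain \<open>u * (s - 1)\<close> into the loss
  \<open>u\<close>.\<close>

lemma nonsingleton_block_le:
  fixes p q :: real
  assumes p: "0 < p" "p \<le> 1" and q: "0 \<le> q" "q \<le> 1" "real e * q \<le> p"
  shows "(q * (1 / p) + (1 - q)) ^ e - real e * (q * (1 / p) * (1 - q) ^ (e - 1))
    \<le> exp (- (real e * q) + (real e * q)\<^sup>2 / p\<^sup>2)"
proof -
  define u where "u = real e * q"
  define s where "s = 1 / p"
  have s: "1 \<le> s" using p by (simp add: s_def)
  have u0: "0 \<le> u" using q by (simp add: u_def)
  have us: "u * s \<le> 1" using q p by (simp add: u_def s_def)
  have "(q * s + (1 - q)) ^ e \<le> exp (q * (s - 1)) ^ e"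
  proof (rule power_mono)
    show "q * s + (1 - q) \<le> exp (q * (s - 1))"
      using exp_ge_add_one_self[of "q * (s - 1)"] by (simp add: algebra_simps)
    show "0 \<le> q * s + (1 - q)" using q s by simp
  qed
  also have "\<dots> = exp (u * (s - 1))" by (simp add: u_def exp_of_nat_mult[symmetric] mult_ac)
  also have "\<dots> \<le> 1 + u * (s - 1) + (u * (s - 1))\<^sup>2"
  proof (rule exp_bound)
    show "0 \<le> u * (s - 1)" using s u0 by simp
    show "u * (s - 1) \<le> 1" using us u0 unfolding right_diff_distrib by simp
  qed
  finally have 1: "(q * s + (1 - q)) ^ e \<le> 1 + u * (s - 1) + (u * (s - 1))\<^sup>2" .
  have "1 - u \<le> (1 - q) ^ (e - 1)"
  proof -
    have "1 + real (e - 1) * (- q) \<le> (1 + (- q)) ^ (e - 1)"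
      using q by (intro Bernoulli_inequality) simp
    moreover have "real (e - 1) * q \<le> u" unfolding u_def using q by (intro mult_right_mono) auto
    ultimately show ?thesis by simp
  qed
  then have 2: "u * s * (1 - u) \<le> real e * (q * s * (1 - q) ^ (e - 1))"
  proof -
    have "u * s * (1 - u) \<le> u * s * (1 - q) ^ (e - 1)"
      using \<open>1 - u \<le> (1 - q) ^ (e - 1)\<close> u0 s by (intro mult_left_mono) auto
    then show ?thesis by (simp add: u_def mult_ac)
  qed
  have "(q * s + (1 - q)) ^ e - real e * (q * s * (1 - q) ^ (e - 1))
      \<le> 1 + u * (s - 1) + (u * (s - 1))\<^sup>2 - u * s * (1 - u)"
    using 1 2 by linarith
  also have "\<dots> = 1 + (- u + u\<^sup>2 * (s\<^sup>2 - (s - 1)))" by (simp add: power2_eq_square algebra_simps)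
  also have "\<dots> \<le> 1 + (- u + u\<^sup>2 * s\<^sup>2)" using s by (intro add_left_mono mult_left_mono) auto
  also have "\<dots> \<le> exp (- u + u\<^sup>2 * s\<^sup>2)" by (rule exp_ge_add_one_self)
  also have "u\<^sup>2 * s\<^sup>2 = u\<^sup>2 / p\<^sup>2" by (simp add: s_def power_divide)
  finally show ?thesis unfolding u_def s_def .
qed

lemma blocks_partition:
  fixes e n :: nat
  shows "disjoint_family_on (\<lambda>c. {c * e..<c * e + e}) {..<n}" "(\<Union>c<n. {c * e..<c * e + e}) = {..<n * e}"
proof -
  show "disjoint_family_on (\<lambda>c. {c * e..<c * e + e}) {..<n}"
    unfolding disjoint_family_on_def
  proof (intro ballI impI)
    fix c c' :: nat assume "c \<noteq> c'"
    moreover have "c = h div e" if "h \<in> {c * e..<c * e + e}" for c h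
      using that div_nat_eqI[of e c h] by (simp add: mult.commute)
    ultimately show "{c * e..<c * e + e} \<inter> {c' * e..<c' * e + e} = {}"
      by (metis disjoint_iff)
  qed
  show "(\<Union>c<n. {c * e..<c * e + e}) = {..<n * e}"
  proof (induction n)
    case (Suc n)
    have "{..<n * e} \<union> {n * e..<n * e + e} = {..<Suc n * e}" by auto
    then show ?case using Suc by (simp add: lessThan_Suc Un_commute)
  qed simp
qed

text \<open>
  The tilting parameter \<open>1 / p\<close> is what produces the sharp factor \<open>p ^ K\<close>: the hits concentrate
  on the fraction \<open>p\<close> of unconstrained columns.
\<close>
lemma prob_no_single_hit:
  fixes p q :: real
  assumes p: "0 < p" "p < 1" and e: "0 < e" and K: "0 < K" "K \<le> n * e" "q = real K / real (n * e)" "real e * q \<le> p"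
    and J: "J \<subseteq> {..<n}" "real (card J) = (1 - p) * real n"
  shows "measure_pmf.prob (pmf_of_set {X. X \<subseteq> {..<n * e} \<and> card X = K})
      {X. \<forall>c\<in>J. card (X \<inter> {c * e..<c * e + e}) \<noteq> 1}
    \<le> real (n * e + 1) * (p ^ K * exp (real K * real e * q / p\<^sup>2))"
proof -
  let ?B = "\<lambda>c. {c * e..<c * e + e}"
  define g :: "nat \<Rightarrow> nat set \<Rightarrow> real" where "g c Y = (if c \<in> J then of_bool (card Y \<noteq> 1) else 1)" for c Y
  let ?F = "\<lambda>c. \<Sum>Y\<in>Pow (?B c). g c Y * ((q * (1 / p)) ^ card Y * (1 - q) ^ (card (?B c) - card Y))"
  let ?G = "\<lambda>c. if c \<in> J then exp (- (real e * q) + (real e * q)\<^sup>2 / p\<^sup>2) else exp (real e * q * (1 / p - 1))"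
  have N: "0 < n * e" using K(1,2) by linarith
  have "real K \<le> real (n * e)" using K(2) by linarith
  then have q: "0 \<le> q" "q \<le> 1" unfolding K(3) using N by (simp_all add: divide_le_eq_1)
  have 1: "measure_pmf.prob (pmf_of_set {X. X \<subseteq> {..<n * e} \<and> card X = K})
      {X. \<forall>c\<in>J. card (X \<inter> ?B c) \<noteq> 1}
    \<le> real (n * e + 1) * inverse (1 / p) ^ K *
      (\<Prod>c<n. ?F c)"
    by (rule prob_uniform_subset_le[OF _ _ blocks_partition])
       (use p K N J in \<open>auto simp: g_def intro!: prod_ge_1\<close>)
  have "(\<Prod>c<n. ?F c)
    \<le> (\<Prod>c<n. ?G c)"
  proof (rule prod_mono, rule conjI)
    fix c
    show "0 \<le> ?F c"
      using q p by (intro sum_nonneg mult_nonneg_nonneg) (auto simp: g_def)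
    show "?F c
      \<le> ?G c"
    proof (cases "c \<in> J")
      case True
      then have "?F c
        = (q * (1 / p) + (1 - q)) ^ e - real e * (q * (1 / p) * (1 - q) ^ (e - 1))"
        using sum_Pow_nonsingleton[of "?B c" "q * (1 / p)" "1 - q"] by (simp add: g_def)
      then show ?thesis using nonsingleton_block_le[of p q e] p q K True by simp
    next
      case False
      then have "?F c
        = (q * (1 / p) + (1 - q)) ^ e"
        using sum_Pow_binomial[of "?B c" "q * (1 / p)" "1 - q"] by (simp add: g_def)
      also have "\<dots> \<le> exp (q * (1 / p - 1)) ^ e"
      proof (rule power_mono)
        show "q * (1 / p) + (1 - q) \<le> exp (q * (1 / p - 1))"
          using exp_ge_add_one_self[of "q * (1 / p - 1)"] by (simp add: algebra_simps)
        show "0 \<le> q * (1 / p) + (1 - q)" using q p by (intro add_nonneg_nonneg) auto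
      qed
      also have "\<dots> = exp (real e * q * (1 / p - 1))" by (simp add: exp_of_nat_mult[symmetric] mult_ac)
      finally show ?thesis using False by simp
    qed
  qed
  also have "(\<Prod>c<n. ?G c)
    = exp (- (real e * q) + (real e * q)\<^sup>2 / p\<^sup>2) ^ card J * exp (real e * q * (1 / p - 1)) ^ (n - card J)"
  proof -
    have "{..<n} \<inter> {c. c \<in> J} = J" "{..<n} \<inter> - {c. c \<in> J} = {..<n} - J" using J by auto
    moreover have "card ({..<n} - J) = n - card J"
      using J finite_subset by (subst card_Diff_subset) auto
    ultimately show ?thesis by (simp add: prod.If_cases)
  qed
  also have "\<dots> \<le> exp (real K * real e * q / p\<^sup>2)"
  proof -
    have "card J \<le> n" using J card_mono[of "{..<n}" J] by simp
    then have nJ: "real (n - card J) = p * real n" using J by (simp add: of_nat_diff algebra_simps)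
    have KK: "real n * (real e * q) = real K" using K N by simp
    have "exp (- (real e * q) + (real e * q)\<^sup>2 / p\<^sup>2) ^ card J * exp (real e * q * (1 / p - 1)) ^ (n - card J)
      = exp (real (card J) * (- (real e * q) + (real e * q)\<^sup>2 / p\<^sup>2) + real (n - card J) * (real e * q * (1 / p - 1)))"
      by (simp only: exp_of_nat_mult exp_add)
    \<comment> \<open>The linear terms cancel exactly: each of the \<open>(1 - p) * n\<close>
      constrained blocks contributes \<open>- e * q\<close>, each of the \<open>p * n\<close> free
      ones \<open>e * q * (1 / p - 1)\<close>. Only the quadratic error survives.\<close>
    also have "real (card J) * (- (real e * q) + (real e * q)\<^sup>2 / p\<^sup>2) + real (n - card J) * (real e * q * (1 / p - 1))
      = (1 - p) * ((real n * (real e * q)) * (real e * q) / p\<^sup>2)"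
      unfolding nJ J(2) using p by (simp add: field_simps power2_eq_square)
    also have "\<dots> = (1 - p) * (real K * real e * q / p\<^sup>2)" unfolding KK by simp
    also have "\<dots> \<le> 1 * (real K * real e * q / p\<^sup>2)" using p q by (intro mult_right_mono) auto
    finally show ?thesis by simp
  qed
  finally have "(\<Prod>c<n. ?F c)
    \<le> exp (real K * real e * q / p\<^sup>2)" .
  from mult_left_mono[OF this, of "real (n * e + 1) * inverse (1 / p) ^ K"] p
  show ?thesis using 1 by (simp add: mult.assoc)
qed

text \<open>Here the tilt is 1. A block is hit with probability \<open>1 - (1 - q) ^ e\<close>, at
  most \<open>e * q\<close> by Bernoulli's inequality.\<close>

lemma prob_all_hit:
  fixes q :: real
  assumes e: "0 < e" "0 < n" and K: "K \<le> n * e" "q = real K / real (n * e)" and J: "J \<subseteq> {..<n}"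
  shows "measure_pmf.prob (pmf_of_set {X. X \<subseteq> {..<n * e} \<and> card X = K})
      {X. \<forall>c\<in>J. X \<inter> {c * e..<c * e + e} \<noteq> {}}
    \<le> real (n * e + 1) * (real e * q) ^ card J"
proof -
  let ?B = "\<lambda>c. {c * e..<c * e + e}"
  define g :: "nat \<Rightarrow> nat set \<Rightarrow> real" where "g c Y = (if c \<in> J then of_bool (Y \<noteq> {}) else 1)" for c Y
  let ?F = "\<lambda>c. \<Sum>Y\<in>Pow (?B c). g c Y * ((q * 1) ^ card Y * (1 - q) ^ (card (?B c) - card Y))"
  have N: "0 < n * e" using e by simp
  have "real K \<le> real (n * e)" using K(1) by linarith
  then have q: "0 \<le> q" "q \<le> 1" unfolding K(2) using N by (simp_all add: divide_le_eq_1)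
  have "measure_pmf.prob (pmf_of_set {X. X \<subseteq> {..<n * e} \<and> card X = K})
      {X. \<forall>c\<in>J. X \<inter> ?B c \<noteq> {}}
    \<le> real (n * e + 1) * inverse 1 ^ K *
      (\<Prod>c<n. ?F c)"
    by (rule prob_uniform_subset_le[OF _ _ blocks_partition])
       (use K N J in \<open>auto simp: g_def intro!: prod_ge_1\<close>)
  also have "(\<Prod>c<n. ?F c)
    \<le> (\<Prod>c<n. if c \<in> J then real e * q else 1)"
  proof (rule prod_mono, rule conjI)
    fix c
    show "0 \<le> ?F c"
      using q by (intro sum_nonneg mult_nonneg_nonneg) (auto simp: g_def)
    show "?F c
      \<le> (if c \<in> J then real e * q else 1)"
    proof (cases "c \<in> J")
      case True
      then have "?F c
        = 1 - (1 - q) ^ e"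
        using sum_Pow_nonempty[of "?B c" q "1 - q"] by (simp add: g_def)
      moreover have "1 + real e * (- q) \<le> (1 + (- q)) ^ e" using q by (intro Bernoulli_inequality) simp
      ultimately show ?thesis using True by simp
    next
      case False
      then show ?thesis using sum_Pow_binomial[of "?B c" q "1 - q"] by (simp add: g_def)
    qed
  qed
  also have "(\<Prod>c<n. if c \<in> J then real e * q else 1) = (real e * q) ^ card J"
  proof -
    have "{..<n} \<inter> {c. c \<in> J} = J" using J by auto
    then show ?thesis by (simp add: prod.If_cases)
  qed
  finally show ?thesis by (simp add: mult_left_mono)
qed

text \<open>Exponential Markov inequality with \<open>exp (2 * card (X \<inter> W) - K)\<close> for
  the two blocks \<open>W\<close> and its complement. By \<open>exp 2 \<le> 9\<close> the block
  \<open>W\<close> contributes at most \<open>exp (8 * q * card W)\<close>, and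
  \<open>16 * card W \<le> N\<close> makes this at most \<open>exp (K / 2)\<close>.\<close>

lemma prob_subset_concentrated:
  fixes q :: real
  assumes K: "K \<le> N" "0 < N" and W: "W \<subseteq> {..<N}" "16 * card W \<le> N"
  shows "measure_pmf.prob (pmf_of_set {X. X \<subseteq> {..<N} \<and> card X = K}) {X. K < 2 * card (X \<inter> W)}
    \<le> real (N + 1) * exp (- (real K / 2))"
proof -
  define q where "q = real K / real N"
  have q: "0 \<le> q" "q \<le> 1" using K by (auto simp: q_def)
  define B where "B b = (if b then W else {..<N} - W)" for b
  define g :: "bool \<Rightarrow> nat set \<Rightarrow> real" where "g b Y = (if b then exp (2 * real (card Y) - real K) else 1)" for b Y
  have finW: "finite W" using W finite_subset by blast
  have "measure_pmf.prob (pmf_of_set {X. X \<subseteq> {..<N} \<and> card X = K}) {X. K < 2 * card (X \<inter> W)}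
    \<le> real (N + 1) * inverse 1 ^ K *
      (\<Prod>b\<in>UNIV. \<Sum>Y\<in>Pow (B b). g b Y * ((q * 1) ^ card Y * (1 - q) ^ (card (B b) - card Y)))"
    by (rule prob_uniform_subset_le)
       (use K W finW in \<open>auto simp: g_def B_def q_def disjoint_family_on_def UNIV_bool\<close>)
  also have "(\<Prod>b\<in>UNIV. \<Sum>Y\<in>Pow (B b). g b Y * ((q * 1) ^ card Y * (1 - q) ^ (card (B b) - card Y)))
     = (\<Sum>Y\<in>Pow W. exp (- real K) * ((q * exp 2) ^ card Y * (1 - q) ^ (card W - card Y)))
     * (\<Sum>Y\<in>Pow ({..<N} - W). q ^ card Y * (1 - q) ^ (card ({..<N} - W) - card Y))"
  proof -
    have "exp (2 * real c - real K) = exp (- real K) * exp 2 ^ c" for c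
      by (metis exp_add exp_of_nat_mult mult.commute uminus_add_conv_diff)
    then have T: "g True Y * ((q * 1) ^ card Y * (1 - q) ^ (card W - card Y))
        = exp (- real K) * ((q * exp 2) ^ card Y * (1 - q) ^ (card W - card Y))" for Y
      by (simp add: g_def power_mult_distrib)
    have pr: "(\<Prod>b\<in>UNIV. f b) = f True * f False" for f :: "bool \<Rightarrow> real"
      by (simp add: UNIV_bool)
    show ?thesis unfolding pr B_def if_True if_False T by (simp add: g_def)
  qed
  also have "\<dots> = exp (- real K) * (q * exp 2 + (1 - q)) ^ card W"
    using sum_Pow_binomial[OF finW, of "q * exp 2" "1 - q"] sum_Pow_binomial[of "{..<N} - W" q "1 - q"]
    by (simp flip: sum_distrib_left)
  also have "\<dots> \<le> exp (- real K) * exp (8 * q) ^ card W"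
  proof -
    have "exp (2::real) = exp 1 * exp 1" by (simp flip: exp_add)
    also have "\<dots> \<le> 3 * 3" using exp_le by (intro mult_mono) auto
    finally have "q * exp 2 \<le> q * 9" using q by (intro mult_left_mono) auto
    then have "q * exp 2 + (1 - q) \<le> exp (8 * q)"
      using exp_ge_add_one_self[of "8 * q"] by linarith
    then show ?thesis using q by (intro mult_left_mono power_mono) auto
  qed
  also have "\<dots> = exp (- real K + 8 * q * card W)"
  proof -
    have "exp (8 * q) ^ card W = exp (8 * q * card W)" by (metis exp_of_nat_mult mult.commute)
    then show ?thesis by (simp only: exp_add)
  qed
  also have "\<dots> \<le> exp (- (real K / 2))"
  proof -
    have "16 * real (card W) \<le> real N" using W(2) by linarith
    then have "q * (16 * real (card W)) \<le> q * real N" using q by (intro mult_left_mono) auto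
    also have "\<dots> = real K" using K by (simp add: q_def)
    finally show ?thesis by simp
  qed
  finally show ?thesis by (simp add: mult_left_mono)
qed

section \<open>Columns, rows and kernel vectors in terms of half-edges\<close>

abbreviation rand_perm :: "nat \<Rightarrow> (nat \<Rightarrow> nat) pmf" where
  "rand_perm N \<equiv> pmf_of_set {\<pi>. \<pi> permutes {..<N}}"

text \<open>Rows and columns are those of the stacked matrix. Because of the transpose, the argument
  of \<open>\<pi>\<close> numbers column half-edges in blocks of \<open>e\<close> and its value
  numbers row half-edges in blocks of \<open>D\<close>. Taking the image as a set merges parallel
  edges.\<close>

definition neighbours :: "nat \<Rightarrow> nat \<Rightarrow> (nat \<Rightarrow> nat) \<Rightarrow> nat \<Rightarrow> nat set" where
  "neighbours e D \<pi> c = (\<lambda>h. \<pi> h div D) ` {c * e..<c * e + e}"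

definition kernel_vec :: "nat \<Rightarrow> nat \<Rightarrow> (nat \<Rightarrow> nat) \<Rightarrow> nat set \<Rightarrow> (nat \<Rightarrow> real) \<Rightarrow> bool" where
  "kernel_vec e D \<pi> J x \<longleftrightarrow> (\<forall>c\<in>J. (\<Sum>i\<in>neighbours e D \<pi> c. x i) = 0)"

text \<open>Recorded on the column side, so that it is a uniformly random set of its size
  (\<open>map_pmf_row_edges\<close>) and can be cut into column blocks.\<close>

definition row_edges :: "nat \<Rightarrow> nat \<Rightarrow> (nat \<Rightarrow> nat) \<Rightarrow> nat set \<Rightarrow> nat set" where
  "row_edges D m \<pi> U = {h\<in>{..<D * m}. \<pi> h div D \<in> U}"

lemma map_pmf_row_edges:
  assumes "0 < D" "U \<subseteq> {..<m}"
  shows "map_pmf (\<lambda>\<pi>. row_edges D m \<pi> U) (rand_perm (D * m))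
    = pmf_of_set {X. X \<subseteq> {..<D * m} \<and> card X = D * card U}"
proof -
  have fin: "finite U" using assms finite_subset by blast
  have sub: "{h. h div D \<in> U} \<subseteq> {..<D * m}"
  proof
    fix h assume "h \<in> {h. h div D \<in> U}"
    then have "h div D < m" using assms(2) by auto
    then show "h \<in> {..<D * m}" using div_less_iff_less_mult[OF assms(1)] by (simp add: mult.commute)
  qed
  show ?thesis
    using map_pmf_permutation_vimage[OF _ sub] card_div_vimage(1)[OF fin assms(1)]
    unfolding row_edges_def by simp
qed

lemma take_drop_concat:
  assumes "\<And>xs. xs \<in> set xss \<Longrightarrow> length xs = e" "j < length xss"
  shows "take e (drop (j * e) (concat xss)) = xss ! j"
  using assms
proof (induction xss arbitrary: j)
  case (Cons xs xss)
  then show ?case by (cases j) auto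
qed simp

lemma neighbours_subset:
  assumes "\<pi> permutes {..<D * m}" "c * e + e \<le> D * m"
  shows "neighbours e D \<pi> c \<subseteq> {..<m}"
proof -
  have "\<pi> h < D * m" if "h < c * e + e" for h
    using permutes_in_image[OF assms(1), of h] that assms(2) by simp
  then show ?thesis using div_less_of_less_mult by (auto simp: neighbours_def)
qed

text \<open>If only one half-edge of the column ends in the support, the column sum is a single
  nonzero value. Half-edges are counted instead of rows because their number is what the random
  subset model controls.\<close>

lemma kernel_no_single_hit:
  assumes x: "kernel_vec e D \<pi> J x" and c: "c \<in> J" "c * e + e \<le> D * m" and \<pi>: "\<pi> permutes {..<D * m}"
  shows "card (row_edges D m \<pi> {i. i < m \<and> x i \<noteq> 0} \<inter> {c * e..<c * e + e}) \<noteq> 1"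
proof
  assume "card (row_edges D m \<pi> {i. i < m \<and> x i \<noteq> 0} \<inter> {c * e..<c * e + e}) = 1"
  then obtain h where h: "row_edges D m \<pi> {i. i < m \<and> x i \<noteq> 0} \<inter> {c * e..<c * e + e} = {h}"
    by (auto simp: card_1_singleton_iff)
  let ?N = "neighbours e D \<pi> c"
  have sub: "?N \<subseteq> {..<m}" using neighbours_subset[OF \<pi> c(2)] .
  have hN: "\<pi> h div D \<in> ?N" "x (\<pi> h div D) \<noteq> 0" using h by (auto simp: neighbours_def row_edges_def)
  have "x i = 0" if i: "i \<in> ?N - {\<pi> h div D}" for i
  proof (rule ccontr)
    assume "x i \<noteq> 0"
    obtain h' where h': "h' \<in> {c * e..<c * e + e}" "i = \<pi> h' div D" using i by (auto simp: neighbours_def)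
    have "i < m" using i sub by auto
    then have "h' \<in> row_edges D m \<pi> {i. i < m \<and> x i \<noteq> 0} \<inter> {c * e..<c * e + e}"
      using h' c(2) \<open>x i \<noteq> 0\<close> by (auto simp: row_edges_def)
    then have "h' = h" using h by blast
    then show False using i h' by simp
  qed
  then have "(\<Sum>i\<in>?N. x i) = (\<Sum>i\<in>{\<pi> h div D}. x i)"
    using hN by (intro sum.mono_neutral_right) (auto simp: neighbours_def)
  then show False using hN x c by (simp add: kernel_vec_def)
qed

text \<open>A column that misses every exceptional row has sum \<open>a\<close> times its number of
  neighbours, and it has at least one.\<close>

lemma kernel_all_hit:
  assumes x: "kernel_vec e D \<pi> J x" and c: "c \<in> J" "c * e + e \<le> D * m" and \<pi>: "\<pi> permutes {..<D * m}"
    and a: "a \<noteq> 0" "0 < e"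
  shows "row_edges D m \<pi> {i. i < m \<and> x i \<noteq> a} \<inter> {c * e..<c * e + e} \<noteq> {}"
proof
  assume emp: "row_edges D m \<pi> {i. i < m \<and> x i \<noteq> a} \<inter> {c * e..<c * e + e} = {}"
  let ?N = "neighbours e D \<pi> c"
  have sub: "?N \<subseteq> {..<m}" using neighbours_subset[OF \<pi> c(2)] .
  have "x i = a" if i: "i \<in> ?N" for i
  proof (rule ccontr)
    assume "x i \<noteq> a"
    obtain h' where h': "h' \<in> {c * e..<c * e + e}" "i = \<pi> h' div D" using i by (auto simp: neighbours_def)
    have "i < m" using i sub by auto
    then have "h' \<in> row_edges D m \<pi> {i. i < m \<and> x i \<noteq> a} \<inter> {c * e..<c * e + e}"
      using h' c(2) \<open>x i \<noteq> a\<close> by (auto simp: row_edges_def)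
    then show False using emp by blast
  qed
  then have "(\<Sum>i\<in>?N. x i) = card ?N * a" by simp
  moreover have "card ?N \<noteq> 0" using a by (simp add: neighbours_def)
  ultimately show False using a x c by (simp add: kernel_vec_def)
qed

section \<open>Estimates for the union bounds over row sets\<close>

lemma binomial_le_exp_power:
  assumes "0 < t" "t \<le> m"
  shows "real (m choose t) * (real t / real m) ^ t \<le> exp (real t)"
proof -
  let ?y = "real t / real m"
  have "real (m choose t) * ?y ^ t \<le> (\<Sum>k\<le>m. real (m choose k) * ?y ^ k * 1 ^ (m - k))"
    using assms member_le_sum[of t "{..m}" "\<lambda>k. real (m choose k) * ?y ^ k * 1 ^ (m - k)"] by simp
  also have "\<dots> = (?y + 1) ^ m" by (rule binomial_ring[symmetric])
  also have "\<dots> \<le> exp ?y ^ m"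
    using exp_ge_add_one_self[of ?y] by (intro power_mono) (auto simp: add.commute)
  also have "\<dots> = exp (real t)" using assms by (simp add: exp_of_nat_mult[symmetric])
  finally show ?thesis .
qed

text \<open>The source of \<open>d0\<close>. The base is below 1 because
  \<open>exp 1 \<le> 3 < 2 ^ 4\<close>, and its square root \<open>r\<close> absorbs the polynomial
  factor: the product is a constant times the square of \<open>D * r ^ D\<close>.\<close>

lemma exists_degree_threshold:
  "\<exists>D0::nat. \<forall>D\<ge>D0. 4 * exp 2 * real D ^ 2 * (exp (1 / 4) / 2) ^ D \<le> 1"
proof -
  have "exp (1 / 4 :: real) < 2"
  proof (rule ccontr)
    assume "\<not> exp (1 / 4 :: real) < 2"
    then have "2 ^ 4 \<le> exp (1 / 4 :: real) ^ 4" by (intro power_mono) auto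
    also have "\<dots> = exp 1" by (simp flip: exp_of_nat_mult)
    finally show False using exp_le by simp
  qed
  let ?r = "sqrt (exp (1 / 4) / 2) :: real"
  have r: "norm ?r < 1" using \<open>exp (1 / 4 :: real) < 2\<close> by (simp add: real_sqrt_lt_1_iff)
  have "(\<lambda>n. 4 * exp 2 * (real n * ?r ^ n) ^ 2) \<longlonglongrightarrow> 4 * exp 2 * 0 ^ 2"
    by (intro tendsto_intros powser_times_n_limit_0[OF r])
  then have "\<forall>\<^sub>F n in sequentially. 4 * exp 2 * (real n * ?r ^ n) ^ 2 < 1"
    by (rule order_tendstoD) simp
  then obtain D0 where D0: "\<And>D. D \<ge> D0 \<Longrightarrow> 4 * exp 2 * (real D * ?r ^ D) ^ 2 < 1"
    by (auto simp: eventually_sequentially)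
  have "(real D * ?r ^ D) ^ 2 = real D ^ 2 * (exp (1 / 4) / 2) ^ D" for D
  proof -
    have "(?r ^ D) ^ 2 = (?r ^ 2) ^ D" by (simp only: power_mult[symmetric] mult.commute)
    then show ?thesis by (simp add: power_mult_distrib)
  qed
  then have "4 * exp 2 * real D ^ 2 * (exp (1 / 4) / 2) ^ D \<le> 1" if "D0 \<le> D" for D
    using D0[OF that] by (simp add: mult.assoc)
  then show ?thesis by blast
qed

text \<open>The exponential factor is the quadratic error of the tilted bound. If its exponent is at
  most 1, it costs \<open>exp 1\<close>, and \<open>exp 2 * exp 1\<close> is the origin of the
  constant \<open>exp 3\<close>. Otherwise \<open>\<beta>\<close> is at least
  \<open>p^2 / (D * e)\<close>, while the upper limit on \<open>\<beta>\<close> keeps the exponent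
  at most \<open>D / 4\<close>; then \<open>p < 1 / 2\<close> gives
  \<open>p ^ D \<le> 4 * p^2 / 2 ^ D\<close>, and the degree condition absorbs the remaining
  \<open>D^2\<close>.\<close>

lemma small_support_estimate:
  fixes p \<beta> :: real
  assumes p: "0 < p" "p < 1 / 2" and e: "0 < e" "e \<le> D" "2 \<le> D"
    and D: "4 * exp 2 * real D ^ 2 * (exp (1 / 4) / 2) ^ D \<le> 1"
    and \<beta>: "exp 3 * p ^ D \<le> \<beta>" "\<beta> \<le> p\<^sup>2 / (4 * real e)"
  shows "exp 2 * p ^ D * exp (real D * real e * \<beta> / p\<^sup>2) \<le> \<beta>"
proof (cases "real D * real e * \<beta> / p\<^sup>2 \<le> 1")
  case True
  then have "exp 2 * p ^ D * exp (real D * real e * \<beta> / p\<^sup>2) \<le> exp 2 * p ^ D * exp 1"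
    using p by (intro mult_left_mono) auto
  also have "\<dots> = exp 3 * p ^ D" by (simp add: mult_ac flip: exp_add)
  finally show ?thesis using \<beta> by simp
next
  case False
  then have b: "p\<^sup>2 \<le> real D * real e * \<beta>" using p by (simp add: field_simps)
  have "real D * real e * \<beta> / p\<^sup>2 \<le> real D * real e * (p\<^sup>2 / (4 * real e)) / p\<^sup>2"
    using \<beta> by (intro divide_right_mono mult_left_mono) auto
  also have "\<dots> = real D / 4" using e p by (simp add: field_simps)
  finally have "exp (real D * real e * \<beta> / p\<^sup>2) \<le> exp (real D / 4)" by simp
  also have "\<dots> = exp (1 / 4) ^ D" by (simp flip: exp_of_nat_mult)
  finally have 1: "exp (real D * real e * \<beta> / p\<^sup>2) \<le> exp (1 / 4) ^ D" .
  have "p ^ D = p\<^sup>2 * p ^ (D - 2)" using e by (metis le_add_diff_inverse power_add)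
  also have "\<dots> \<le> p\<^sup>2 * (1 / 2) ^ (D - 2)" using p by (intro mult_left_mono power_mono) auto
  also have "(1 / 2 :: real) ^ (D - 2) = 4 * (1 / 2) ^ D" using e by (simp add: power_diff power2_eq_square)
  finally have 2: "p ^ D \<le> p\<^sup>2 * (4 * (1 / 2) ^ D)" .
  have "exp 2 * p ^ D * exp (real D * real e * \<beta> / p\<^sup>2) \<le> exp 2 * (p\<^sup>2 * (4 * (1 / 2) ^ D)) * exp (1 / 4) ^ D"
    using 1 2 p by (intro mult_mono) auto
  also have "\<dots> = p\<^sup>2 * (4 * exp 2 * (exp (1 / 4) / 2) ^ D)" by (simp add: power_divide field_simps)
  also have "\<dots> \<le> (real D * real e * \<beta>) * (4 * exp 2 * (exp (1 / 4) / 2) ^ D)"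
    using b by (intro mult_right_mono) auto
  also have "\<dots> \<le> (real D * real D * \<beta>) * (4 * exp 2 * (exp (1 / 4) / 2) ^ D)"
  proof -
    have "0 \<le> \<beta>" using \<beta>(1) p by (meson exp_ge_zero mult_nonneg_nonneg order_trans zero_le_power less_imp_le)
    then show ?thesis using e by (intro mult_right_mono mult_left_mono) auto
  qed
  also have "\<dots> = \<beta> * (4 * exp 2 * real D ^ 2 * (exp (1 / 4) / 2) ^ D)" by (simp add: power2_eq_square)
  also have "\<dots> \<le> \<beta> * 1"
  proof -
    have "0 \<le> \<beta>" using \<beta>(1) p by (meson exp_ge_zero mult_nonneg_nonneg order_trans zero_le_power less_imp_le)
    then show ?thesis using D by (intro mult_left_mono) auto
  qed
  finally show ?thesis by simp
qed

text \<open>Every cardinality from 0 to \<open>m\<close> contributes exactly 1. A union bound whose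
  terms are proportional to \<open>1 / (m choose card T)\<close> thus costs only a factor
  \<open>m + 1\<close>.\<close>

lemma sum_Pow_inverse_binomial:
  "(\<Sum>T\<in>Pow {..<m}. 1 / real (m choose card T)) = real m + 1"
proof -
  have "(\<Sum>T\<in>Pow {..<m}. 1 / real (m choose card T))
      = (\<Sum>t\<le>m. \<Sum>T\<in>{T\<in>Pow {..<m}. card T = t}. 1 / real (m choose card T))"
  proof (rule sum.group[symmetric])
    show "card ` Pow {..<m} \<subseteq> {..m}"
      using card_mono[of "{..<m}"] by auto
  qed simp_all
  also have "\<dots> = (\<Sum>t\<le>m. 1)"
  proof (intro sum.cong refl)
    fix t assume "t \<in> {..m}"
    moreover have "card {T\<in>Pow {..<m}. card T = t} = m choose t"
      using n_subsets[of "{..<m}" t] by simp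
    ultimately show "(\<Sum>T\<in>{T\<in>Pow {..<m}. card T = t}. 1 / real (m choose card T)) = 1" by simp
  qed
  finally show ?thesis by simp
qed

text \<open>Apart from the factor \<open>D * m + 1\<close>, the bound is the \<open>t\<close>-th
  power of a base that \<open>small_support_estimate\<close> makes at most
  \<open>exp (- 2) * t / m\<close>. One \<open>exp (- t)\<close> pays for \<open>m choose t\<close>;
  the other remains, and \<open>t\<close> exceeds \<open>exp 3 * p ^ D * m\<close>.\<close>

lemma prob_kernel_small_le:
  fixes p :: real
  assumes p: "0 < p" "p < 1 / 2" and e: "0 < e" "e \<le> D" "2 \<le> D" "D = g * e"
    and D: "4 * exp 2 * real D ^ 2 * (exp (1 / 4) / 2) ^ D \<le> 1"
    and J: "J \<subseteq> {..<g * m}" "real (card J) = (1 - p) * real (g * m)"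
    and T: "T \<subseteq> {..<m}" "exp 3 * p ^ D * m < card T" "card T < p\<^sup>2 * m / (4 * real e)"
  shows "measure_pmf.prob (rand_perm (D * m))
      {\<pi>. \<forall>c\<in>J. card (row_edges D m \<pi> T \<inter> {c * e..<c * e + e}) \<noteq> 1}
    \<le> real (D * m + 1) * exp (- (exp 3 * p ^ D * m)) * (1 / real (m choose card T))"
proof -
  define t where "t = card T"
  have D0: "0 < D" using e by simp
  have "0 \<le> exp 3 * p ^ D * m" using p by simp
  then have t: "0 < t" using T unfolding t_def by linarith
  have tm: "t \<le> m" using card_mono[OF _ T(1)] by (simp add: t_def)
  then have m: "0 < m" using t by simp
  have NE: "g * m * e = D * m" using e by simp
  define \<beta> where "\<beta> = real t / real m"
  let ?f = "p ^ D * exp (real D * real e * \<beta> / p\<^sup>2)"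
  have \<beta>: "0 < \<beta>" "exp 3 * p ^ D \<le> \<beta>" "\<beta> \<le> p\<^sup>2 / (4 * real e)"
    using T t m e by (auto simp: \<beta>_def t_def field_simps)
  have q: "\<beta> = real (D * t) / real (g * m * e)" unfolding NE \<beta>_def using D0 by simp
  have eb: "real e * \<beta> \<le> p"
  proof -
    have "real e * \<beta> \<le> real e * (p\<^sup>2 / (4 * real e))" using \<beta> by (intro mult_left_mono) auto
    also have "\<dots> = p * (p / 4)" using e by (simp add: power2_eq_square)
    also have "\<dots> \<le> p * 1" using p by (intro mult_left_mono) auto
    finally show ?thesis by simp
  qed
  have "measure_pmf.prob (rand_perm (D * m))
      {\<pi>. \<forall>c\<in>J. card (row_edges D m \<pi> T \<inter> {c * e..<c * e + e}) \<noteq> 1}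
    = measure_pmf.prob (pmf_of_set {X. X \<subseteq> {..<g * m * e} \<and> card X = D * t})
      {X. \<forall>c\<in>J. card (X \<inter> {c * e..<c * e + e}) \<noteq> 1}"
    unfolding NE t_def map_pmf_row_edges[OF D0 T(1), symmetric] by (simp add: vimage_def)
  also have "\<dots> \<le> real (g * m * e + 1) * (p ^ (D * t) * exp (real (D * t) * real e * \<beta> / p\<^sup>2))"
  proof (rule prob_no_single_hit)
    show "D * t \<le> g * m * e" unfolding NE using tm by simp
  qed (use p e D0 t q eb J in auto)
  also have "p ^ (D * t) * exp (real (D * t) * real e * \<beta> / p\<^sup>2) = ?f ^ t"
  proof -
    have "real (D * t) * real e * \<beta> / p\<^sup>2 = real t * (real D * real e * \<beta> / p\<^sup>2)" by simp
    then show ?thesis by (simp only: exp_of_nat_mult power_mult power_mult_distrib)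
  qed
  also have "\<dots> \<le> exp (- (exp 3 * p ^ D * m)) * (1 / real (m choose t))"
  proof -
    have "exp 2 * p ^ D * exp (real D * real e * \<beta> / p\<^sup>2) \<le> \<beta>"
      using p e D \<beta> by (intro small_support_estimate) auto
    then have "exp 2 * ?f \<le> \<beta>" by (simp add: mult.assoc)
    then have "(exp 2 * ?f) ^ t \<le> \<beta> ^ t"
      using p by (intro power_mono) auto
    then have "exp 2 ^ t * ?f ^ t \<le> \<beta> ^ t"
      by (simp only: power_mult_distrib)
    moreover have "exp 2 ^ t = exp (2 * real t)" by (metis exp_of_nat_mult mult.commute)
    ultimately have 1: "exp (2 * real t) * ?f ^ t \<le> \<beta> ^ t" by simp
    have C0: "0 < real (m choose t)" using tm by simp
    have "real (m choose t) * (exp (2 * real t) * ?f ^ t) \<le> exp (real t)"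
      using mult_left_mono[OF 1, of "real (m choose t)"] binomial_le_exp_power[OF t tm] unfolding \<beta>_def by linarith
    then have "exp (- 2 * real t) * (real (m choose t) * (exp (2 * real t) * ?f ^ t))
      \<le> exp (- 2 * real t) * exp (real t)" by (intro mult_left_mono) auto
    also have "\<dots> = exp (- real t)" by (simp flip: exp_add)
    also have "\<dots> \<le> exp (- (exp 3 * p ^ D * m))" using T(2) by (simp add: t_def)
    finally have "real (m choose t) * ?f ^ t * (exp (- 2 * real t) * exp (2 * real t))
      \<le> exp (- (exp 3 * p ^ D * m))" by (simp only: mult_ac)
    then have "real (m choose t) * ?f ^ t \<le> exp (- (exp 3 * p ^ D * m))"
      by (simp flip: exp_add)
    then show ?thesis using C0 by (simp add: pos_le_divide_eq mult.commute)
  qed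
  finally show ?thesis unfolding NE t_def by (simp add: mult_left_mono mult.assoc)
qed

text \<open>Here \<open>e * q \<le> p^2 / 4 \<le> 1 / 16\<close> and at least half of the
  \<open>g * m\<close> columns survive, so \<open>(1 / 16) ^ card J \<le> (1 / 4) ^ m\<close>,
  enough for a union over all \<open>2 ^ m\<close> row sets.\<close>

lemma prob_kernel_constant_le:
  fixes p :: real
  assumes p: "0 < p" "p < 1 / 2" and e: "0 < e" "D = g * e" "0 < g" "0 < m"
    and J: "J \<subseteq> {..<g * m}" "real (card J) = (1 - p) * real (g * m)"
    and U: "U \<subseteq> {..<m}" "card U < p\<^sup>2 * m / (4 * real e)"
  shows "measure_pmf.prob (rand_perm (D * m))
      {\<pi>. \<forall>c\<in>J. row_edges D m \<pi> U \<inter> {c * e..<c * e + e} \<noteq> {}}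
    \<le> real (D * m + 1) * (1 / 4) ^ m"
proof -
  define q where "q = real (card U) / real m"
  have D0: "0 < D" using e by simp
  have NE: "g * m * e = D * m" using e by simp
  have um: "card U \<le> m" using card_mono[OF _ U(1)] by simp
  have q: "q = real (D * card U) / real (g * m * e)" unfolding NE q_def using D0 by simp
  have q0: "0 \<le> q" by (simp add: q_def)
  have eq: "real e * q \<le> 1 / 16"
  proof -
    have "q \<le> p\<^sup>2 / (4 * real e)" using U(2) e by (simp add: q_def field_simps)
    then have "real e * q \<le> real e * (p\<^sup>2 / (4 * real e))" by (intro mult_left_mono) auto
    also have "\<dots> = p\<^sup>2 / 4" using e by simp
    also have "\<dots> \<le> (1 / 2)\<^sup>2 / 4" using p by (intro divide_right_mono power_mono) auto
    finally show ?thesis by (simp add: power2_eq_square)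
  qed
  have "measure_pmf.prob (rand_perm (D * m))
      {\<pi>. \<forall>c\<in>J. row_edges D m \<pi> U \<inter> {c * e..<c * e + e} \<noteq> {}}
    = measure_pmf.prob (pmf_of_set {X. X \<subseteq> {..<g * m * e} \<and> card X = D * card U})
      {X. \<forall>c\<in>J. X \<inter> {c * e..<c * e + e} \<noteq> {}}"
    unfolding NE map_pmf_row_edges[OF D0 U(1), symmetric] by (simp add: vimage_def)
  also have "\<dots> \<le> real (g * m * e + 1) * (real e * q) ^ card J"
  proof (rule prob_all_hit)
    show "D * card U \<le> g * m * e" unfolding NE using um by simp
  qed (use e q J in auto)
  also have "(real e * q) ^ card J \<le> (1 / 16) ^ card J" using q0 eq by (intro power_mono) auto
  also have "(1 / 16 :: real) ^ card J = (1 / 4) ^ (2 * card J)" by (simp add: power_mult power2_eq_square)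
  also have "(1 / 4 :: real) ^ (2 * card J) \<le> (1 / 4) ^ m"
  proof (rule power_decreasing)
    have "(1 / 2) * real (g * m) \<le> (1 - p) * real (g * m)" using p by (intro mult_right_mono) auto
    then have "real (g * m) \<le> real (2 * card J)" using J(2) by simp
    then have "g * m \<le> 2 * card J" by linarith
    moreover have "m \<le> g * m" using e by simp
    ultimately show "m \<le> 2 * card J" by linarith
  qed auto
  finally show ?thesis unfolding NE by (simp add: mult_left_mono)
qed

lemma exp_neg_two_le: "exp (- 2 :: real) \<le> 1 / 4"
proof -
  have "2 * 2 \<le> exp 1 * exp (1 :: real)" using exp_ge_add_one_self[of 1] by (intro mult_mono) auto
  also have "\<dots> = exp 2" by (simp flip: exp_add)
  finally show ?thesis by (simp add: exp_minus field_simps)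
qed

text \<open>The condition \<open>16 \<le> g * p^2\<close> comes from here: \<open>U\<close> then
  owns at least \<open>4 * m\<close> half-edges, and \<open>exp (- 2 * m) \<le> (1 / 4) ^ m\<close>
  withstands the union over \<open>U\<close>.\<close>

lemma prob_pool_depleted_le:
  fixes p :: real and e D g m :: nat
  assumes e: "0 < e" "D = g * e" "0 < g" "0 < m" and g: "16 \<le> real g * p\<^sup>2"
    and U: "U \<subseteq> {..<m}" "p\<^sup>2 * m / (4 * real e) \<le> card U"
    and W: "W \<subseteq> {..<D * m}" "16 * card W \<le> D * m"
  shows "measure_pmf.prob (rand_perm (D * m))
      {\<pi>. D * card U < 2 * card (row_edges D m \<pi> U \<inter> W)}
    \<le> real (D * m + 1) * (1 / 4) ^ m"
proof -
  have D0: "0 < D" using e by simp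
  have um: "card U \<le> m" using card_mono[OF _ U(1)] by simp
  have "measure_pmf.prob (rand_perm (D * m))
      {\<pi>. D * card U < 2 * card (row_edges D m \<pi> U \<inter> W)}
    = measure_pmf.prob (pmf_of_set {X. X \<subseteq> {..<D * m} \<and> card X = D * card U})
      {X. D * card U < 2 * card (X \<inter> W)}"
    unfolding map_pmf_row_edges[OF D0 U(1), symmetric] by (simp add: vimage_def)
  also have "\<dots> \<le> real (D * m + 1) * exp (- (real (D * card U) / 2))"
    using um e D0 W by (intro prob_subset_concentrated) auto
  also have "exp (- (real (D * card U) / 2)) \<le> exp (real m * - 2)"
  proof -
    have "16 * real m \<le> (real g * p\<^sup>2) * real m" using g by (intro mult_right_mono) auto
    also have "\<dots> = 4 * (real D * (p\<^sup>2 * m / (4 * real e)))" using e by simp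
    also have "\<dots> \<le> 4 * (real D * card U)" using U by (intro mult_left_mono) auto
    finally show ?thesis by simp
  qed
  also have "exp (real m * - 2) = exp (- 2) ^ m" by (rule exp_of_nat_mult)
  also have "exp (- 2) ^ m \<le> (1 / 4 :: real) ^ m" using exp_neg_two_le by (intro power_mono) auto
  finally show ?thesis by (simp add: mult_left_mono)
qed

text \<open>The choice \<open>\<kappa> = p^2 / 8\<close> turns \<open>2 * \<kappa> * m / e\<close>
  into the border \<open>p^2 * m / (4 * e)\<close> and \<open>\<kappa> / 16\<close> into
  \<open>p^2 / 128\<close>. The \<open>m * (g div 16)\<close> exposed columns gain
  \<open>(1 / 4) ^ m\<close> against the rank loss \<open>2 ^ m\<close>.\<close>

lemma prob_bad_prefix_le:
  fixes p :: real
  assumes p: "0 < p" "p < 1 / 2" and e: "0 < e" "D = g * e" "0 < g" "0 < m"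
    and g: "(1 - p\<^sup>2 / 128) ^ (g div 16) \<le> 1 / 4" and big: "64 * real e ^ 2 \<le> p\<^sup>2 * m"
    and zs: "distinct zs" "set zs \<subseteq> {..<D * m}" "length zs = m * (g div 16) * e"
  shows "measure_pmf.prob (rand_perm (D * m))
      {\<pi>. bad_prefix (p\<^sup>2 * m / (4 * real e)) e D m (m * (g div 16)) (map \<pi> zs)}
    \<le> (1 / 2) ^ m"
proof -
  let ?L = "dlists {..<D * m} (m * (g div 16) * e)"
  let ?b = "bad_prefix (p\<^sup>2 * m / (4 * real e)) e D m (m * (g div 16))"
  have "zs \<in> ?L" using zs by (simp add: dlists_def)
  then have ne: "?L \<noteq> {}" by blast
  have fin: "finite ?L" by simp
  have c0: "0 < card ?L" using ne fin by (simp add: card_gt_0_iff)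
  have p2: "p\<^sup>2 \<le> 1 / 4"
    using power_mono[of p "1 / 2" 2] p by (simp add: power2_eq_square)
  have "measure_pmf.prob (rand_perm (D * m)) {\<pi>. ?b (map \<pi> zs)}
     = measure_pmf.prob (pmf_of_set ?L) {xs. ?b xs}"
    unfolding zs(3)[symmetric] map_pmf_permutation_list[OF finite_lessThan zs(1,2), symmetric]
    by (simp add: vimage_def)
  also have "\<dots> = card {xs\<in>?L. ?b xs} / card ?L"
    using ne fin by (simp add: measure_pmf_of_set Int_def)
  also have "\<dots> \<le> 2 ^ m * (1 - p\<^sup>2 / 8 / 16) ^ (m * (g div 16))"
  proof -
    have "real (card {xs\<in>?L. ?b xs}) \<le> 2 ^ m * (1 - p\<^sup>2 / 8 / 16) ^ (m * (g div 16)) * real (card ?L)"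
    proof (rule card_bad_prefix_le)
      have "2 * (g div 16) \<le> g" by simp
      then have "m * e * (2 * (g div 16)) \<le> m * e * g" by (rule mult_le_mono2)
      then show "2 * (m * (g div 16) * e) \<le> D * m" using e by (simp add: mult_ac)
    qed (use p p2 e big in auto)
    then show ?thesis using c0 by (simp add: pos_divide_le_eq)
  qed
  also have "(1 - p\<^sup>2 / 8 / 16) ^ (m * (g div 16)) = ((1 - p\<^sup>2 / 128) ^ (g div 16)) ^ m"
    by (simp add: power_mult[symmetric] mult.commute)
  also have "\<dots> \<le> (1 / 4) ^ m" using g p2 by (intro power_mono) auto
  also have "2 ^ m * (1 / 4 :: real) ^ m = (1 / 2) ^ m" by (simp flip: power_mult_distrib)
  finally show ?thesis by simp
qed

definition slots :: "nat \<Rightarrow> nat list \<Rightarrow> nat list" where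
  "slots e js = concat (map (\<lambda>c. [c * e..<c * e + e]) js)"

lemma slots_props:
  assumes "distinct js"
  shows "length (slots e js) = length js * e" "distinct (slots e js)"
    "set (slots e js) = (\<Union>c\<in>set js. {c * e..<c * e + e})"
    "j < length js \<Longrightarrow> set (take e (drop (j * e) (slots e js))) = {js ! j * e..<js ! j * e + e}"
proof -
  show "length (slots e js) = length js * e"
    unfolding slots_def by (induction js) auto
  show s: "set (slots e js) = (\<Union>c\<in>set js. {c * e..<c * e + e})" for js
    unfolding slots_def by auto
  show "distinct (slots e js)"
    using assms
  proof (induction js)
    case (Cons c js)
    have "{c * e..<c * e + e} \<inter> {c' * e..<c' * e + e} = {}" if "c' \<in> set js" for c'
    proof -
      have "c \<noteq> c'" using Cons.prems that by auto
      then show ?thesis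
        using disjoint_family_onD[OF blocks_partition(1)[of e "Suc (max c c')"], of c c'] by simp
    qed
    then have "{c * e..<c * e + e} \<inter> set (slots e js) = {}" unfolding s by blast
    then show ?case using Cons by (simp add: slots_def)
  qed (simp add: slots_def)
  assume "j < length js"
  then show "set (take e (drop (j * e) (slots e js))) = {js ! j * e..<js ! j * e + e}"
    unfolding slots_def by (subst take_drop_concat) auto
qed

lemma kernel_bad_prefix:
  assumes x: "kernel_vec e D \<pi> J x" and js: "distinct js" "set js \<subseteq> J"
    and pg: "pool_good u D m (\<pi> ` set (slots e js))" and sp: "spread_vec u m x"
  shows "bad_prefix u e D m (length js) (map \<pi> (slots e js))"
proof -
  have "(\<Sum>i\<in>s. x i) = 0" if s: "s \<in> block_cols e D (map \<pi> (slots e js)) (length js)" for s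
  proof -
    obtain j where j: "j < length js"
      "s = (\<lambda>h. h div D) ` set (take e (drop (j * e) (map \<pi> (slots e js))))"
      using s by (auto simp: block_cols_def)
    have "set (take e (drop (j * e) (map \<pi> (slots e js)))) = \<pi> ` {js ! j * e..<js ! j * e + e}"
      using slots_props(4)[OF js(1) j(1), of e] by (simp add: drop_map take_map)
    then have "s = neighbours e D \<pi> (js ! j)" unfolding j(2) neighbours_def by (simp add: image_image)
    moreover have "js ! j \<in> J" using js j by auto
    ultimately show ?thesis using x by (simp add: kernel_vec_def)
  qed
  then show ?thesis using pg sp unfolding bad_prefix_def by auto
qed

text \<open>The summands account for vectors of small support, for near-constant vectors and
  depleted pools together (the factor 2), and for spread vectors.\<close>

definition kernel_bound :: "real \<Rightarrow> nat \<Rightarrow> nat \<Rightarrow> real" where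
  "kernel_bound p D m = real (D * m + 1) * ((real m + 1) * exp (- (exp 3 * p ^ D * m)) + 2 * (1 / 2) ^ m) + (1 / 2) ^ m"

text \<open>
  A kernel vector with large support either is zero or constant outside a small set, which
  forces every surviving column to avoid a hit pattern that occurs often, or has no dominant
  value, which the sequential exposure excludes.
\<close>
lemma prob_large_kernel_vec_le:
  fixes p :: real
  assumes p: "0 < p" "p < 1 / 2" and e: "0 < e" "D = g * e" "2 \<le> D" "0 < m"
    and D: "4 * exp 2 * real D ^ 2 * (exp (1 / 4) / 2) ^ D \<le> 1"
    and g: "16 \<le> real g * p\<^sup>2" "(1 - p\<^sup>2 / 128) ^ (g div 16) \<le> 1 / 4"
    and big: "64 * real e ^ 2 \<le> p\<^sup>2 * m"
    and J: "J \<subseteq> {..<g * m}" "real (card J) = (1 - p) * real (g * m)"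
  shows "measure_pmf.prob (rand_perm (D * m))
      {\<pi>. \<exists>x. kernel_vec e D \<pi> J x \<and> exp 3 * p ^ D * m < card {i. i < m \<and> x i \<noteq> 0}}
    \<le> kernel_bound p D m"
proof -
  let ?P = "rand_perm (D * m)"
  let ?B = "\<lambda>c. {c * e..<c * e + e}"
  define u where "u = p\<^sup>2 * m / (4 * real e)"
  define \<tau> where "\<tau> = exp 3 * p ^ D * m"
  let ?E = "{\<pi>. \<exists>x. kernel_vec e D \<pi> J x \<and> \<tau> < card {i. i < m \<and> x i \<noteq> 0}}"
  \<comment> \<open>Few enough columns to be found among the survivors and to use at most a
    sixteenth of all half-edges, as \<open>prob_pool_depleted_le\<close> demands.\<close>
  define R where "R = m * (g div 16)"
  have g0: "0 < g" using g(1) by (cases g) auto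
  have eD: "e \<le> D" using e g0 by simp
  have NE: "g * m * e = D * m" using e by simp
  have finJ: "finite J" using J finite_subset by blast
  have RJ: "R \<le> card J"
  proof -
    have "(1 / 2) * real (g * m) \<le> (1 - p) * real (g * m)" using p by (intro mult_right_mono) auto
    then have "real (g * m) \<le> real (2 * card J)" using J(2) by simp
    then have "g * m \<le> 2 * card J" by linarith
    moreover have "2 * R \<le> g * m"
    proof -
      have "2 * (g div 16) \<le> g" by simp
      then have "m * (2 * (g div 16)) \<le> m * g" by (rule mult_le_mono2)
      then show ?thesis by (simp only: R_def mult_ac)
    qed
    ultimately show ?thesis by linarith
  qed
  define js where "js = take R (sorted_list_of_set J)"
  have js: "distinct js" "set js \<subseteq> J" "length js = R"
    using finJ RJ set_take_subset[of R "sorted_list_of_set J"] by (auto simp: js_def)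
  define zs where "zs = slots e js"
  have blk: "c * e + e \<le> D * m" if "c \<in> J" for c
  proof -
    have "Suc c * e \<le> g * m * e" using that J by (intro mult_le_mono1) auto
    then show ?thesis unfolding NE by simp
  qed
  have zs: "distinct zs" "set zs \<subseteq> {..<D * m}" "length zs = R * e"
    using slots_props(1-3)[OF js(1), of e] js blk by (fastforce simp: zs_def)+
  define EA where "EA T = {\<pi>. \<forall>c\<in>J. card (row_edges D m \<pi> T \<inter> ?B c) \<noteq> 1}" for T
  define EB where "EB U = {\<pi>. \<forall>c\<in>J. row_edges D m \<pi> U \<inter> ?B c \<noteq> {}}" for U
  define EC where "EC U = {\<pi>. D * card U < 2 * card (row_edges D m \<pi> U \<inter> set zs)}" for U
  define ED where "ED = {\<pi>. bad_prefix u e D m R (map \<pi> zs)}"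
  define IA where "IA = {T\<in>Pow {..<m}. \<tau> < card T \<and> card T < u}"
  define IB where "IB = {U\<in>Pow {..<m}. card U < u}"
  define IC where "IC = {U\<in>Pow {..<m}. u \<le> card U}"
  have fin: "finite IA" "finite IB" "finite IC" by (auto simp: IA_def IB_def IC_def)
  have setP: "set_pmf ?P = {\<pi>. \<pi> permutes {..<D * m}}"
    by (rule set_pmf_permutations) simp
  have cover: "?E \<inter> set_pmf ?P
    \<subseteq> (\<Union>T\<in>IA. EA T) \<union> (\<Union>U\<in>IB. EB U) \<union> (\<Union>U\<in>IC. EC U) \<union> ED"
  proof
    fix \<pi> assume "\<pi> \<in> ?E \<inter> set_pmf ?P"
    then obtain x where x: "kernel_vec e D \<pi> J x" "\<tau> < card {i. i < m \<and> x i \<noteq> 0}"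
      and \<pi>: "\<pi> permutes {..<D * m}" unfolding setP by blast
    show "\<pi> \<in> (\<Union>T\<in>IA. EA T) \<union> (\<Union>U\<in>IB. EB U) \<union> (\<Union>U\<in>IC. EC U) \<union> ED"
    proof (cases "spread_vec u m x")
      case False
      then obtain a where a: "card {i. i < m \<and> x i \<noteq> a} < u" unfolding spread_vec_def by (auto simp: not_le)
      show ?thesis
      proof (cases "a = 0")
        case True
        then have "{i. i < m \<and> x i \<noteq> 0} \<in> IA" using a x(2) by (auto simp: IA_def)
        moreover have "\<pi> \<in> EA {i. i < m \<and> x i \<noteq> 0}"
          using kernel_no_single_hit[OF x(1) _ blk \<pi>] by (simp add: EA_def)
        ultimately show ?thesis by blast
      next
        case False
        have "{i. i < m \<and> x i \<noteq> a} \<in> IB" using a by (auto simp: IB_def)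
        moreover have "\<pi> \<in> EB {i. i < m \<and> x i \<noteq> a}"
          using kernel_all_hit[OF x(1) _ blk \<pi> False e(1)] by (simp add: EB_def)
        ultimately show ?thesis by blast
      qed
    next
      case True
      show ?thesis
      proof (cases "pool_good u D m (\<pi> ` set zs)")
        case True
        have "bad_prefix u e D m (length js) (map \<pi> (slots e js))"
          using kernel_bad_prefix[OF x(1) js(1,2)] True \<open>spread_vec u m x\<close> by (simp add: zs_def)
        then have "\<pi> \<in> ED" by (simp add: ED_def zs_def js)
        then show ?thesis by blast
      next
        \<comment> \<open>The exposed columns have consumed more than half of the half-edges of some
          large row set, which concentration excludes.\<close>
        case False
        then obtain U where U: "U \<subseteq> {..<m}" "u \<le> real (card U)"
          "D * card U < 2 * card {h\<in>\<pi> ` set zs. h div D \<in> U}"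
          unfolding pool_good_def by (auto simp: not_le)
        have "{h\<in>\<pi> ` set zs. h div D \<in> U} = \<pi> ` (row_edges D m \<pi> U \<inter> set zs)"
          using zs(2) by (auto simp: row_edges_def)
        also have "card \<dots> = card (row_edges D m \<pi> U \<inter> set zs)"
          using permutes_inj_on[OF \<pi>] by (rule card_image)
        finally have "\<pi> \<in> EC U" using U(3) by (simp add: EC_def)
        moreover have "U \<in> IC" using U by (simp add: IC_def)
        ultimately show ?thesis by blast
      qed
    qed
  qed
  let ?N = "real (D * m + 1)"
  have A: "measure_pmf.prob ?P (\<Union>T\<in>IA. EA T) \<le> ?N * ((real m + 1) * exp (- \<tau>))"
  proof -
    have "measure_pmf.prob ?P (\<Union>T\<in>IA. EA T) \<le> (\<Sum>T\<in>IA. measure_pmf.prob ?P (EA T))"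
      by (rule measure_pmf.finite_measure_subadditive_finite) (use fin in auto)
    also have "\<dots> \<le> (\<Sum>T\<in>IA. ?N * exp (- \<tau>) * (1 / real (m choose card T)))"
      unfolding EA_def \<tau>_def
    proof (rule sum_mono)
      fix T assume "T \<in> IA"
      then show "measure_pmf.prob ?P {\<pi>. \<forall>c\<in>J. card (row_edges D m \<pi> T \<inter> ?B c) \<noteq> 1}
        \<le> ?N * exp (- (exp 3 * p ^ D * m)) * (1 / real (m choose card T))"
        by (intro prob_kernel_small_le[OF p e(1) eD e(3,2) D J]) (auto simp: IA_def \<tau>_def u_def)
    qed
    also have "\<dots> = ?N * exp (- \<tau>) * (\<Sum>T\<in>IA. 1 / real (m choose card T))"
      by (rule sum_distrib_left[symmetric])
    also have "\<dots> \<le> ?N * exp (- \<tau>) * (\<Sum>T\<in>Pow {..<m}. 1 / real (m choose card T))"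
      by (intro mult_left_mono sum_mono2) (auto simp: IA_def)
    finally show ?thesis unfolding sum_Pow_inverse_binomial by (simp add: mult_ac)
  qed
  have pw: "(2::real) ^ m * (1 / 4) ^ m = (1 / 2) ^ m" by (simp flip: power_mult_distrib)
  have cardI: "real (card I) \<le> 2 ^ m" if "I \<subseteq> Pow {..<m}" for I
    using card_mono[OF _ that] by (simp add: card_Pow)
  have union: "measure_pmf.prob ?P (\<Union>U\<in>I. E U) \<le> ?N * (1 / 2) ^ m"
    if I: "I \<subseteq> Pow {..<m}" and E: "\<And>U. U \<in> I \<Longrightarrow> measure_pmf.prob ?P (E U) \<le> ?N * (1 / 4) ^ m" for I E
  proof -
    have "finite I" using I finite_subset by blast
    then have "measure_pmf.prob ?P (\<Union>U\<in>I. E U) \<le> (\<Sum>U\<in>I. measure_pmf.prob ?P (E U))"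
      by (intro measure_pmf.finite_measure_subadditive_finite) auto
    also have "\<dots> \<le> (\<Sum>U\<in>I. ?N * (1 / 4) ^ m)" by (rule sum_mono[OF E])
    also have "\<dots> = card I * (?N * (1 / 4) ^ m)" by simp
    also have "\<dots> \<le> 2 ^ m * (?N * (1 / 4) ^ m)" using cardI[OF I] by (intro mult_right_mono) auto
    also have "\<dots> = ?N * (2 ^ m * (1 / 4) ^ m)" by (simp only: mult_ac)
    finally show ?thesis unfolding pw .
  qed
  have B: "measure_pmf.prob ?P (\<Union>U\<in>IB. EB U) \<le> ?N * (1 / 2) ^ m"
    by (rule union) (unfold EB_def, use prob_kernel_constant_le[OF p e(1,2) g0 e(4) J] in \<open>auto simp: IB_def u_def\<close>)
  have C: "measure_pmf.prob ?P (\<Union>U\<in>IC. EC U) \<le> ?N * (1 / 2) ^ m"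
  proof (rule union)
    fix U assume U: "U \<in> IC"
    have "16 * (g div 16) \<le> g" by simp
    then have "m * e * (16 * (g div 16)) \<le> m * e * g" by (rule mult_le_mono2)
    then have "16 * card (set zs) \<le> D * m"
      using zs distinct_card[of zs] e by (simp add: R_def mult_ac)
    then show "measure_pmf.prob ?P (EC U) \<le> ?N * (1 / 4) ^ m"
      unfolding EC_def using U zs(2) by (intro prob_pool_depleted_le[OF e(1,2) g0 e(4) g(1)]) (auto simp: IC_def u_def)
  qed (auto simp: IC_def)
  have D': "measure_pmf.prob ?P ED \<le> (1 / 2) ^ m"
    unfolding ED_def u_def R_def
    by (rule prob_bad_prefix_le[OF p e(1,2) g0 e(4) g(2) big]) (use zs in \<open>auto simp: R_def\<close>)
  have "measure_pmf.prob ?P ?E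
    = measure_pmf.prob ?P (?E \<inter> set_pmf ?P)"
    by (rule measure_Int_set_pmf[symmetric])
  also have "\<dots> \<le> measure_pmf.prob ?P ((\<Union>T\<in>IA. EA T) \<union> (\<Union>U\<in>IB. EB U) \<union> (\<Union>U\<in>IC. EC U) \<union> ED)"
    using cover by (intro measure_pmf.finite_measure_mono) auto
  also have "\<dots> \<le> measure_pmf.prob ?P (\<Union>T\<in>IA. EA T) + measure_pmf.prob ?P (\<Union>U\<in>IB. EB U)
      + measure_pmf.prob ?P (\<Union>U\<in>IC. EC U) + measure_pmf.prob ?P ED"
    by (intro order_trans[OF measure_Un_le] add_mono order_refl) auto
  also have "\<dots> \<le> ?N * ((real m + 1) * exp (- \<tau>)) + ?N * (1 / 2) ^ m + ?N * (1 / 2) ^ m + (1 / 2) ^ m"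
    by (intro add_mono A B C D')
  also have "\<dots> = kernel_bound p D m" by (simp add: kernel_bound_def \<tau>_def algebra_simps)
  finally show ?thesis unfolding \<tau>_def .
qed

section \<open>Decoding error and least squares\<close>

text \<open>The normal equations, solved by a Gram-Schmidt step: the new column \<open>v b\<close>
  is replaced by its residual \<open>s\<close> over the old columns, and the old residual
  \<open>r\<close> is projected onto \<open>s\<close>.\<close>

lemma least_squares_residual:
  fixes v :: "'c \<Rightarrow> nat \<Rightarrow> real"
  assumes "finite J"
  shows "\<exists>w. \<forall>c\<in>J. (\<Sum>i<m. (y i - (\<Sum>c'\<in>J. w c' * v c' i)) * v c i) = 0"
  using assms
proof (induction J arbitrary: y rule: finite_induct)
  case (insert b J)
  obtain w where w: "\<And>c. c \<in> J \<Longrightarrow> (\<Sum>i<m. (y i - (\<Sum>c'\<in>J. w c' * v c' i)) * v c i) = 0"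
    using insert.IH[of y] by blast
  obtain z where z: "\<And>c. c \<in> J \<Longrightarrow> (\<Sum>i<m. (v b i - (\<Sum>c'\<in>J. z c' * v c' i)) * v c i) = 0"
    using insert.IH[of "v b"] by blast
  define r where "r i = y i - (\<Sum>c'\<in>J. w c' * v c' i)" for i
  define s where "s i = v b i - (\<Sum>c'\<in>J. z c' * v c' i)" for i
  \<comment> \<open>If \<open>s\<close> vanishes on all rows, division by 0 gives
    \<open>l = 0\<close>, which is correct: column \<open>b\<close> then lies in the span of the
    others.\<close>
  define l where "l = (\<Sum>i<m. r i * s i) / (\<Sum>i<m. s i * s i)"
  define w' where "w' c = (if c = b then l else w c - l * z c)" for c
  have res: "y i - (\<Sum>c'\<in>insert b J. w' c' * v c' i) = r i - l * s i" for i
  proof -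
    have "(\<Sum>c'\<in>J. w' c' * v c' i) = (\<Sum>c'\<in>J. w c' * v c' i - l * (z c' * v c' i))"
      using insert.hyps by (intro sum.cong) (auto simp: w'_def algebra_simps)
    then show ?thesis
      using insert.hyps by (simp add: r_def s_def w'_def sum_subtractf sum_distrib_left algebra_simps)
  qed
  have J: "(\<Sum>i<m. (r i - l * s i) * v c i) = 0" if "c \<in> J" for c
  proof -
    have "(\<Sum>i<m. (r i - l * s i) * v c i) = (\<Sum>i<m. r i * v c i) - l * (\<Sum>i<m. s i * v c i)"
      by (simp add: sum_subtractf sum_distrib_left algebra_simps)
    then show ?thesis using w[OF that] z[OF that] by (simp add: r_def s_def)
  qed
  have s: "(\<Sum>i<m. (r i - l * s i) * s i) = 0"
  proof -
    have e: "(\<Sum>i<m. (r i - l * s i) * s i) = (\<Sum>i<m. r i * s i) - l * (\<Sum>i<m. s i * s i)"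
      by (simp add: sum_subtractf sum_distrib_left algebra_simps)
    show ?thesis
    proof (cases "(\<Sum>i<m. s i * s i) = 0")
      case True
      then have "\<forall>i\<in>{..<m}. s i * s i = 0" by (subst (asm) sum_nonneg_eq_0_iff) auto
      then have "(\<Sum>i<m. r i * s i) = 0" by (intro sum.neutral) auto
      then show ?thesis using True e by simp
    next
      case False
      then show ?thesis using e by (simp add: l_def)
    qed
  qed
  have b: "(\<Sum>i<m. (r i - l * s i) * v b i) = 0"
  proof -
    have "(\<Sum>i<m. (r i - l * s i) * v b i)
        = (\<Sum>i<m. (r i - l * s i) * s i + (r i - l * s i) * (\<Sum>c'\<in>J. z c' * v c' i))"
      by (intro sum.cong) (auto simp: s_def algebra_simps)
    also have "\<dots> = (\<Sum>i<m. (r i - l * s i) * (\<Sum>c'\<in>J. z c' * v c' i))"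
      using s by (simp add: sum.distrib)
    also have "\<dots> = (\<Sum>c'\<in>J. z c' * (\<Sum>i<m. (r i - l * s i) * v c' i))"
      unfolding sum_distrib_left by (subst sum.swap) (simp add: mult_ac)
    also have "\<dots> = 0" using J by simp
    finally show ?thesis .
  qed
  show ?case using J b unfolding res[symmetric] by blast
qed simp

text \<open>
  The residual of the least squares solution lies in the left kernel and satisfies
  \<open>|r|\<^sup>2 = \<Sum> r\<close>, so by Cauchy-Schwarz its square norm is at most the size of its support.
\<close>
lemma least_squares_le_support:
  fixes nb :: "'c \<Rightarrow> nat set" and \<tau> :: real
  assumes J: "finite J" "\<And>c. c \<in> J \<Longrightarrow> nb c \<subseteq> {..<m}"
    and ker: "\<And>x. (\<forall>c\<in>J. (\<Sum>i\<in>nb c. x i) = 0) \<Longrightarrow> real (card {i. i < m \<and> x i \<noteq> (0::real)}) \<le> \<tau>"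
  shows "\<exists>w. (\<Sum>i<m. ((\<Sum>c\<in>J. of_bool (i \<in> nb c) * w c) - 1)\<^sup>2) \<le> \<tau>"
proof -
  define v :: "'c \<Rightarrow> nat \<Rightarrow> real" where "v c i = of_bool (i \<in> nb c)" for c i
  obtain w where w: "\<And>c. c \<in> J \<Longrightarrow> (\<Sum>i<m. (1 - (\<Sum>c'\<in>J. w c' * v c' i)) * v c i) = 0"
    using least_squares_residual[OF J(1), where m = m and y = "\<lambda>_. 1" and v = v] by blast
  define r where "r i = 1 - (\<Sum>c\<in>J. w c * v c i)" for i
  have "(\<Sum>i\<in>nb c. r i) = 0" if "c \<in> J" for c
  proof -
    have "(\<Sum>i\<in>nb c. r i) = (\<Sum>i<m. r i * v c i)"
      using J(2)[OF that] by (simp add: v_def of_bool_def if_distrib sum.If_cases Int_absorb1 cong: if_cong)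
    then show ?thesis using w[OF that] by (simp add: r_def)
  qed
  then have supp: "real (card {i. i < m \<and> r i \<noteq> 0}) \<le> \<tau>" using ker by blast
  define A where "A = (\<Sum>i<m. (r i)\<^sup>2)"
  have A0: "0 \<le> A" by (simp add: A_def sum_nonneg)
  have "(\<Sum>i<m. r i * (\<Sum>c\<in>J. w c * v c i)) = (\<Sum>c\<in>J. w c * (\<Sum>i<m. r i * v c i))"
    unfolding sum_distrib_left by (subst sum.swap) (simp add: mult_ac)
  also have "\<dots> = 0" using w by (simp add: r_def)
  finally have orth: "(\<Sum>i<m. r i * (\<Sum>c\<in>J. w c * v c i)) = 0" .
  have "A = (\<Sum>i<m. r i - r i * (\<Sum>c\<in>J. w c * v c i))"
    unfolding A_def by (intro sum.cong) (simp_all add: r_def power2_eq_square algebra_simps)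
  then have A1: "A = (\<Sum>i<m. r i)" using orth by (simp add: sum_subtractf)
  also have "\<dots> = (\<Sum>i\<in>{i. i < m \<and> r i \<noteq> 0}. r i)"
    by (intro sum.mono_neutral_right) auto
  finally have A2: "A\<^sup>2 \<le> (\<Sum>i\<in>{i. i < m \<and> r i \<noteq> 0}. (r i)\<^sup>2) * card {i. i < m \<and> r i \<noteq> 0}"
    using sum_squared_le_sum_of_squares[of "\<lambda>i. r i" "{i. i < m \<and> r i \<noteq> 0}"] by simp
  have "(\<Sum>i\<in>{i. i < m \<and> r i \<noteq> 0}. (r i)\<^sup>2) \<le> A"
    unfolding A_def by (intro sum_mono2) auto
  then have "A\<^sup>2 \<le> A * \<tau>" 
    using order_trans[OF A2 mult_mono[OF _ supp]] A0 by simp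
  then have "A \<le> \<tau>" 
  proof (cases "A = 0")
    case True
    then show ?thesis using supp of_nat_0_le_iff order_trans by blast
  next
    case False
    then show ?thesis using \<open>A\<^sup>2 \<le> A * \<tau>\<close> A0 by (simp add: power2_eq_square)
  qed
  moreover have "A = (\<Sum>i<m. ((\<Sum>c\<in>J. of_bool (i \<in> nb c) * w c) - 1)\<^sup>2)"
    unfolding A_def r_def v_def by (intro sum.cong refl) (simp add: mult.commute power2_commute)
  ultimately have "(\<Sum>i<m. ((\<Sum>c\<in>J. of_bool (i \<in> nb c) * w c) - 1)\<^sup>2) \<le> \<tau>" by simp
  then show ?thesis by (rule exI[of _ w])
qed

section \<open>The stacked matrix of a permutation\<close>

definition stacked :: "nat \<Rightarrow> nat \<Rightarrow> nat \<Rightarrow> (nat \<Rightarrow> nat) \<Rightarrow> real mat" where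
  "stacked g m e \<pi> = vstack g (transpose_mat (biadjacency m g e \<pi>))"

lemma stacked_dims [simp]: "dim_row (stacked g m e \<pi>) = g * m" "dim_col (stacked g m e \<pi>) = g * m"
  by (simp_all add: stacked_def vstack_def biadjacency_def)

lemma stacked_index:
  assumes "i < g * m" "c < g * m" "0 < e"
  shows "stacked g m e \<pi> $$ (i, c) = of_bool (i mod m \<in> neighbours e (g * e) \<pi> c)"
proof -
  have m: "0 < m" using assms by (cases m) auto
  have "Suc c * e \<le> g * m * e" using assms by (intro mult_le_mono1) simp
  then have sub: "c * e + e \<le> g * e * m" by (simp add: mult_ac)
  note hd = div_eq_iff_interval[OF assms(3), of _ c]
  have "(\<exists>h<g * e * m. h div e = c \<and> \<pi> h div (g * e) = i mod m) \<longleftrightarrow> i mod m \<in> neighbours e (g * e) \<pi> c"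
  proof
    assume "\<exists>h<g * e * m. h div e = c \<and> \<pi> h div (g * e) = i mod m"
    then obtain h where h: "h \<in> {c * e..<c * e + e}" "\<pi> h div (g * e) = i mod m" using hd by blast
    then show "i mod m \<in> neighbours e (g * e) \<pi> c"
      unfolding neighbours_def by (intro image_eqI[of _ _ h]) simp_all
  next
    assume "i mod m \<in> neighbours e (g * e) \<pi> c"
    then obtain h where h: "h \<in> {c * e..<c * e + e}" "i mod m = \<pi> h div (g * e)"
      unfolding neighbours_def by blast
    moreover have "h < g * e * m" using h sub by simp
    ultimately show "\<exists>h<g * e * m. h div e = c \<and> \<pi> h div (g * e) = i mod m" using hd by metis
  qed
  then show ?thesis using assms m
    by (simp add: stacked_def vstack_def biadjacency_def)
qed

lemma sum_mod_repeat:
  fixes f :: "nat \<Rightarrow> real"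
  shows "(\<Sum>i<g * m. f (i mod m)) = real g * (\<Sum>i<m. f i)"
proof -
  have "(\<Sum>i<g * m. f (i mod m)) = (\<Sum>j<g. \<Sum>i\<in>{j * m..<j * m + m}. f (i mod m))"
    by (rule sum.nat_group[symmetric])
  also have "\<dots> = (\<Sum>j<g. \<Sum>i<m. f i)"
  proof (rule sum.cong[OF refl])
    fix j
    show "(\<Sum>i\<in>{j * m..<j * m + m}. f (i mod m)) = (\<Sum>i<m. f i)"
    proof (rule sum.reindex_bij_witness[where i = "\<lambda>i. i + j * m" and j = "\<lambda>i. i - j * m"], goal_cases)
      case (5 i)
      then have "i = (i - j * m) + j * m" "i - j * m < m" by auto
      then have "i mod m = i - j * m" by (metis mod_less mod_mult_self1)
      then show ?case by simp
    qed auto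
  qed
  finally show ?thesis by simp
qed

text \<open>Any admissible weight vector bounds the infimum, and the \<open>g\<close> identical
  copies contribute equal sums of squares.\<close>

lemma err_stacked_le:
  fixes w :: "nat \<Rightarrow> real"
  assumes "0 < e" and w: "\<And>c. c \<in> S \<Longrightarrow> w c = 0"
  shows "err (stacked g m e \<pi>) S
    \<le> real g * (\<Sum>i<m. ((\<Sum>c<g * m. of_bool (i \<in> neighbours e (g * e) \<pi> c) * w c) - 1)\<^sup>2)"
proof -
  let ?B = "stacked g m e \<pi>"
  let ?W = "{w \<in> carrier_vec (dim_col ?B). \<forall>j<dim_col ?B. j \<in> S \<longrightarrow> vec_index w j = 0}"
  let ?f = "\<lambda>w. \<Sum>i<dim_row ?B. (vec_index (mult_mat_vec ?B w) i - 1)\<^sup>2"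
  let ?w = "vec (g * m) w"
  have "err ?B S \<le> ?f ?w"
    unfolding err_def
  proof (rule cINF_lower)
    show "bdd_below (?f ` ?W)" by (rule bdd_belowI2[of _ 0]) (simp add: sum_nonneg)
    show "?w \<in> ?W" using w by auto
  qed
  also have "?f ?w = (\<Sum>i<g * m. ((\<Sum>c<g * m. of_bool (i mod m \<in> neighbours e (g * e) \<pi> c) * w c) - 1)\<^sup>2)"
  proof (unfold stacked_dims, intro sum.cong refl)
    fix i assume i: "i \<in> {..<g * m}"
    have "vec_index (mult_mat_vec ?B ?w) i = (\<Sum>c<g * m. ?B $$ (i, c) * w c)"
      using i by (simp add: scalar_prod_def lessThan_atLeast0)
    also have "\<dots> = (\<Sum>c<g * m. of_bool (i mod m \<in> neighbours e (g * e) \<pi> c) * w c)"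
      using i assms(1) by (intro sum.cong) (auto simp: stacked_index)
    finally show "(vec_index (mult_mat_vec ?B ?w) i - 1)\<^sup>2
      = ((\<Sum>c<g * m. of_bool (i mod m \<in> neighbours e (g * e) \<pi> c) * w c) - 1)\<^sup>2" by simp
  qed
  also have "\<dots> = real g * (\<Sum>i<m. ((\<Sum>c<g * m. of_bool (i \<in> neighbours e (g * e) \<pi> c) * w c) - 1)\<^sup>2)"
    by (rule sum_mod_repeat)
  finally show ?thesis .
qed

lemma err_stacked_le_size:
  assumes "0 < e"
  shows "err (stacked g m e \<pi>) S \<le> real (g * m)"
  using err_stacked_le[OF assms, of S "\<lambda>_. 0" g m \<pi>] by simp

lemma err_stacked_le_kernel:
  fixes \<tau> :: real
  assumes e: "0 < e" and \<pi>: "\<pi> permutes {..<g * e * m}"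
    and ker: "\<And>x. kernel_vec e (g * e) \<pi> ({..<g * m} - S) x \<Longrightarrow> real (card {i. i < m \<and> x i \<noteq> 0}) \<le> \<tau>"
  shows "err (stacked g m e \<pi>) S \<le> real g * \<tau>"
proof -
  let ?J = "{..<g * m} - S"
  have "neighbours e (g * e) \<pi> c \<subseteq> {..<m}" if "c \<in> ?J" for c
  proof (rule neighbours_subset[OF \<pi>])
    have "Suc c * e \<le> g * m * e" using that by (intro mult_le_mono1) auto
    then show "c * e + e \<le> g * e * m" by (simp add: mult_ac)
  qed
  then obtain w where w: "(\<Sum>i<m. ((\<Sum>c\<in>?J. of_bool (i \<in> neighbours e (g * e) \<pi> c) * w c) - 1)\<^sup>2) \<le> \<tau>"
    using least_squares_le_support[of ?J "neighbours e (g * e) \<pi>" m \<tau>] ker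
    unfolding kernel_vec_def by blast
  define w' where "w' c = (if c \<in> S then 0 else w c)" for c
  have "(\<Sum>c<g * m. of_bool (i \<in> neighbours e (g * e) \<pi> c) * w' c)
      = (\<Sum>c\<in>?J. of_bool (i \<in> neighbours e (g * e) \<pi> c) * w c)" for i
    by (rule sum.mono_neutral_cong_right) (auto simp: w'_def)
  then have "err (stacked g m e \<pi>) S \<le> real g *
     (\<Sum>i<m. ((\<Sum>c\<in>?J. of_bool (i \<in> neighbours e (g * e) \<pi> c) * w c) - 1)\<^sup>2)"
    using err_stacked_le[OF e, of S w' g m \<pi>] by (simp add: w'_def)
  also have "\<dots> \<le> real g * \<tau>" using w by (rule mult_left_mono) simp
  finally show ?thesis .
qed

section \<open>Worst-case error\<close>

text \<open>Hoeffding's bound for both signs of \<open>\<theta>\<close>: the negative case follows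
  by exchanging the two outcomes, which replaces \<open>p\<close> by \<open>1 - p\<close>.\<close>

lemma bernoulli_mgf_le:
  fixes p \<theta> :: real
  assumes "0 \<le> p" "p \<le> 1"
  shows "p * exp \<theta> + (1 - p) \<le> exp (\<theta> * p + \<theta>\<^sup>2 / 8)"
proof -
  have pos: "q * exp h + (1 - q) \<le> exp (h * q + h\<^sup>2 / 8)" if "0 \<le> h" "0 \<le> q" for h q :: real
  proof -
    have "0 < 1 + q * (exp h - 1)" using that by (intro add_pos_nonneg mult_nonneg_nonneg) auto
    moreover have "ln (1 + q * (exp h - 1)) \<le> h * q + h\<^sup>2 / 8"
      using Hoeffdings_lemma_aux[OF that] by simp
    ultimately have "1 + q * (exp h - 1) \<le> exp (h * q + h\<^sup>2 / 8)" by (metis exp_le_cancel_iff exp_ln)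
    then show ?thesis by (simp add: algebra_simps)
  qed
  show ?thesis
  proof (cases "0 \<le> \<theta>")
    case True
    then show ?thesis using pos assms by blast
  next
    case False
    then have "(1 - p) * exp (- \<theta>) + p \<le> exp (- \<theta> * (1 - p) + \<theta>\<^sup>2 / 8)"
      using pos[of "- \<theta>" "1 - p"] assms by simp
    then have "exp \<theta> * ((1 - p) * exp (- \<theta>) + p) \<le> exp \<theta> * exp (- \<theta> * (1 - p) + \<theta>\<^sup>2 / 8)"
      by (rule mult_left_mono) simp
    moreover have "exp \<theta> * ((1 - p) * exp (- \<theta>) + p) = p * exp \<theta> + (1 - p)"
      by (simp add: algebra_simps exp_minus)
    moreover have "exp \<theta> * exp (- \<theta> * (1 - p) + \<theta>\<^sup>2 / 8) = exp (\<theta> * p + \<theta>\<^sup>2 / 8)"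
      by (simp add: algebra_simps flip: exp_add)
    ultimately show ?thesis by simp
  qed
qed

text \<open>
  \<open>exp (y\<^sup>2)\<close> is dominated by a discrete mixture of exponentials of linear functions of \<open>y\<close>:
  take the term where \<open>k\<close> is \<open>\<bar>y\<bar>\<close> rounded to the nearest integer.
\<close>
lemma exp_square_le_sum:
  fixes y :: real
  assumes "\<bar>y\<bar> \<le> real D"
  shows "exp (y\<^sup>2) \<le> exp (1 / 4) * (\<Sum>k\<le>D. exp (2 * real k * y - (real k)\<^sup>2) + exp (2 * real k * (- y) - (real k)\<^sup>2))"
proof -
  define k where "k = nat (round \<bar>y\<bar>)"
  have r0: "0 \<le> round \<bar>y\<bar>" using round_mono[of 0 "\<bar>y\<bar>"] by simp
  have k: "real k = real_of_int (round \<bar>y\<bar>)" unfolding k_def using r0 by simp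
  have "round \<bar>y\<bar> \<le> round (real D)" using assms by (rule round_mono)
  then have kD: "k \<le> D" unfolding k_def by simp
  have near: "(\<bar>y\<bar> - real k)\<^sup>2 \<le> 1 / 4"
  proof -
    have "\<bar>\<bar>y\<bar> - real k\<bar> \<le> 1 / 2" unfolding k using of_int_round_abs_le[of "\<bar>y\<bar>"] by (simp add: abs_minus_commute)
    then have "\<bar>\<bar>y\<bar> - real k\<bar>\<^sup>2 \<le> (1 / 2)\<^sup>2" by (intro power_mono) auto
    then show ?thesis by (simp add: power2_eq_square)
  qed
  have "y\<^sup>2 = \<bar>y\<bar>\<^sup>2" by simp
  also have "\<dots> \<le> 1 / 4 + (2 * real k * \<bar>y\<bar> - (real k)\<^sup>2)"
    using near by (simp add: power2_eq_square algebra_simps)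
  finally have "exp (y\<^sup>2) \<le> exp (1 / 4) * exp (2 * real k * \<bar>y\<bar> - (real k)\<^sup>2)"
    by (simp flip: exp_add)
  also have "exp (2 * real k * \<bar>y\<bar> - (real k)\<^sup>2)
      \<le> exp (2 * real k * y - (real k)\<^sup>2) + exp (2 * real k * (- y) - (real k)\<^sup>2)"
    by (cases "0 \<le> y") simp_all
  also have "\<dots> \<le> (\<Sum>k\<le>D. exp (2 * real k * y - (real k)\<^sup>2) + exp (2 * real k * (- y) - (real k)\<^sup>2))"
    using kD by (intro member_le_sum) (auto intro: add_nonneg_nonneg)
  finally show ?thesis by simp
qed

text \<open>By \<open>k \<le> k^2\<close> the sum is at most a geometric series with ratio
  \<open>exp (- 1 / 2) \<le> 2 / 3\<close>.\<close>

lemma sum_exp_neg_square_le: "(\<Sum>k\<le>D. exp (- (real k)\<^sup>2 / 2)) \<le> 3"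
proof -
  define r where "r = exp (- 1 / 2 :: real)"
  have r: "0 < r" "r \<le> 2 / 3"
  proof -
    have "3 / 2 \<le> exp (1 / 2 :: real)" using exp_ge_add_one_self[of "1 / 2"] by simp
    then show "r \<le> 2 / 3" by (simp add: r_def exp_minus field_simps)
  qed (simp add: r_def)
  have "(\<Sum>k\<le>D. exp (- (real k)\<^sup>2 / 2)) \<le> (\<Sum>k\<le>D. r ^ k)"
  proof (rule sum_mono)
    fix k
    have "real k \<le> (real k)\<^sup>2" by (cases k) (simp_all add: power2_eq_square)
    then have "exp (- (real k)\<^sup>2 / 2) \<le> exp (real k * (- 1 / 2))" by simp
    then show "exp (- (real k)\<^sup>2 / 2) \<le> r ^ k" by (simp only: exp_of_nat_mult r_def)
  qed
  also have "\<dots> = (1 - r ^ Suc D) / (1 - r)" using r sum_gp0[of r D] by simp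
  also have "\<dots> \<le> 1 / (1 - r)" using r by (intro divide_right_mono) auto
  also have "\<dots> \<le> 3" using r by (simp add: field_simps)
  finally show ?thesis .
qed

text \<open>The \<open>k\<close>-th term of the mixture has \<open>\<theta> = 2 * k / sqrt D\<close>
  up to sign, so Hoeffding's bound yields \<open>exp (k^2 / 2)\<close>, half of the
  \<open>k^2\<close> that is subtracted, whatever \<open>D\<close> is. The constant is
  \<open>2 * (3 + 3)\<close>: a 3 for each sign, and \<open>exp (1 / 4) \<le> 2\<close>.\<close>

lemma binomial_square_exp_moment:
  fixes p :: real
  assumes p: "0 \<le> p" "p \<le> 1" and B: "finite B" "card B = D" "0 < D"
  shows "(\<Sum>Y\<in>Pow B. exp ((real (card Y) - p * D)\<^sup>2 / D) * (p ^ card Y * (1 - p) ^ (card B - card Y))) \<le> 12"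
proof -
  let ?w = "\<lambda>Y. p ^ card Y * (1 - p) ^ (card B - card Y)"
  let ?y = "\<lambda>Y. (real (card Y) - p * D) / sqrt D"
  have w0: "0 \<le> ?w Y" for Y using p by simp
  have mgf: "(\<Sum>Y\<in>Pow B. exp (2 * real k * (s * ?y Y) - (real k)\<^sup>2) * ?w Y) \<le> exp (- (real k)\<^sup>2 / 2)"
    if "s = 1 \<or> s = - 1" for s :: real and k
  proof -
    define \<theta> where "\<theta> = 2 * real k * s / sqrt D"
    have s2: "s\<^sup>2 = 1" using that by auto
    have \<theta>: "real D * (\<theta>\<^sup>2 / 8) = (real k)\<^sup>2 / 2"
      using B s2 by (simp add: \<theta>_def power_divide power_mult_distrib)
    have e: "2 * real k * (s * ?y Y) - (real k)\<^sup>2 = (- \<theta> * p * D - (real k)\<^sup>2) + real (card Y) * \<theta>" for Y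
      by (simp add: \<theta>_def diff_divide_distrib algebra_simps)
    have "(\<Sum>Y\<in>Pow B. exp (2 * real k * (s * ?y Y) - (real k)\<^sup>2) * ?w Y)
      = (\<Sum>Y\<in>Pow B. exp (- \<theta> * p * D - (real k)\<^sup>2) * ((p * exp \<theta>) ^ card Y * (1 - p) ^ (card B - card Y)))"
      unfolding e exp_add exp_of_nat_mult by (simp add: power_mult_distrib mult_ac)
    also have "\<dots> = exp (- \<theta> * p * D - (real k)\<^sup>2) * (p * exp \<theta> + (1 - p)) ^ D"
      using sum_Pow_binomial[OF B(1), of "p * exp \<theta>" "1 - p"] B(2) by (simp flip: sum_distrib_left)
    also have "\<dots> \<le> exp (- \<theta> * p * D - (real k)\<^sup>2) * exp (\<theta> * p + \<theta>\<^sup>2 / 8) ^ D"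
      using bernoulli_mgf_le[OF p, of \<theta>] p by (intro mult_left_mono power_mono) auto
    also have "\<dots> = exp (- \<theta> * p * D - (real k)\<^sup>2 + real D * (\<theta> * p + \<theta>\<^sup>2 / 8))"
      by (simp only: exp_add exp_of_nat_mult)
    also have "- \<theta> * p * D - (real k)\<^sup>2 + real D * (\<theta> * p + \<theta>\<^sup>2 / 8) = - (real k)\<^sup>2 / 2"
      unfolding distrib_left \<theta> by simp
    finally show ?thesis .
  qed
  have "(\<Sum>Y\<in>Pow B. exp ((real (card Y) - p * D)\<^sup>2 / D) * ?w Y)
    \<le> (\<Sum>Y\<in>Pow B. exp (1 / 4) * (\<Sum>k\<le>D. exp (2 * real k * (1 * ?y Y) - (real k)\<^sup>2) * ?w Y
        + exp (2 * real k * (- 1 * ?y Y) - (real k)\<^sup>2) * ?w Y))"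
  proof (rule sum_mono)
    fix Y assume Y: "Y \<in> Pow B"
    have "\<bar>real (card Y) - p * D\<bar> \<le> real D"
    proof -
      have "real (card Y) \<le> D" using card_mono[of B Y] Y B by auto
      moreover have "0 \<le> p * D" "p * D \<le> D" using p by (simp_all add: mult_left_le_one_le)
      ultimately show ?thesis by linarith
    qed
    moreover have "1 \<le> sqrt D" using B by simp
    ultimately have yD: "\<bar>?y Y\<bar> \<le> real D"
      using frac_le[of "real D" "\<bar>real (card Y) - p * D\<bar>" 1 "sqrt D"] by (simp add: abs_divide)
    have "(real (card Y) - p * D)\<^sup>2 / D = (?y Y)\<^sup>2" by (simp add: power_divide)
    then have "exp ((real (card Y) - p * D)\<^sup>2 / D) * ?w Y
      \<le> exp (1 / 4) * (\<Sum>k\<le>D. exp (2 * real k * ?y Y - (real k)\<^sup>2) + exp (2 * real k * (- ?y Y) - (real k)\<^sup>2)) * ?w Y"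
      using exp_square_le_sum[OF yD] w0 by (intro mult_right_mono) simp_all
    then show "exp ((real (card Y) - p * D)\<^sup>2 / D) * ?w Y \<le> exp (1 / 4) * (\<Sum>k\<le>D. exp (2 * real k * (1 * ?y Y) - (real k)\<^sup>2) * ?w Y
        + exp (2 * real k * (- 1 * ?y Y) - (real k)\<^sup>2) * ?w Y)"
      unfolding mult.assoc sum_distrib_right distrib_right mult_1 mult_minus1 .
  qed
  also have "\<dots> = exp (1 / 4) * (\<Sum>k\<le>D. (\<Sum>Y\<in>Pow B. exp (2 * real k * (1 * ?y Y) - (real k)\<^sup>2) * ?w Y)
        + (\<Sum>Y\<in>Pow B. exp (2 * real k * (- 1 * ?y Y) - (real k)\<^sup>2) * ?w Y))"
    unfolding sum.distrib[symmetric] sum_distrib_left[symmetric] by (subst sum.swap) (rule refl)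
  also have "\<dots> \<le> exp (1 / 4) * (\<Sum>k\<le>D. exp (- (real k)\<^sup>2 / 2) + exp (- (real k)\<^sup>2 / 2))"
    by (intro mult_left_mono sum_mono add_mono mgf) auto
  also have "\<dots> \<le> exp (1 / 4) * (3 + 3)"
    unfolding sum.distrib by (intro mult_left_mono add_mono sum_exp_neg_square_le) auto
  also have "\<dots> \<le> 2 * (3 + 3)"
  proof -
    have "exp (1 / 4 :: real) \<le> 1 + 1 / 4 + (1 / 4)\<^sup>2" by (rule exp_bound) auto
    then show ?thesis by (simp add: power2_eq_square)
  qed
  finally show ?thesis by simp
qed

text \<open>Markov's inequality for the number of events that occur. It serves both the sets
  \<open>S\<close> with a large kernel vector and the rows with parallel edges.\<close>

lemma prob_count_ge_le:
  fixes M :: "'a pmf" and t :: real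
  assumes "finite I" "0 < t"
  shows "measure_pmf.prob M {\<omega>. t \<le> real (card {i\<in>I. \<omega> \<in> E i})} \<le> (\<Sum>i\<in>I. measure_pmf.prob M (E i)) / t"
proof -
  let ?A = "{\<omega>. t \<le> real (card {i\<in>I. \<omega> \<in> E i})}"
  have int: "integrable (measure_pmf M) (\<lambda>\<omega>. indicat_real X \<omega>)" for X
    by (intro measure_pmf.integrable_const_bound[where B = 1]) (auto simp: indicator_def)
  have "t * measure_pmf.prob M ?A = measure_pmf.expectation M (\<lambda>\<omega>. t * indicat_real ?A \<omega>)" by simp
  also have "\<dots> \<le> measure_pmf.expectation M (\<lambda>\<omega>. \<Sum>i\<in>I. indicat_real (E i) \<omega>)"
  proof (rule integral_mono)
    show "integrable (measure_pmf M) (\<lambda>\<omega>. t * indicat_real ?A \<omega>)"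
      using int by (rule integrable_mult_right)
    show "integrable (measure_pmf M) (\<lambda>\<omega>. \<Sum>i\<in>I. indicat_real (E i) \<omega>)"
      using int by (rule Bochner_Integration.integrable_sum)
    fix \<omega>
    have "(\<Sum>i\<in>I. indicat_real (E i) \<omega>) = card {i\<in>I. \<omega> \<in> E i}"
      using assms by (simp add: indicator_def of_bool_def sum.If_cases Int_def)
    then show "t * indicat_real ?A \<omega> \<le> (\<Sum>i\<in>I. indicat_real (E i) \<omega>)"
      by (cases "\<omega> \<in> ?A") (simp_all add: sum_nonneg)
  qed
  also have "\<dots> = (\<Sum>i\<in>I. measure_pmf.prob M (E i))"
    using int by (subst Bochner_Integration.integral_sum) simp_all
  finally show ?thesis using assms by (simp add: pos_le_divide_eq mult.commute)
qed

section \<open>Straggling half-edges and parallel edges\<close>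

definition straggler_edges :: "nat \<Rightarrow> nat \<Rightarrow> nat \<Rightarrow> (nat \<Rightarrow> nat) \<Rightarrow> nat set \<Rightarrow> nat \<Rightarrow> nat set" where
  "straggler_edges e D m \<pi> S i = {h\<in>{..<D * m}. h div e \<in> S \<and> \<pi> h div D = i}"

abbreviation row_deviation :: "nat \<Rightarrow> nat \<Rightarrow> nat \<Rightarrow> real \<Rightarrow> (nat \<Rightarrow> nat) \<Rightarrow> nat set \<Rightarrow> nat \<Rightarrow> real" where
  "row_deviation e D m p \<pi> S i \<equiv> (real (card (straggler_edges e D m \<pi> S i)) - p * real D)\<^sup>2 / real D"

text \<open>\<open>straggler_edges\<close> counts half-edges one by one, whereas the matrix merges
  parallel edges; on the rows singled out here the two counts agree.\<close>

definition simple_row :: "nat \<Rightarrow> nat \<Rightarrow> nat \<Rightarrow> (nat \<Rightarrow> nat) \<Rightarrow> nat \<Rightarrow> bool" where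
  "simple_row e D m \<pi> i \<longleftrightarrow> inj_on (\<lambda>h. h div e) {h\<in>{..<D * m}. \<pi> h div D = i}"

lemma card_row_edges_single:
  assumes \<pi>: "\<pi> permutes {..<D * m}" and "0 < D" "i < m"
  shows "card {h\<in>{..<D * m}. \<pi> h div D = i} = D"
proof -
  have "\<pi> ` {h\<in>{..<D * m}. \<pi> h div D = i} = {h. h div D \<in> {i}}"
  proof (rule equalityI; rule subsetI)
    fix h assume h: "h \<in> {h. h div D \<in> {i}}"
    then have "h < D * m" using assms div_less_iff_less_mult[of D h m] by (simp add: mult.commute)
    then obtain h' where "h' < D * m" "h = \<pi> h'"
      using permutes_image[OF \<pi>] by blast
    then show "h \<in> \<pi> ` {h\<in>{..<D * m}. \<pi> h div D = i}" using h by auto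
  qed auto
  then have "card (\<pi> ` {h\<in>{..<D * m}. \<pi> h div D = i}) = D"
    using card_div_vimage(1)[of "{i}" D] assms by simp
  then show ?thesis using card_image[OF permutes_inj_on[OF \<pi>]] by metis
qed

lemma row_weight:
  assumes \<pi>: "\<pi> permutes {..<D * m}" and D: "0 < e" "D = g * e" "0 < g" "i < m" and S: "S \<subseteq> {..<g * m}"
  shows "card {c\<in>{..<g * m} - S. i \<in> neighbours e D \<pi> c} \<le> D"
    and "simple_row e D m \<pi> i \<Longrightarrow>
      real (card {c\<in>{..<g * m} - S. i \<in> neighbours e D \<pi> c}) = real D - card (straggler_edges e D m \<pi> S i)"
proof -
  let ?H = "{h\<in>{..<D * m}. \<pi> h div D = i}"
  have NE: "g * m * e = D * m" using D by simp
  have cH: "card ?H = D" using card_row_edges_single[OF \<pi>] D by simp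
  have sub: "straggler_edges e D m \<pi> S i \<subseteq> ?H" by (auto simp: straggler_edges_def)
  have eq: "{c\<in>{..<g * m} - S. i \<in> neighbours e D \<pi> c} = (\<lambda>h. h div e) ` (?H - straggler_edges e D m \<pi> S i)"
  proof (rule equalityI; rule subsetI)
    fix c assume c: "c \<in> {c\<in>{..<g * m} - S. i \<in> neighbours e D \<pi> c}"
    then obtain h where h: "h \<in> {c * e..<c * e + e}" "\<pi> h div D = i" by (auto simp: neighbours_def)
    then have hc: "h div e = c" using div_eq_iff_interval D by simp
    then have "h < D * m" using c div_less_iff_less_mult[of e h "g * m"] D(1) NE by simp
    then show "c \<in> (\<lambda>h. h div e) ` (?H - straggler_edges e D m \<pi> S i)"
      using hc h c by (intro image_eqI[of _ _ h]) (auto simp: straggler_edges_def)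
  next
    fix c assume "c \<in> (\<lambda>h. h div e) ` (?H - straggler_edges e D m \<pi> S i)"
    then obtain h where h: "h < D * m" "\<pi> h div D = i" "h div e \<notin> S" "c = h div e"
      by (auto simp: straggler_edges_def)
    have "c < g * m" using h(1,4) div_less_iff_less_mult[of e h "g * m"] D(1) NE by simp
    moreover have "i \<in> neighbours e D \<pi> c"
      using h div_eq_iff_interval[of e h c] D by (auto simp: neighbours_def)
    ultimately show "c \<in> {c\<in>{..<g * m} - S. i \<in> neighbours e D \<pi> c}" using h by simp
  qed
  have cd: "card (?H - straggler_edges e D m \<pi> S i) = D - card (straggler_edges e D m \<pi> S i)"
    using card_Diff_subset[OF _ sub] cH finite_subset[OF sub] by simp
  have le: "card (straggler_edges e D m \<pi> S i) \<le> D" using card_mono[OF _ sub] cH by simp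
  show "card {c\<in>{..<g * m} - S. i \<in> neighbours e D \<pi> c} \<le> D"
    unfolding eq using card_image_le[of "?H - straggler_edges e D m \<pi> S i" "\<lambda>h. h div e"] cd by simp
  assume "simple_row e D m \<pi> i"
  then have "inj_on (\<lambda>h. h div e) (?H - straggler_edges e D m \<pi> S i)"
    unfolding simple_row_def by (rule inj_on_subset) blast
  then show "real (card {c\<in>{..<g * m} - S. i \<in> neighbours e D \<pi> c}) = real D - card (straggler_edges e D m \<pi> S i)"
    unfolding eq using card_image cd le by fastforce
qed

text \<open>Every survivor gets the weight \<open>1 / ((1 - p) * D)\<close>. A row without parallel
  edges then differs from 1 exactly by its scaled deviation; in any other row the value lies between
  0 and 2, by \<open>D \<le> 2 * (1 - p) * D\<close>, and costs at most 1.\<close>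

lemma err_stacked_le_deviation:
  fixes p :: real
  assumes p: "0 < p" "p < 1 / 2" and \<pi>: "\<pi> permutes {..<D * m}"
    and D: "0 < e" "D = g * e" "0 < g" and S: "S \<subseteq> {..<g * m}"
  shows "err (stacked g m e \<pi>) S \<le> real g *
    ((\<Sum>i<m. row_deviation e D m p \<pi> S i) / ((1 - p)\<^sup>2 * D)
      + card {i\<in>{..<m}. \<not> simple_row e D m \<pi> i})"
proof -
  define w where "w c = (if c \<in> S then 0 else 1 / ((1 - p) * D))" for c :: nat
  have D0: "0 < D" using D by simp
  have pD: "0 < (1 - p) * D" using p D0 by simp
  have val: "(\<Sum>c<g * m. of_bool (i \<in> neighbours e (g * e) \<pi> c) * w c)
      = card {c\<in>{..<g * m} - S. i \<in> neighbours e D \<pi> c} / ((1 - p) * D)" for i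
  proof -
    have "(\<Sum>c<g * m. of_bool (i \<in> neighbours e (g * e) \<pi> c) * w c)
      = (\<Sum>c\<in>{c\<in>{..<g * m} - S. i \<in> neighbours e D \<pi> c}. 1 / ((1 - p) * D))"
      by (rule sum.mono_neutral_cong_right) (auto simp: w_def D)
    then show ?thesis by simp
  qed
  have "(\<Sum>i<m. ((\<Sum>c<g * m. of_bool (i \<in> neighbours e (g * e) \<pi> c) * w c) - 1)\<^sup>2)
    \<le> (\<Sum>i<m. row_deviation e D m p \<pi> S i / ((1 - p)\<^sup>2 * D)
        + of_bool (\<not> simple_row e D m \<pi> i))"
  proof (rule sum_mono)
    fix i assume i: "i \<in> {..<m}"
    let ?v = "real (card {c\<in>{..<g * m} - S. i \<in> neighbours e D \<pi> c})"
    let ?s = "real (card (straggler_edges e D m \<pi> S i))"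
    have "(?v / ((1 - p) * D) - 1)\<^sup>2 \<le> (?s - p * D)\<^sup>2 / D / ((1 - p)\<^sup>2 * D) + of_bool (\<not> simple_row e D m \<pi> i)"
    proof (cases "simple_row e D m \<pi> i")
      case True
      then have v: "?v = D - ?s" using row_weight(2)[OF \<pi> D _ S] i by simp
      have "?v / ((1 - p) * D) - 1 = (?v - (1 - p) * D) / ((1 - p) * D)"
        using p D0 by (simp add: diff_divide_distrib)
      also have "?v - (1 - p) * D = - (?s - p * D)" unfolding v by (simp add: algebra_simps)
      finally have "?v / ((1 - p) * D) - 1 = - (?s - p * D) / ((1 - p) * D)" .
      then have "(?v / ((1 - p) * D) - 1)\<^sup>2 = (?s - p * D)\<^sup>2 / ((1 - p) * D)\<^sup>2"
        by (simp only: power_divide power2_minus)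
      also have "\<dots> = (?s - p * D)\<^sup>2 / D / ((1 - p)\<^sup>2 * D)"
        by (simp add: power_mult_distrib power2_eq_square)
      finally show ?thesis using True by simp
    next
      case False
      have "?v \<le> D" using row_weight(1)[OF \<pi> D _ S] i by simp
      also have "real D \<le> 2 * ((1 - p) * D)"
      proof -
        have "1 * real D \<le> (2 * (1 - p)) * real D" using p by (intro mult_right_mono) auto
        then show ?thesis by (simp only: mult_1 mult.assoc)
      qed
      finally have "?v / ((1 - p) * D) \<le> 2" using pD by (simp add: divide_le_eq)
      moreover have "0 \<le> ?v / ((1 - p) * D)" using pD by simp
      ultimately have "\<bar>?v / ((1 - p) * D) - 1\<bar> \<le> 1" by linarith
      then have "(?v / ((1 - p) * D) - 1)\<^sup>2 \<le> 1" by (simp add: abs_square_le_1)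
      moreover have "0 \<le> (?s - p * D)\<^sup>2 / D / ((1 - p)\<^sup>2 * D)" by simp
      moreover have "of_bool (\<not> simple_row e D m \<pi> i) = (1 :: real)" using False by simp
      ultimately show ?thesis by linarith
    qed
    then show "((\<Sum>c<g * m. of_bool (i \<in> neighbours e (g * e) \<pi> c) * w c) - 1)\<^sup>2
      \<le> (?s - p * D)\<^sup>2 / D / ((1 - p)\<^sup>2 * D) + of_bool (\<not> simple_row e D m \<pi> i)"
      unfolding val .
  qed
  also have "\<dots> = (\<Sum>i<m. row_deviation e D m p \<pi> S i) / ((1 - p)\<^sup>2 * D)
      + card {i\<in>{..<m}. \<not> simple_row e D m \<pi> i}"
    by (simp add: sum.distrib sum_divide_distrib of_bool_def sum.If_cases Int_def)
  finally show ?thesis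
    using order_trans[OF err_stacked_le[OF D(1), of S w g m \<pi>] mult_left_mono] by (simp add: w_def)
qed

lemma two_times_choose_two: "2 * real (n choose 2) = real n * (real n - 1)"
proof -
  have "2 * (n choose 2) = n * (n - 1)"
    using binomial_absorption[of 1 n] by (simp add: numeral_2_eq_2)
  then have "2 * real (n choose 2) = real n * real (n - 1)"
    by (metis of_nat_mult of_nat_numeral)
  then show ?thesis by (cases n) auto
qed

text \<open>Union over the ordered pairs of half-edges in a common column: at most
  \<open>D * m * e\<close> pairs, each sent into row \<open>i\<close> with probability at most
  \<open>1 / m^2\<close>. The expected number of rows with parallel edges is therefore bounded
  independently of \<open>m\<close>.\<close>

lemma prob_not_simple_row_le:
  assumes D: "0 < e" "0 < D" "i < m"
  shows "measure_pmf.prob (rand_perm (D * m)) {\<pi>. \<not> simple_row e D m \<pi> i} \<le> real e * real D / real m"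
proof -
  let ?V = "{..<D * m}"
  let ?P = "pmf_of_set {\<pi>. \<pi> permutes ?V}"
  let ?B = "{i * D..<i * D + D}"
  define Q where "Q = (SIGMA h:?V. {h'\<in>?V. h' \<noteq> h \<and> h' div e = h div e})"
  have m0: "0 < m" using D by simp
  have finQ: "finite Q" by (simp add: Q_def)
  have "card Q = (\<Sum>h<D * m. card {h'\<in>?V. h' \<noteq> h \<and> h' div e = h div e})"
    unfolding Q_def by simp
  also have "\<dots> \<le> (\<Sum>h<D * m. e)"
  proof (rule sum_mono)
    fix h
    have "card {h'\<in>?V. h' \<noteq> h \<and> h' div e = h div e} \<le> card {h'. h' div e \<in> {h div e}}"
      using card_div_vimage(2)[of "{h div e}" e] D by (intro card_mono) auto
    then show "card {h'\<in>?V. h' \<noteq> h \<and> h' div e = h div e} \<le> e"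
      using card_div_vimage(1)[of "{h div e}" e] D by simp
  qed
  finally have cQ: "card Q \<le> D * m * e" by simp
  have pair: "measure_pmf.prob ?P {\<pi>. \<pi> ` {h, h'} \<subseteq> ?B} \<le> 1 / (real m)\<^sup>2" if hh: "(h, h') \<in> Q" for h h'
  proof -
    have hh': "{h, h'} \<subseteq> ?V" "card {h, h'} = 2" using hh by (auto simp: Q_def)
    have N2: "2 \<le> D * m" using card_mono[OF _ hh'(1)] hh'(2) by simp
    let ?F = "{X. X \<subseteq> ?V \<and> card X = 2}"
    have cF: "card ?F = (D * m) choose 2" using n_subsets[of ?V 2] by simp
    have F: "finite ?F" "?F \<noteq> {}" using hh' by (auto simp del: insert_subset)
    have "measure_pmf.prob ?P {\<pi>. \<pi> ` {h, h'} \<subseteq> ?B} = measure_pmf.prob (pmf_of_set ?F) {X. X \<subseteq> ?B}"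
      unfolding hh'(2)[symmetric] map_pmf_permutation_image[OF finite_lessThan hh'(1), symmetric]
      by (simp add: vimage_def)
    also have "\<dots> = card {X\<in>?F. X \<subseteq> ?B} / ((D * m) choose 2)"
      using F cF by (simp add: measure_pmf_of_set Int_def)
    also have "\<dots> \<le> (D choose 2) / ((D * m) choose 2)"
    proof (intro divide_right_mono)
      have "card {X\<in>?F. X \<subseteq> ?B} \<le> card {X. X \<subseteq> ?B \<and> card X = 2}"
        by (intro card_mono) auto
      also have "\<dots> = D choose 2" using n_subsets[of ?B 2] by simp
      finally show "real (card {X\<in>?F. X \<subseteq> ?B}) \<le> real (D choose 2)" by simp
    qed simp
    also have "\<dots> = (2 * real (D choose 2)) / (2 * real ((D * m) choose 2))" by simp
    also have "\<dots> = real D * (real D - 1) / (real (D * m) * (real (D * m) - 1))"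
      unfolding two_times_choose_two ..
    also have "\<dots> \<le> 1 / (real m)\<^sup>2"
    proof -
      have "1 < real (D * m)" using N2 by linarith
      moreover have "(real D - 1) * real m \<le> real (D * m) - 1" using m0 by (simp add: algebra_simps)
      then have "real D * real m * ((real D - 1) * real m) \<le> real D * real m * (real (D * m) - 1)"
        by (intro mult_left_mono) auto
      ultimately show ?thesis using m0 D by (simp add: divide_simps power2_eq_square mult_ac)
    qed
    finally show ?thesis .
  qed
  have "measure_pmf.prob ?P {\<pi>. \<not> simple_row e D m \<pi> i} \<le> measure_pmf.prob ?P (\<Union>(h, h')\<in>Q. {\<pi>. \<pi> ` {h, h'} \<subseteq> ?B})"
  proof (rule measure_pmf.finite_measure_mono)
    show "{\<pi>. \<not> simple_row e D m \<pi> i} \<subseteq> (\<Union>(h, h')\<in>Q. {\<pi>. \<pi> ` {h, h'} \<subseteq> ?B})"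
    proof
      fix \<pi> assume "\<pi> \<in> {\<pi>. \<not> simple_row e D m \<pi> i}"
      then obtain h h' where h: "h < D * m" "h' < D * m" "\<pi> h div D = i" "\<pi> h' div D = i" "h div e = h' div e" "h \<noteq> h'"
        unfolding simple_row_def inj_on_def by auto
      then have "(h, h') \<in> Q" by (auto simp: Q_def)
      moreover have "\<pi> ` {h, h'} \<subseteq> ?B" using h div_eq_iff_interval[OF D(2), of _ i] by simp
      ultimately show "\<pi> \<in> (\<Union>(h, h')\<in>Q. {\<pi>. \<pi> ` {h, h'} \<subseteq> ?B})" by blast
    qed
  qed simp
  also have "\<dots> \<le> (\<Sum>x\<in>Q. measure_pmf.prob ?P (case x of (h, h') \<Rightarrow> {\<pi>. \<pi> ` {h, h'} \<subseteq> ?B}))"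
    by (rule measure_pmf.finite_measure_subadditive_finite) (use finQ in auto)
  also have "\<dots> \<le> (\<Sum>x\<in>Q. 1 / (real m)\<^sup>2)"
    using pair by (intro sum_mono) (auto split: prod.split)
  also have "\<dots> = real (card Q) * (1 / (real m)\<^sup>2)" by simp
  also have "\<dots> \<le> real (D * m * e) * (1 / (real m)\<^sup>2)"
    using cQ by (intro mult_right_mono) (simp_all only: of_nat_le_iff, simp)
  also have "\<dots> = real e * real D / real m" using m0 by (simp add: power2_eq_square)
  finally show ?thesis .
qed

text \<open>Now the rows are the blocks: the half-edges of \<open>S\<close> are sent to a uniform
  subset of density exactly \<open>p\<close>, so \<open>binomial_square_exp_moment\<close> applies
  to each row, and the exponential Markov inequality gives an \<open>m\<close>-th power.\<close>

lemma prob_deviation_le: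
  fixes p :: real
  assumes p: "0 < p" "p < 1 / 2" and D: "0 < e" "D = g * e" "0 < g" "0 < m"
    and S: "S \<subseteq> {..<g * m}" "real (card S) = p * real (g * m)"
  shows "measure_pmf.prob (rand_perm (D * m))
      {\<pi>. 2 * real g ^ 3 * p * m < (\<Sum>i<m. row_deviation e D m p \<pi> S i)}
    \<le> real (D * m + 1) * (12 * exp (- (2 * real g ^ 3 * p))) ^ m"
proof -
  let ?V = "{..<D * m}"
  let ?P = "pmf_of_set {\<pi>. \<pi> permutes ?V}"
  let ?B = "\<lambda>i. {i * D..<i * D + D}"
  have D0: "0 < D" using D by simp
  have NE: "g * m * e = D * m" using D by simp
  define A where "A = {h. h div e \<in> S}"
  have finS: "finite S" using S finite_subset by blast
  have cA: "card A = e * card S" unfolding A_def using card_div_vimage(1)[OF finS D(1)] .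
  have AV: "A \<subseteq> ?V"
  proof
    fix h assume "h \<in> A"
    then have "h div e < g * m" using S by (auto simp: A_def)
    then show "h \<in> ?V" using div_less_iff_less_mult[OF D(1), of h "g * m"] NE by simp
  qed
  have pq: "p = real (card A) / real (D * m)"
    unfolding cA NE[symmetric] using S(2) D by simp
  have se: "card (straggler_edges e D m \<pi> S i) = card (\<pi> ` A \<inter> ?B i)" if "\<pi> permutes ?V" for \<pi> i
  proof -
    have "\<pi> ` A \<inter> ?B i = \<pi> ` straggler_edges e D m \<pi> S i"
      using AV div_eq_iff_interval[OF D0, of _ i] by (auto simp: straggler_edges_def A_def)
    then show ?thesis using card_image[OF permutes_inj_on[OF that]] by metis
  qed
  define T where "T X \<longleftrightarrow> 2 * real g ^ 3 * p * m < (\<Sum>i<m. (real (card (X \<inter> ?B i)) - p * D)\<^sup>2 / D)" for X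
  define G :: "nat \<Rightarrow> nat set \<Rightarrow> real" where "G i Y = exp (- (2 * real g ^ 3 * p)) * exp ((real (card Y) - p * D)\<^sup>2 / D)" for i Y
  let ?E = "{\<pi>. 2 * real g ^ 3 * p * m < (\<Sum>i<m. row_deviation e D m p \<pi> S i)}"
  let ?F = "\<lambda>i. \<Sum>Y\<in>Pow (?B i). G i Y * ((p * 1) ^ card Y * (1 - p) ^ (card (?B i) - card Y))"
  have setP: "set_pmf ?P = {\<pi>. \<pi> permutes ?V}"
    by (rule set_pmf_permutations) simp
  have "measure_pmf.prob ?P ?E
    = measure_pmf.prob ?P (?E \<inter> set_pmf ?P)"
    by (rule measure_Int_set_pmf[symmetric])
  also have "\<dots> = measure_pmf.prob ?P ({\<pi>. T (\<pi> ` A)} \<inter> set_pmf ?P)"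
    unfolding setP T_def using se by (intro arg_cong[where f = "measure_pmf.prob ?P"]) auto
  also have "\<dots> = measure_pmf.prob ?P {\<pi>. T (\<pi> ` A)}" by (rule measure_Int_set_pmf)
  also have "\<dots> = measure_pmf.prob (pmf_of_set {X. X \<subseteq> ?V \<and> card X = card A}) {X. T X}"
    unfolding map_pmf_permutation_image[OF finite_lessThan AV, symmetric] by (simp add: vimage_def)
  also have "\<dots> \<le> real (D * m + 1) * inverse 1 ^ card A *
      (\<Prod>i<m. ?F i)"
  proof (rule prob_uniform_subset_le[OF _ _ blocks_partition(1)])
    show "(\<Union>i<m. ?B i) = ?V" using blocks_partition(2)[of D m] by (simp add: mult.commute)
    show "card A \<le> D * m" using card_mono[OF _ AV] by simp
    fix X assume "T X"
    have "(\<Prod>i<m. G i (X \<inter> ?B i)) = exp (- (2 * real g ^ 3 * p)) ^ m * exp (\<Sum>i<m. (real (card (X \<inter> ?B i)) - p * D)\<^sup>2 / D)"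
      unfolding G_def prod.distrib by (simp add: exp_sum)
    also have "\<dots> = exp (real m * - (2 * real g ^ 3 * p) + (\<Sum>i<m. (real (card (X \<inter> ?B i)) - p * D)\<^sup>2 / D))"
      by (simp only: exp_add exp_of_nat_mult)
    also have "\<dots> \<ge> 1" using \<open>T X\<close> unfolding T_def by (simp add: mult_ac)
    finally show "1 \<le> (\<Prod>i<m. G i (X \<inter> ?B i))" .
  qed (use D0 D pq in \<open>auto simp: G_def\<close>)
  also have "(\<Prod>i<m. ?F i)
    \<le> (\<Prod>i<m. 12 * exp (- (2 * real g ^ 3 * p)))"
  proof (rule prod_mono, rule conjI)
    fix i
    show "0 \<le> ?F i"
      using p by (intro sum_nonneg mult_nonneg_nonneg) (auto simp: G_def)
    have "?F i
      = exp (- (2 * real g ^ 3 * p)) *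
        (\<Sum>Y\<in>Pow (?B i). exp ((real (card Y) - p * D)\<^sup>2 / D) * (p ^ card Y * (1 - p) ^ (card (?B i) - card Y)))"
      unfolding sum_distrib_left G_def by (simp add: mult.assoc)
    also have "\<dots> \<le> exp (- (2 * real g ^ 3 * p)) * 12"
      using p D0 by (intro mult_left_mono binomial_square_exp_moment) auto
    finally show "?F i
      \<le> 12 * exp (- (2 * real g ^ 3 * p))" by (simp add: mult.commute)
  qed
  finally show ?thesis by (simp add: mult_left_mono)
qed

text \<open>The first term is the union bound over \<open>S\<close>, the second is Markov's
  inequality for at least \<open>sqrt m\<close> rows with parallel edges.\<close>

definition deviation_bound :: "nat \<Rightarrow> nat \<Rightarrow> nat \<Rightarrow> real" where
  "deviation_bound e D m = real (D * m + 1) * (1 / 2) ^ m + real e * real D / sqrt m"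

text \<open>The 8 is 2 times 4: a deviation of \<open>2 * g^3 * p\<close> per row is allowed, and
  \<open>1 / (1 - p)^2 \<le> 4\<close>. At most \<open>sqrt m\<close> rows with parallel edges add
  \<open>1 / sqrt m\<close> after normalisation. Since \<open>g^2 * p \<ge> 1\<close>, the factor
  \<open>exp (- (2 * g^3 * p))\<close> is at most \<open>(1 / 4) ^ g\<close>, and its
  \<open>m\<close>-th power beats the \<open>2 ^ (g * m)\<close> sets \<open>S\<close>.\<close>

lemma prob_worst_err_gt_le:
  fixes p :: real
  assumes p: "0 < p" "p < 1 / 2" and D: "0 < e" "D = g * e" "0 < m" and g: "16 \<le> real g * p\<^sup>2"
    and k: "real k = p * real (g * m)"
  shows "measure_pmf.prob (rand_perm (D * m))
      {\<pi>. \<exists>S\<in>subsets_of_card (g * m) k.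
        real (g * m) * (8 * real g ^ 3 * p / D + 1 / sqrt m) < err (stacked g m e \<pi>) S}
    \<le> deviation_bound e D m"
proof -
  let ?P = "rand_perm (D * m)"
  let ?SS = "subsets_of_card (g * m) k"
  let ?E = "{\<pi>. \<exists>S\<in>?SS. real (g * m) * (8 * real g ^ 3 * p / D + 1 / sqrt m) < err (stacked g m e \<pi>) S}"
  define ES where "ES S = {\<pi>. 2 * real g ^ 3 * p * m < (\<Sum>i<m. row_deviation e D m p \<pi> S i)}" for S
  define EN where "EN = {\<pi>. sqrt m \<le> real (card {i\<in>{..<m}. \<pi> \<in> {\<pi>. \<not> simple_row e D m \<pi> i}})}"
  have p2: "p\<^sup>2 \<le> 1 / 4" using power_mono[of p "1 / 2" 2] p by (simp add: power2_eq_square)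
  have g64: "64 \<le> real g"
  proof -
    have "real g * p\<^sup>2 \<le> real g * (1 / 4)" using p2 by (intro mult_left_mono) auto
    then show ?thesis using g by simp
  qed
  then have g0: "0 < g" by (cases g) auto
  have D0: "0 < D" using D g0 by simp
  have SS: "?SS \<subseteq> Pow {..<g * m}" "finite ?SS" by (auto simp: subsets_of_card_def intro: finite_subset[of _ "Pow {..<g * m}"])
  have setP: "set_pmf ?P = {\<pi>. \<pi> permutes {..<D * m}}"
    by (rule set_pmf_permutations) simp
  have cover: "?E \<inter> set_pmf ?P
    \<subseteq> (\<Union>S\<in>?SS. ES S) \<union> EN"
  proof
    fix \<pi> assume "\<pi> \<in> ?E \<inter> set_pmf ?P"
    then obtain S where S: "S \<in> ?SS" "real (g * m) * (8 * real g ^ 3 * p / D + 1 / sqrt m) < err (stacked g m e \<pi>) S"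
      and \<pi>: "\<pi> permutes {..<D * m}" unfolding setP by blast
    show "\<pi> \<in> (\<Union>S\<in>?SS. ES S) \<union> EN"
    proof (rule ccontr)
      assume "\<pi> \<notin> (\<Union>S\<in>?SS. ES S) \<union> EN"
      then have 1: "(\<Sum>i<m. row_deviation e D m p \<pi> S i) \<le> 2 * real g ^ 3 * p * m"
        and 2: "real (card {i\<in>{..<m}. \<not> simple_row e D m \<pi> i}) \<le> sqrt m"
        using S(1) by (auto simp: ES_def EN_def not_less not_le)
      have q4: "1 / 4 \<le> (1 - p)\<^sup>2" using power_mono[of "1 / 2" "1 - p" 2] p by (simp add: power2_eq_square)
      have "(\<Sum>i<m. row_deviation e D m p \<pi> S i) / ((1 - p)\<^sup>2 * D)
        \<le> (2 * real g ^ 3 * p * m) / (1 / 4 * D)"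
        using 1 q4 D0 p by (intro frac_le mult_right_mono) auto
      then have "(\<Sum>i<m. row_deviation e D m p \<pi> S i) / ((1 - p)\<^sup>2 * D)
          + card {i\<in>{..<m}. \<not> simple_row e D m \<pi> i} \<le> (2 * real g ^ 3 * p * m) / (1 / 4 * D) + sqrt m"
        using 2 by linarith
      also have "\<dots> = real m * (8 * real g ^ 3 * p / D + 1 / sqrt m)"
        using D(3) by (simp add: distrib_left real_div_sqrt)
      finally have "err (stacked g m e \<pi>) S \<le> real g * (real m * (8 * real g ^ 3 * p / D + 1 / sqrt m))"
        using order_trans[OF err_stacked_le_deviation[OF p \<pi> D(1,2) g0, of S] mult_left_mono] SS S(1) by auto
      then show False using S(2) by (simp add: mult.assoc)
    qed
  qed
  have 1: "measure_pmf.prob ?P (\<Union>S\<in>?SS. ES S) \<le> real (D * m + 1) * (1 / 2) ^ m"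
  proof -
    have "measure_pmf.prob ?P (\<Union>S\<in>?SS. ES S) \<le> (\<Sum>S\<in>?SS. measure_pmf.prob ?P (ES S))"
      by (rule measure_pmf.finite_measure_subadditive_finite) (use SS in auto)
    also have "\<dots> \<le> (\<Sum>S\<in>?SS. real (D * m + 1) * (12 * exp (- (2 * real g ^ 3 * p))) ^ m)"
      unfolding ES_def using k by (intro sum_mono prob_deviation_le p D g0) (auto simp: subsets_of_card_def)
    also have "\<dots> = real (card ?SS) * (real (D * m + 1) * (12 * exp (- (2 * real g ^ 3 * p))) ^ m)" by simp
    also have "\<dots> \<le> 2 ^ (g * m) * (real (D * m + 1) * (12 * exp (- (2 * real g ^ 3 * p))) ^ m)"
    proof (rule mult_right_mono)
      show "real (card ?SS) \<le> 2 ^ (g * m)" using card_mono[OF _ SS(1)] by (simp add: card_Pow)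
    qed simp
    also have "\<dots> = real (D * m + 1) * (2 ^ g * (12 * exp (- (2 * real g ^ 3 * p)))) ^ m"
      by (simp only: power_mult power_mult_distrib mult_ac)
    also have "\<dots> \<le> real (D * m + 1) * (1 / 2) ^ m"
    proof (intro mult_left_mono power_mono)
      have "1 \<le> real g * (real g * p)"
      proof -
        have "real g * p\<^sup>2 \<le> real g * p" using p by (intro mult_left_mono) (auto simp: power2_eq_square)
        then have "1 \<le> real g * p" using g by linarith
        then have "1 * 1 \<le> real g * (real g * p)" using g64 by (intro mult_mono) auto
        then show ?thesis by simp
      qed
      then have "2 * real g * 1 \<le> 2 * real g * (real g * (real g * p))" by (intro mult_left_mono) auto
      then have "exp (- (2 * real g ^ 3 * p)) \<le> exp (real g * - 2)" by (simp add: power3_eq_cube mult_ac)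
      also have "\<dots> = exp (- 2) ^ g" by (rule exp_of_nat_mult)
      also have "\<dots> \<le> (1 / 4) ^ g" using exp_neg_two_le by (intro power_mono) auto
      finally have "2 ^ g * (12 * exp (- (2 * real g ^ 3 * p))) \<le> 2 ^ g * (12 * (1 / 4 :: real) ^ g)"
        by (intro mult_left_mono) auto
      also have "\<dots> = 12 * (1 / 2) ^ g" by (simp flip: power_mult_distrib)
      also have "\<dots> \<le> 12 * (1 / 2) ^ 5" using g64 by (intro mult_left_mono power_decreasing) auto
      also have "\<dots> \<le> 1 / 2" by (simp add: power_divide)
      finally show "2 ^ g * (12 * exp (- (2 * real g ^ 3 * p))) \<le> 1 / 2" .
    qed auto
    finally show ?thesis .
  qed
  have 2: "measure_pmf.prob ?P EN \<le> real e * real D / sqrt m"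
  proof -
    have "measure_pmf.prob ?P EN \<le> (\<Sum>i<m. measure_pmf.prob ?P {\<pi>. \<not> simple_row e D m \<pi> i}) / sqrt m"
      unfolding EN_def using D by (intro prob_count_ge_le) auto
    also have "\<dots> \<le> (\<Sum>i<m. real e * real D / real m) / sqrt m"
      using D D0 by (intro divide_right_mono sum_mono prob_not_simple_row_le) auto
    finally show ?thesis using D by simp
  qed
  have "measure_pmf.prob ?P ?E
    = measure_pmf.prob ?P (?E \<inter> set_pmf ?P)"
    by (rule measure_Int_set_pmf[symmetric])
  also have "\<dots> \<le> measure_pmf.prob ?P ((\<Union>S\<in>?SS. ES S) \<union> EN)"
    using cover by (intro measure_pmf.finite_measure_mono) auto
  also have "\<dots> \<le> measure_pmf.prob ?P (\<Union>S\<in>?SS. ES S) + measure_pmf.prob ?P EN"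
    by (intro measure_Un_le) auto
  also have "\<dots> \<le> deviation_bound e D m" unfolding deviation_bound_def by (intro add_mono 1 2)
  finally show ?thesis .
qed

section \<open>Conclusion\<close>

lemma ABC_stacked_eq:
  assumes "0 < g"
  shows "ABC_stacked g (g * m) (g * e) = map_pmf (stacked g m e) (rand_perm (g * e * m))"
  using assms unfolding ABC_stacked_def ABC_def pmf.map_comp by (simp add: stacked_def[abs_def] o_def)

lemma proportion_le:
  fixes p :: real
  assumes "p \<le> 1" "real k = p * real n"
  shows "k \<le> n"
proof -
  have "real k \<le> 1 * real n" unfolding assms(2) using assms(1) by (intro mult_right_mono) auto
  then show ?thesis by (simp only: mult_1 of_nat_le_iff)
qed

lemma subsets_of_card_props:
  assumes "k \<le> n"
  shows "finite (subsets_of_card n k)" "subsets_of_card n k \<noteq> {}" "0 < card (subsets_of_card n k)"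
proof -
  show fin: "finite (subsets_of_card n k)"
    by (rule finite_subset[of _ "Pow {..<n}"]) (auto simp: subsets_of_card_def)
  have "{..<k} \<in> subsets_of_card n k" using assms by (auto simp: subsets_of_card_def)
  then show ne: "subsets_of_card n k \<noteq> {}" by blast
  show "0 < card (subsets_of_card n k)" using fin ne by (simp add: card_gt_0_iff)
qed

text \<open>A set \<open>S\<close> that admits a large kernel vector is charged the trivial error
  \<open>g * m\<close>. If the average is too large, the share of such \<open>S\<close> exceeds the
  square root of \<open>kernel_bound p D m\<close>, while the mean share is at most
  \<open>kernel_bound p D m\<close>. The square root balances excess error against failure
  probability.\<close>

lemma prob_avg_err_gt_le:
  fixes p :: real
  assumes p: "0 < p" "p < 1 / 2" and e: "0 < e" "D = g * e" "2 \<le> D" "0 < m"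
    and D: "4 * exp 2 * real D ^ 2 * (exp (1 / 4) / 2) ^ D \<le> 1"
    and g: "16 \<le> real g * p\<^sup>2" "(1 - p\<^sup>2 / 128) ^ (g div 16) \<le> 1 / 4"
    and big: "64 * real e ^ 2 \<le> p\<^sup>2 * m" and k: "real k = p * real (g * m)"
  shows "measure_pmf.prob (rand_perm (D * m))
      {\<pi>. real (g * m) * (exp 3 * p ^ D + sqrt (kernel_bound p D m))
        < measure_pmf.expectation (pmf_of_set (subsets_of_card (g * m) k)) (err (stacked g m e \<pi>))}
    \<le> sqrt (kernel_bound p D m)"
proof -
  let ?P = "rand_perm (D * m)"
  let ?SS = "subsets_of_card (g * m) k"
  let ?\<phi> = "kernel_bound p D m"
  have g0: "0 < g" using g(1) by (cases g) auto
  have kn: "k \<le> g * m" using proportion_le[OF _ k] p by simp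
  note SS = subsets_of_card_props[OF kn]
  have \<phi>: "0 < ?\<phi>" unfolding kernel_bound_def by (intro add_nonneg_pos mult_nonneg_nonneg add_nonneg_nonneg) auto
  define EB where "EB S = {\<pi>. \<exists>x. kernel_vec e D \<pi> ({..<g * m} - S) x \<and> exp 3 * p ^ D * m < card {i. i < m \<and> x i \<noteq> 0}}" for S
  have EB: "measure_pmf.prob ?P (EB S) \<le> ?\<phi>" if "S \<in> ?SS" for S
    unfolding EB_def
  proof (rule prob_large_kernel_vec_le[OF p e D g big])
    have S: "S \<subseteq> {..<g * m}" "card S = k" using that by (auto simp: subsets_of_card_def)
    then have "card ({..<g * m} - S) = g * m - k" by (simp add: card_Diff_subset finite_subset)
    then show "real (card ({..<g * m} - S)) = (1 - p) * real (g * m)"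
      using kn k by (simp add: of_nat_diff algebra_simps)
  qed auto
  define t where "t = sqrt ?\<phi> * card ?SS"
  have t: "0 < t" using \<phi> SS(3) by (simp add: t_def)
  have setP: "set_pmf ?P = {\<pi>. \<pi> permutes {..<D * m}}"
    by (rule set_pmf_permutations) simp
  let ?E = "{\<pi>. real (g * m) * (exp 3 * p ^ D + sqrt ?\<phi>) < measure_pmf.expectation (pmf_of_set ?SS) (err (stacked g m e \<pi>))}"
  have sub: "?E \<inter> set_pmf ?P \<subseteq> {\<pi>. t \<le> real (card {S\<in>?SS. \<pi> \<in> EB S})}"
  proof
    fix \<pi> assume "\<pi> \<in> ?E \<inter> set_pmf ?P"
    then have \<pi>: "\<pi> permutes {..<D * m}"
      and E: "real (g * m) * (exp 3 * p ^ D + sqrt ?\<phi>) < measure_pmf.expectation (pmf_of_set ?SS) (err (stacked g m e \<pi>))"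
      unfolding setP by auto
    have le: "err (stacked g m e \<pi>) S \<le> real (g * m) * (exp 3 * p ^ D + of_bool (\<pi> \<in> EB S))" for S
    proof (cases "\<pi> \<in> EB S")
      case True
      have "real (g * m) * 1 \<le> real (g * m) * (exp 3 * p ^ D + 1)" using p by (intro mult_left_mono) auto
      then show ?thesis using True err_stacked_le_size[OF e(1), of g m \<pi> S] by simp
    next
      case False
      have "err (stacked g m e \<pi>) S \<le> real g * (exp 3 * p ^ D * m)"
        using e(1) \<pi> False unfolding e(2) EB_def
        by (intro err_stacked_le_kernel) (auto simp: not_less)
      then show ?thesis using False by (simp add: mult_ac)
    qed
    have "measure_pmf.expectation (pmf_of_set ?SS) (err (stacked g m e \<pi>))
      = (\<Sum>S\<in>?SS. err (stacked g m e \<pi>) S) / card ?SS"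
      using SS by (intro integral_pmf_of_set) auto
    also have "\<dots> \<le> (\<Sum>S\<in>?SS. real (g * m) * (exp 3 * p ^ D + of_bool (\<pi> \<in> EB S))) / card ?SS"
      using le by (intro divide_right_mono sum_mono) auto
    also have "\<dots> = real (g * m) * (card ?SS * (exp 3 * p ^ D) + card {S\<in>?SS. \<pi> \<in> EB S}) / card ?SS"
      using SS by (simp add: sum.distrib of_bool_def sum.If_cases Int_def flip: sum_distrib_left)
    also have "\<dots> = real (g * m) * (exp 3 * p ^ D + card {S\<in>?SS. \<pi> \<in> EB S} / card ?SS)"
    proof -
      have "(card ?SS * (exp 3 * p ^ D) + card {S\<in>?SS. \<pi> \<in> EB S}) / card ?SS
          = exp 3 * p ^ D + card {S\<in>?SS. \<pi> \<in> EB S} / card ?SS"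
        using SS(3) by (simp add: add_divide_distrib)
      then show ?thesis by (simp only: times_divide_eq_right[symmetric])
    qed
    finally have "real (g * m) * (exp 3 * p ^ D + sqrt ?\<phi>) < real (g * m) * (exp 3 * p ^ D + card {S\<in>?SS. \<pi> \<in> EB S} / card ?SS)"
      using E by linarith
    then have "sqrt ?\<phi> < card {S\<in>?SS. \<pi> \<in> EB S} / card ?SS"
      using g0 e(4) by (simp add: mult_less_cancel_left_pos)
    then show "\<pi> \<in> {\<pi>. t \<le> real (card {S\<in>?SS. \<pi> \<in> EB S})}"
      using SS(3) by (simp add: t_def pos_less_divide_eq)
  qed
  have "measure_pmf.prob ?P ?E = measure_pmf.prob ?P (?E \<inter> set_pmf ?P)" by (rule measure_Int_set_pmf[symmetric])
  also have "\<dots> \<le> measure_pmf.prob ?P {\<pi>. t \<le> real (card {S\<in>?SS. \<pi> \<in> EB S})}"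
    using sub by (intro measure_pmf.finite_measure_mono) auto
  also have "\<dots> \<le> (\<Sum>S\<in>?SS. measure_pmf.prob ?P (EB S)) / t"
    using SS t by (intro prob_count_ge_le) auto
  also have "\<dots> \<le> (\<Sum>S\<in>?SS. ?\<phi>) / t" using EB t by (intro divide_right_mono sum_mono) auto
  also have "\<dots> = ?\<phi> / sqrt ?\<phi>" using SS(3) by (simp add: t_def)
  also have "\<dots> = sqrt ?\<phi>" using \<phi> by (simp add: real_div_sqrt)
  finally show ?thesis .
qed

lemma prob_ABC_stacked_good_ge:
  fixes p \<eta> :: real
  assumes p: "0 < p" "p < 1 / 2" and e: "0 < e" "D = g * e" "2 \<le> D" "0 < m"
    and D: "4 * exp 2 * real D ^ 2 * (exp (1 / 4) / 2) ^ D \<le> 1"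
    and g: "16 \<le> real g * p\<^sup>2" "(1 - p\<^sup>2 / 128) ^ (g div 16) \<le> 1 / 4"
    and big: "64 * real e ^ 2 \<le> p\<^sup>2 * m" and k: "real k = p * real (g * m)"
    and \<eta>: "exp 3 * p ^ D \<le> \<eta>"
  shows "1 - (sqrt (kernel_bound p D m) + deviation_bound e D m) \<le> measure_pmf.prob (ABC_stacked g (g * m) D)
     {B. 1 / real (g * m) * measure_pmf.expectation (pmf_of_set (subsets_of_card (g * m) k)) (err B)
           \<le> \<eta> + sqrt (kernel_bound p D m)
       \<and> 1 / real (g * m) * Max (err B ` subsets_of_card (g * m) k) \<le> 8 * real g ^ 3 * p / real D + 1 / sqrt m}"
    (is "_ \<le> measure_pmf.prob _ ?G")
proof -
  let ?P = "rand_perm (D * m)"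
  let ?SS = "subsets_of_card (g * m) k"
  define E1 where "E1 = {\<pi>. real (g * m) * (exp 3 * p ^ D + sqrt (kernel_bound p D m))
        < measure_pmf.expectation (pmf_of_set ?SS) (err (stacked g m e \<pi>))}"
  define E2 where "E2 = {\<pi>. \<exists>S\<in>?SS. real (g * m) * (8 * real g ^ 3 * p / D + 1 / sqrt m) < err (stacked g m e \<pi>) S}"
  have g0: "0 < g" using g(1) by (cases g) auto
  have n0: "0 < real (g * m)" using g0 e by simp
  have kn: "k \<le> g * m" using proportion_le[OF _ k] p by simp
  note SS = subsets_of_card_props[OF kn]
  have sub: "- (E1 \<union> E2) \<subseteq> stacked g m e -` ?G"
  proof
    fix \<pi> assume "\<pi> \<in> - (E1 \<union> E2)"
    then have 1: "measure_pmf.expectation (pmf_of_set ?SS) (err (stacked g m e \<pi>)) \<le> real (g * m) * (exp 3 * p ^ D + sqrt (kernel_bound p D m))"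
      and 2: "\<And>S. S \<in> ?SS \<Longrightarrow> err (stacked g m e \<pi>) S \<le> real (g * m) * (8 * real g ^ 3 * p / D + 1 / sqrt m)"
      by (auto simp: E1_def E2_def not_less)
    have "1 / real (g * m) * measure_pmf.expectation (pmf_of_set ?SS) (err (stacked g m e \<pi>)) \<le> exp 3 * p ^ D + sqrt (kernel_bound p D m)"
      using 1 n0 by (simp add: pos_divide_le_eq mult.commute)
    moreover have "Max (err (stacked g m e \<pi>) ` ?SS) \<le> real (g * m) * (8 * real g ^ 3 * p / D + 1 / sqrt m)"
      using 2 SS by simp
    then have "1 / real (g * m) * Max (err (stacked g m e \<pi>) ` ?SS) \<le> 8 * real g ^ 3 * p / D + 1 / sqrt m"
      using n0 by (simp add: pos_divide_le_eq mult.commute)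
    ultimately show "\<pi> \<in> stacked g m e -` ?G" using \<eta> by simp
  qed
  have "measure_pmf.prob ?P (E1 \<union> E2) \<le> measure_pmf.prob ?P E1 + measure_pmf.prob ?P E2"
    by (intro measure_Un_le) auto
  also have "\<dots> \<le> sqrt (kernel_bound p D m) + deviation_bound e D m"
    unfolding E1_def E2_def
    by (intro add_mono prob_avg_err_gt_le prob_worst_err_gt_le assms)
  finally have "1 - (sqrt (kernel_bound p D m) + deviation_bound e D m) \<le> 1 - measure_pmf.prob ?P (E1 \<union> E2)" by simp
  also have "\<dots> = measure_pmf.prob ?P (- (E1 \<union> E2))"
    using measure_pmf.prob_compl[of "E1 \<union> E2" ?P] by (simp add: Compl_eq_Diff_UNIV)
  also have "\<dots> \<le> measure_pmf.prob ?P (stacked g m e -` ?G)"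
    using sub by (intro measure_pmf.finite_measure_mono) auto
  also have "\<dots> = measure_pmf.prob (ABC_stacked g (g * m) D) ?G"
    unfolding e(2) ABC_stacked_eq[OF g0] by simp
  finally show ?thesis .
qed

text \<open>Zero weights already give normalised error at most 1, so finitely many small
  \<open>n\<close> can be absorbed into the error terms.\<close>

lemma prob_ABC_stacked_trivial:
  fixes p \<eta>1 \<eta>2 :: real
  assumes e: "0 < e" "0 < g" "0 < m" and k: "k \<le> g * m" and \<eta>: "1 \<le> \<eta>1" "1 \<le> \<eta>2"
  shows "measure_pmf.prob (ABC_stacked g (g * m) (g * e))
     {B. 1 / real (g * m) * measure_pmf.expectation (pmf_of_set (subsets_of_card (g * m) k)) (err B) \<le> \<eta>1
       \<and> 1 / real (g * m) * Max (err B ` subsets_of_card (g * m) k) \<le> \<eta>2} = 1"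
proof -
  let ?SS = "subsets_of_card (g * m) k"
  note SS = subsets_of_card_props[OF k]
  have n0: "0 < real (g * m)" using e by simp
  have "1 / real (g * m) * measure_pmf.expectation (pmf_of_set ?SS) (err (stacked g m e \<pi>)) \<le> \<eta>1
       \<and> 1 / real (g * m) * Max (err (stacked g m e \<pi>) ` ?SS) \<le> \<eta>2" for \<pi>
  proof
    have "measure_pmf.expectation (pmf_of_set ?SS) (err (stacked g m e \<pi>)) = (\<Sum>S\<in>?SS. err (stacked g m e \<pi>) S) / card ?SS"
      using SS by (intro integral_pmf_of_set) auto
    also have "\<dots> \<le> (\<Sum>S\<in>?SS. real (g * m)) / card ?SS"
      using err_stacked_le_size[OF e(1)] by (intro divide_right_mono sum_mono) auto
    also have "\<dots> = real (g * m)" using SS by simp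
    finally have "1 / real (g * m) * measure_pmf.expectation (pmf_of_set ?SS) (err (stacked g m e \<pi>)) \<le> 1"
      using n0 by (simp add: pos_divide_le_eq)
    then show "1 / real (g * m) * measure_pmf.expectation (pmf_of_set ?SS) (err (stacked g m e \<pi>)) \<le> \<eta>1"
      using \<eta> by linarith
    have "Max (err (stacked g m e \<pi>) ` ?SS) \<le> real (g * m)"
      using SS err_stacked_le_size[OF e(1)] by simp
    then have "1 / real (g * m) * Max (err (stacked g m e \<pi>) ` ?SS) \<le> 1"
      using n0 by (simp add: pos_divide_le_eq)
    then show "1 / real (g * m) * Max (err (stacked g m e \<pi>) ` ?SS) \<le> \<eta>2" using \<eta> by linarith
  qed
  then show ?thesis unfolding ABC_stacked_eq[OF e(2)] by (simp add: vimage_def)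
qed

section \<open>Limits of the error terms\<close>

lemma tendsto_linear_power_0:
  fixes s :: real
  assumes "\<bar>s\<bar> < 1"
  shows "(\<lambda>m. real (D * m + 1) * s ^ m) \<longlonglongrightarrow> 0"
proof -
  have "(\<lambda>m. real D * (real m * s ^ m) + s ^ m) \<longlonglongrightarrow> real D * 0 + 0"
    using assms by (intro tendsto_intros powser_times_n_limit_0 LIMSEQ_power_zero) auto
  then show ?thesis by (simp add: algebra_simps)
qed

lemma kernel_bound_tendsto_0:
  assumes "0 < p"
  shows "kernel_bound p D \<longlonglongrightarrow> 0"
proof -
  \<comment> \<open>\<open>s ^ m\<close> is the square root of the exponential, so each of the two
    factors linear in \<open>m\<close> gets its own damping.\<close>
  define s where "s = exp (- (exp 3 * p ^ D) / 2)"
  have s: "\<bar>s\<bar> < 1" using assms by (simp add: s_def)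
  have "exp (- (exp 3 * p ^ D * m)) = s ^ m * s ^ m" for m :: nat
    by (simp add: s_def flip: exp_of_nat_mult exp_add)
  then have "kernel_bound p D = (\<lambda>m. (real (D * m + 1) * s ^ m) * (real (1 * m + 1) * s ^ m)
      + 2 * (real (D * m + 1) * (1 / 2) ^ m) + (1 / 2) ^ m)"
    by (simp add: kernel_bound_def fun_eq_iff algebra_simps)
  also have "\<dots> \<longlonglongrightarrow> 0 * 0 + 2 * 0 + 0"
    using s by (intro tendsto_intros tendsto_linear_power_0 LIMSEQ_power_zero) auto
  finally show ?thesis by simp
qed

lemma deviation_bound_tendsto_0: "deviation_bound e D \<longlonglongrightarrow> 0"
proof -
  have "(\<lambda>m. real e * real D / sqrt (real m)) \<longlonglongrightarrow> 0"
    by (intro tendsto_divide_0[OF tendsto_const] filterlim_at_top_imp_at_infinity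
        filterlim_compose[OF sqrt_at_top filterlim_real_sequentially])
  then have "(\<lambda>m. real (D * m + 1) * (1 / 2) ^ m + real e * real D / sqrt m) \<longlonglongrightarrow> 0 + 0"
    by (intro tendsto_add tendsto_linear_power_0) auto
  then show ?thesis by (simp add: deviation_bound_def[abs_def])
qed

lemma filterlim_div_const_at_top: "0 < g \<Longrightarrow> filterlim (\<lambda>n. n div g) at_top (at_top :: nat filter)"
  unfolding filterlim_at_top
proof
  fix Z assume "0 < g"
  show "\<forall>\<^sub>F n in at_top. Z \<le> n div g"
    using eventually_ge_at_top[of "Z * g"] by eventually_elim (simp add: \<open>0 < g\<close> less_eq_div_iff_mult_less_eq)
qed

theorem theorem8p4:
  fixes p :: real
  assumes "0 < p" and "p < 1 / 2"
  shows "\<exists>(c::real) (\<gamma>0::nat) (d0::nat). \<forall>(\<gamma>::nat) (d::nat).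
    0 < \<gamma> \<and> 0 < d \<and> \<gamma>0 \<le> \<gamma> \<and> \<gamma> dvd d \<and> real d0 \<le> real d / real \<gamma> \<longrightarrow>
    (\<exists>(\<delta>::real) (\<epsilon>1::nat \<Rightarrow> real) (\<epsilon>2::nat \<Rightarrow> real).
      0 < \<delta> \<and> \<epsilon>1 \<longlonglongrightarrow> 0 \<and> \<epsilon>2 \<longlonglongrightarrow> 0 \<and>
      (\<forall>(n::nat) (k::nat). 0 < n \<and> \<gamma> dvd n \<and> real k = p * real n \<longrightarrow>
        \<delta> \<le> measure_pmf.prob (ABC_stacked \<gamma> n d)
          {B. 1 / real n * measure_pmf.expectation (pmf_of_set (subsets_of_card n k)) (err B)
                \<le> p powr (real d - c * ln (real d)) + \<epsilon>1 n
            \<and> 1 / real n * Max (err B ` subsets_of_card n k)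
                \<le> 8 * real \<gamma> ^ 3 * p / real d + \<epsilon>2 n}))"
proof -
  \<comment> \<open>Then \<open>c * ln (1 / p) * ln d = 3 * ln d / ln 2\<close>, at least 3 for
    \<open>d \<ge> 2\<close>, so that \<open>p powr (- c * ln d)\<close> absorbs the factor
    \<open>exp 3\<close>.\<close>
  define c where "c = 3 / (ln (1 / p) * ln 2)"
  obtain D0 :: nat where D0: "\<And>D. D0 \<le> D \<Longrightarrow> 4 * exp 2 * real D ^ 2 * (exp (1 / 4) / 2) ^ D \<le> 1"
    using exists_degree_threshold by blast
  have p2: "0 < p\<^sup>2" "p\<^sup>2 \<le> 1 / 4"
    using power_mono[of p "1 / 2" 2] assms by (simp_all add: power2_eq_square)
  obtain k0 where k0: "(1 - p\<^sup>2 / 128) ^ k0 < 1 / 4"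
    using real_arch_pow_inv[of "1 / 4" "1 - p\<^sup>2 / 128"] p2 by auto
  \<comment> \<open>The first entry lets the exposed columns outweigh the rank loss, the second
    ensures \<open>16 \<le> \<gamma> * p^2\<close>.\<close>
  define \<gamma>0 where "\<gamma>0 = max (16 * k0) (nat \<lceil>16 / p\<^sup>2\<rceil>)"
  show ?thesis
  proof (rule exI[of _ c], rule exI[of _ \<gamma>0], rule exI[of _ D0], intro allI impI, elim conjE)
    fix \<gamma> d :: nat
    assume \<gamma>: "0 < \<gamma>" "\<gamma>0 \<le> \<gamma>" and d: "0 < d" "\<gamma> dvd d" "real D0 \<le> real d / real \<gamma>"
    obtain e where e: "d = \<gamma> * e" using d by blast
    have e0: "0 < e" using d e by (cases e) auto
    have g1: "16 \<le> real \<gamma> * p\<^sup>2"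
    proof -
      have "16 / p\<^sup>2 \<le> real (nat \<lceil>16 / p\<^sup>2\<rceil>)" by (rule real_nat_ceiling_ge)
      also have "\<dots> \<le> real \<gamma>" using \<gamma>(2) unfolding \<gamma>0_def by (metis max.bounded_iff of_nat_le_iff)
      finally show ?thesis using p2 by (simp add: pos_divide_le_eq)
    qed
    have g2: "(1 - p\<^sup>2 / 128) ^ (\<gamma> div 16) \<le> 1 / 4"
    proof -
      have "k0 \<le> \<gamma> div 16" using \<gamma> by (simp add: \<gamma>0_def less_eq_div_iff_mult_less_eq)
      then have "(1 - p\<^sup>2 / 128) ^ (\<gamma> div 16) \<le> (1 - p\<^sup>2 / 128) ^ k0"
        using p2 by (intro power_decreasing) auto
      then show ?thesis using k0 by simp
    qed
    have g64: "64 \<le> \<gamma>"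
    proof -
      have "real \<gamma> * p\<^sup>2 \<le> real \<gamma> * (1 / 4)" using p2 by (intro mult_left_mono) auto
      then show ?thesis using g1 by simp
    qed
    have d2: "2 \<le> d" using g64 e e0 by (cases e) auto
    have ed: "D0 \<le> d"
    proof -
      have "D0 \<le> e" using d(3) \<gamma> e by simp
      also have "e \<le> d" using e \<gamma> by simp
      finally show ?thesis .
    qed
    define \<phi> where "\<phi> n = sqrt (kernel_bound p d (n div \<gamma>))" for n
    define \<psi> where "\<psi> n = 1 / sqrt (real (n div \<gamma>))" for n
    note div_top = filterlim_div_const_at_top[OF \<gamma>(1)]
    have \<phi>: "\<phi> \<longlonglongrightarrow> 0"
      using tendsto_real_sqrt[OF filterlim_compose[OF kernel_bound_tendsto_0[OF assms(1), of d] div_top]]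
      by (simp add: \<phi>_def[abs_def])
    have dev: "(\<lambda>n. deviation_bound e d (n div \<gamma>)) \<longlonglongrightarrow> 0"
      by (rule filterlim_compose[OF deviation_bound_tendsto_0 div_top])
    have \<psi>: "\<psi> \<longlonglongrightarrow> 0"
      unfolding \<psi>_def[abs_def]
      by (intro tendsto_divide_0[OF tendsto_const] filterlim_at_top_imp_at_infinity
          filterlim_compose[OF sqrt_at_top filterlim_compose[OF filterlim_real_sequentially div_top]])
    have "(\<lambda>n. \<phi> n + deviation_bound e d (n div \<gamma>)) \<longlonglongrightarrow> 0 + 0" by (intro tendsto_add \<phi> dev)
    then have ev1: "\<forall>\<^sub>F n in sequentially. \<phi> n + deviation_bound e d (n div \<gamma>) < 1 / 2"
      by (rule order_tendstoD) simp
    have "filterlim (\<lambda>n. real (n div \<gamma>)) at_top sequentially"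
      by (rule filterlim_compose[OF filterlim_real_sequentially div_top])
    then have ev2: "\<forall>\<^sub>F n in sequentially. 64 * real e ^ 2 / p\<^sup>2 \<le> real (n div \<gamma>)"
      unfolding filterlim_at_top by blast
    obtain n0 where n0: "\<And>n. n0 \<le> n \<Longrightarrow> \<phi> n + deviation_bound e d (n div \<gamma>) < 1 / 2"
      "\<And>n. n0 \<le> n \<Longrightarrow> 64 * real e ^ 2 / p\<^sup>2 \<le> real (n div \<gamma>)"
      using eventually_conj[OF ev1 ev2] unfolding eventually_sequentially by blast
    have \<eta>: "exp 3 * p ^ d \<le> p powr (real d - c * ln (real d))"
    proof -
      have lp: "0 < ln (1 / p)" using assms by simp
      have "p powr (real d - c * ln (real d)) = p ^ d * exp (c * ln (1 / p) * ln d)"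
        using assms by (simp add: powr_diff powr_realpow powr_def[of p "c * ln (real d)"] ln_div exp_minus field_simps)
      also have "c * ln (1 / p) = 3 / ln 2" using lp by (simp add: c_def)
      finally have eq: "p powr (real d - c * ln (real d)) = p ^ d * exp (3 / ln 2 * ln d)" .
      have "ln 2 \<le> ln (real d)" using d2 by simp
      then have "3 \<le> 3 / ln 2 * ln (real d)" by (simp add: field_simps)
      then have "p ^ d * exp 3 \<le> p ^ d * exp (3 / ln 2 * ln d)"
        using assms by (intro mult_left_mono) auto
      then show ?thesis unfolding eq by (simp add: mult.commute)
    qed
    \<comment> \<open>Below \<open>n0\<close>, which may depend on \<open>\<gamma>\<close> and
      \<open>d\<close>, error terms equal to 1 make the claim trivial, so that one
      \<open>\<delta>\<close> serves all \<open>n\<close>.\<close>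
    define \<epsilon>1 where "\<epsilon>1 n = (if n < n0 then 1 else \<phi> n)" for n
    define \<epsilon>2 where "\<epsilon>2 n = (if n < n0 then 1 else \<psi> n)" for n
    have \<epsilon>: "\<epsilon>1 \<longlonglongrightarrow> 0" "\<epsilon>2 \<longlonglongrightarrow> 0"
    proof -
      have "\<forall>\<^sub>F n in sequentially. \<epsilon>1 n = \<phi> n" "\<forall>\<^sub>F n in sequentially. \<epsilon>2 n = \<psi> n"
        using eventually_ge_at_top[of n0] by (eventually_elim; simp add: \<epsilon>1_def \<epsilon>2_def)+
      then show "\<epsilon>1 \<longlonglongrightarrow> 0" "\<epsilon>2 \<longlonglongrightarrow> 0" using \<phi> \<psi> by (simp_all add: tendsto_cong)
    qed
    show "\<exists>(\<delta>::real) (\<epsilon>1::nat \<Rightarrow> real) (\<epsilon>2::nat \<Rightarrow> real).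
      0 < \<delta> \<and> \<epsilon>1 \<longlonglongrightarrow> 0 \<and> \<epsilon>2 \<longlonglongrightarrow> 0 \<and>
      (\<forall>(n::nat) (k::nat). 0 < n \<and> \<gamma> dvd n \<and> real k = p * real n \<longrightarrow>
        \<delta> \<le> measure_pmf.prob (ABC_stacked \<gamma> n d)
          {B. 1 / real n * measure_pmf.expectation (pmf_of_set (subsets_of_card n k)) (err B)
                \<le> p powr (real d - c * ln (real d)) + \<epsilon>1 n
            \<and> 1 / real n * Max (err B ` subsets_of_card n k)
                \<le> 8 * real \<gamma> ^ 3 * p / real d + \<epsilon>2 n})"
    \<comment> \<open>The failure probability tends to 0, so 1/2 is merely a convenient constant;
      \<open>n0\<close> was chosen to match it.\<close>
    proof (rule exI[of _ "1 / 2"], rule exI[of _ \<epsilon>1], rule exI[of _ \<epsilon>2], intro conjI allI impI \<epsilon>)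
      fix n k :: nat
      assume nk: "0 < n \<and> \<gamma> dvd n \<and> real k = p * real n"
      then obtain m where m: "n = \<gamma> * m" by blast
      have m0: "0 < m" using nk m by (cases m) auto
      have nm: "n div \<gamma> = m" using m \<gamma> by simp
      let ?prob = "measure_pmf.prob (ABC_stacked \<gamma> n d)
          {B. 1 / real n * measure_pmf.expectation (pmf_of_set (subsets_of_card n k)) (err B)
                \<le> p powr (real d - c * ln (real d)) + \<epsilon>1 n
            \<and> 1 / real n * Max (err B ` subsets_of_card n k)
                \<le> 8 * real \<gamma> ^ 3 * p / real d + \<epsilon>2 n}"
      show "1 / 2 \<le> ?prob"
      proof (cases "n < n0")
        case True
        have "k \<le> \<gamma> * m" using proportion_le[of p k n] nk assms m by simp
        then have "?prob = 1"
          unfolding m e using True assms m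
          by (intro prob_ABC_stacked_trivial e0 \<gamma> m0) (auto simp: \<epsilon>1_def \<epsilon>2_def)
        then show ?thesis by simp
      next
        case False
        have "1 - (sqrt (kernel_bound p d m) + deviation_bound e d m) \<le> ?prob"
          using False nm prob_ABC_stacked_good_ge[OF assms e0 e d2 m0 D0[OF ed] g1 g2 _ _ \<eta>, of k] n0(2)[of n] nk p2
          unfolding \<epsilon>1_def \<epsilon>2_def \<phi>_def \<psi>_def
          by (simp add: m pos_divide_le_eq mult.commute)
        then show ?thesis using n0(1)[of n] False unfolding \<phi>_def nm by linarith
      qed
    qed simp
  qed
qed

end
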